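(* The category $\mathsf B$ carries a natural structure of symmetric monoidal category. Moreover, this structure is closed, complete, and cocomplete.
   Context: $\mathsf{Set}_*$ is the category of pointed sets, symmetric monoidal under the smash product $\wedge$ (unit the two-element pointed set $\mathbb S^0$). $\mathsf{Mon}_0$ is the category of commutative, associative and unitary monoids with absorbent object $0$, regarded as a symmetric monoidal category under the tensor product $\otimes$ of monoids, in such a way that its commutative monoid objects are the commutative, associative and unitary semirings. $|\cdot|:\mathsf{Mon}_0\to\mathsf{Set}_*$ is the forgetful functor, the base point of $|M|$ being the element corresponding to $0$; $\mathbb N[\cdot]:\mathsf{Set}_*\to\mathsf{Mon}_0$ is its left adjoint. The comma category $\mathbb N[\cdot]/\mathsf{Mon}_0$ has as objects the pairs $(X,\mathbb N[X]\to M)$ with $X\in\mathsf{Set}_*$, $M\in\mathsf{Mon}_0$; a morphism $(X,\mathbb N[X]\to M)\to(Y,\mathbb N[Y]\to N)$ is a pair $(f:X\to Y,\ g:M\to N)$ such that the square formed with $\mathbb N[f]$ commutes. $\mathsf B$ is the full subcategory of $\mathbb N[\cdot]/\mathsf{Mon}_0$ whose objects $(X,\mathbb N[X]\to M)$ satisfy: (a) the morphism $\mathbb N[X]\to M$ is surjective; (b) the composition $X\to|\mathbb N[X]|\to|M|$ is a monomorphism. The natural monoidal product on $\mathsf B$ is $(X,\mathbb N[X]\to M)\otimes(X',\mathbb N[X']\to M')=(X\wedge X',\ \mathbb N[X\wedge X']\to M\otimes M')$, where the map is the composition $\mathbb N[X\wedge X']\cong\mathbb N[X]\otimes\mathbb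 N[X']\to M\otimes M'$, the isomorphism sending $n(x,x')$ to $n\,x\otimes x'$. "Closed" means that there are internal homs, i.e. $-\otimes B$ has a right adjoint for every object $B$; "complete" and "cocomplete" mean that $\mathsf B$ has limits and colimits.
   Formalization: The stated product can violate (b) (Z/2 and Z/3 with points {0,1}), so the product on B is taken to be it with points of X∧X' having equal image in M⊗M' identified; it is the stated one whenever that lies in B. Sets, limits and colimits are small relative to a Grothendieck universe. *)

theory Defs
  imports "HOL-Library.Multiset" "HOL-Algebra.FiniteProduct"
begin

unbundle cardinal_syntax

section \<open>Categories\<close>

record ('o, 'a) cat =
  Ob :: "'o set"
  Arr :: "'a set"
  Dom :: "'a \<Rightarrow> 'o"
  Cod :: "'a \<Rightarrow> 'o"
  Ident :: "'o \<Rightarrow> 'a"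
  Comp :: "'a \<Rightarrow> 'a \<Rightarrow> 'a"  (infixr "\<cdot>\<index>" 65)

definition Hom :: "('o, 'a, 'x) cat_scheme \<Rightarrow> 'o \<Rightarrow> 'o \<Rightarrow> 'a set" where
  "Hom C A B = {f \<in> Arr C. Dom C f = A \<and> Cod C f = B}"

locale category =
  fixes C (structure)
  assumes dom_cod: "f \<in> Arr C \<Longrightarrow> Dom C f \<in> Ob C \<and> Cod C f \<in> Ob C"
    and ident: "A \<in> Ob C \<Longrightarrow> Ident C A \<in> Hom C A A"
    and comp: "f \<in> Hom C A B \<Longrightarrow> g \<in> Hom C B D \<Longrightarrow> g \<cdot> f \<in> Hom C A D"
    and comp_assoc:
      "f \<in> Hom C A B \<Longrightarrow> g \<in> Hom C B D \<Longrightarrow> h \<in> Hom C D E \<Longrightarrow> h \<cdot> (g \<cdot> f) = (h \<cdot> g) \<cdot> f"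
    and comp_ident_right: "f \<in> Hom C A B \<Longrightarrow> f \<cdot> Ident C A = f"
    and comp_ident_left: "f \<in> Hom C A B \<Longrightarrow> Ident C B \<cdot> f = f"

definition is_iso :: "('o, 'a, 'x) cat_scheme \<Rightarrow> 'a \<Rightarrow> bool" where
  "is_iso C f \<longleftrightarrow> f \<in> Arr C \<and>
     (\<exists>g \<in> Hom C (Cod C f) (Dom C f).
        g \<cdot>\<^bsub>C\<^esub> f = Ident C (Dom C f) \<and> f \<cdot>\<^bsub>C\<^esub> g = Ident C (Cod C f))"

definition full_subcategory :: "('o, 'a) cat \<Rightarrow> 'o set \<Rightarrow> ('o, 'a) cat" where
  "full_subcategory C S =
     C\<lparr>Ob := Ob C \<inter> S, Arr := {f \<in> Arr C. Dom C f \<in> S \<and> Cod C f \<in> S}\<rparr>"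

definition is_functor ::
  "('j, 'i, 'x) cat_scheme \<Rightarrow> ('o, 'a, 'y) cat_scheme \<Rightarrow> ('j \<Rightarrow> 'o) \<Rightarrow> ('i \<Rightarrow> 'a) \<Rightarrow> bool" where
  "is_functor J C Fo Fa \<longleftrightarrow>
     (\<forall>j \<in> Ob J. Fo j \<in> Ob C) \<and>
     (\<forall>j \<in> Ob J. \<forall>k \<in> Ob J. \<forall>f \<in> Hom J j k. Fa f \<in> Hom C (Fo j) (Fo k)) \<and>
     (\<forall>j \<in> Ob J. Fa (Ident J j) = Ident C (Fo j)) \<and>
     (\<forall>j \<in> Ob J. \<forall>k \<in> Ob J. \<forall>l \<in> Ob J. \<forall>f \<in> Hom J j k. \<forall>g \<in> Hom J k l.
        Fa (g \<cdot>\<^bsub>J\<^esub> f) = Fa g \<cdot>\<^bsub>C\<^esub> Fa f)"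

text \<open>Existence of a functor \<open>G : D \<rightarrow> C\<close> and of a bijection \<open>D(F A, X) \<cong> C(A, G X)\<close>, natural
  in \<open>A\<close> and \<open>X\<close>.\<close>

definition has_right_adjoint ::
  "('o, 'a, 'x) cat_scheme \<Rightarrow> ('p, 'b, 'y) cat_scheme \<Rightarrow> ('o \<Rightarrow> 'p) \<Rightarrow> ('a \<Rightarrow> 'b) \<Rightarrow> bool" where
  "has_right_adjoint C D Fo Fa \<longleftrightarrow>
     (\<exists>Go Ga \<phi>. is_functor D C Go Ga \<and>
        (\<forall>A \<in> Ob C. \<forall>X \<in> Ob D. bij_betw (\<phi> A X) (Hom D (Fo A) X) (Hom C A (Go X))) \<and>
        (\<forall>A \<in> Ob C. \<forall>A' \<in> Ob C. \<forall>X \<in> Ob D. \<forall>X' \<in> Ob D.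
           \<forall>h \<in> Hom C A' A. \<forall>f \<in> Hom D (Fo A) X. \<forall>k \<in> Hom D X X'.
             \<phi> A' X' (k \<cdot>\<^bsub>D\<^esub> f \<cdot>\<^bsub>D\<^esub> Fa h) = Ga k \<cdot>\<^bsub>C\<^esub> \<phi> A X f \<cdot>\<^bsub>C\<^esub> h))"

subsection \<open>Limits and colimits\<close>

definition cone ::
  "('j, 'i, 'x) cat_scheme \<Rightarrow> ('o, 'a, 'y) cat_scheme \<Rightarrow> ('j \<Rightarrow> 'o) \<Rightarrow> ('i \<Rightarrow> 'a)
    \<Rightarrow> 'o \<Rightarrow> ('j \<Rightarrow> 'a) \<Rightarrow> bool" where
  "cone J C Fo Fa L \<pi> \<longleftrightarrow> L \<in> Ob C \<and> (\<forall>j \<in> Ob J. \<pi> j \<in> Hom C L (Fo j)) \<and>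
     (\<forall>f \<in> Arr J. Fa f \<cdot>\<^bsub>C\<^esub> \<pi> (Dom J f) = \<pi> (Cod J f))"

definition is_limit ::
  "('j, 'i, 'x) cat_scheme \<Rightarrow> ('o, 'a, 'y) cat_scheme \<Rightarrow> ('j \<Rightarrow> 'o) \<Rightarrow> ('i \<Rightarrow> 'a)
    \<Rightarrow> 'o \<Rightarrow> ('j \<Rightarrow> 'a) \<Rightarrow> bool" where
  "is_limit J C Fo Fa L \<pi> \<longleftrightarrow> cone J C Fo Fa L \<pi> \<and>
     (\<forall>L' \<pi>'. cone J C Fo Fa L' \<pi>' \<longrightarrow>
        (\<exists>!u. u \<in> Hom C L' L \<and> (\<forall>j \<in> Ob J. \<pi> j \<cdot>\<^bsub>C\<^esub> u = \<pi>' j)))"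

definition cocone ::
  "('j, 'i, 'x) cat_scheme \<Rightarrow> ('o, 'a, 'y) cat_scheme \<Rightarrow> ('j \<Rightarrow> 'o) \<Rightarrow> ('i \<Rightarrow> 'a)
    \<Rightarrow> 'o \<Rightarrow> ('j \<Rightarrow> 'a) \<Rightarrow> bool" where
  "cocone J C Fo Fa L \<iota> \<longleftrightarrow> L \<in> Ob C \<and> (\<forall>j \<in> Ob J. \<iota> j \<in> Hom C (Fo j) L) \<and>
     (\<forall>f \<in> Arr J. \<iota> (Cod J f) \<cdot>\<^bsub>C\<^esub> Fa f = \<iota> (Dom J f))"

definition is_colimit ::
  "('j, 'i, 'x) cat_scheme \<Rightarrow> ('o, 'a, 'y) cat_scheme \<Rightarrow> ('j \<Rightarrow> 'o) \<Rightarrow> ('i \<Rightarrow> 'a)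
    \<Rightarrow> 'o \<Rightarrow> ('j \<Rightarrow> 'a) \<Rightarrow> bool" where
  "is_colimit J C Fo Fa L \<iota> \<longleftrightarrow> cocone J C Fo Fa L \<iota> \<and>
     (\<forall>L' \<iota>'. cocone J C Fo Fa L' \<iota>' \<longrightarrow>
        (\<exists>!u. u \<in> Hom C L L' \<and> (\<forall>j \<in> Ob J. u \<cdot>\<^bsub>C\<^esub> \<iota> j = \<iota>' j)))"

text \<open>The type \<open>'u\<close> plays the role of a Grothendieck universe: its cardinality is a strongly
  inaccessible (in particular uncountable) cardinal, and a set is small if it has smaller
  cardinality. Every small set is in bijection with a small subset of \<open>'u\<close>, so it is enough to
  take diagrams indexed by small categories on \<open>'u\<close>.\<close>

definition inaccessible :: "'u itself \<Rightarrow> bool" where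
  "inaccessible U \<longleftrightarrow>
     |UNIV :: nat set| <o |UNIV :: 'u set| \<and> regularCard |UNIV :: 'u set| \<and>
     (\<forall>S :: 'u set. |S| <o |UNIV :: 'u set| \<longrightarrow> |Pow S| <o |UNIV :: 'u set| )"

definition small :: "'u itself \<Rightarrow> 'b set \<Rightarrow> bool" where
  "small U S \<longleftrightarrow> |S| <o |UNIV :: 'u set|"

definition small_category :: "'u itself \<Rightarrow> ('j, 'i, 'x) cat_scheme \<Rightarrow> bool" where
  "small_category U J \<longleftrightarrow> category J \<and> small U (Ob J) \<and> small U (Arr J)"

definition complete_category :: "'u itself \<Rightarrow> ('o, 'a, 'x) cat_scheme \<Rightarrow> bool" where
  "complete_category U C \<longleftrightarrow>
     (\<forall>(J :: ('u, 'u) cat) Fo Fa. small_category U J \<and> is_functor J C Fo Fa \<longrightarrow>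
        (\<exists>L \<pi>. is_limit J C Fo Fa L \<pi>))"

definition cocomplete_category :: "'u itself \<Rightarrow> ('o, 'a, 'x) cat_scheme \<Rightarrow> bool" where
  "cocomplete_category U C \<longleftrightarrow>
     (\<forall>(J :: ('u, 'u) cat) Fo Fa. small_category U J \<and> is_functor J C Fo Fa \<longrightarrow>
        (\<exists>L \<iota>. is_colimit J C Fo Fa L \<iota>))"

subsection \<open>Symmetric monoidal categories\<close>

record ('o, 'a) monoidal_cat = "('o, 'a) cat" +
  Tensor :: "'o \<Rightarrow> 'o \<Rightarrow> 'o"  (infixr "\<odot>\<index>" 75)
  TensorA :: "'a \<Rightarrow> 'a \<Rightarrow> 'a"  (infixr "\<odot>\<^sub>a\<index>" 75)
  Unit :: "'o"
  Assoc :: "'o \<Rightarrow> 'o \<Rightarrow> 'o \<Rightarrow> 'a"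
  LUnit :: "'o \<Rightarrow> 'a"
  RUnit :: "'o \<Rightarrow> 'a"
  Braid :: "'o \<Rightarrow> 'o \<Rightarrow> 'a"

locale symmetric_monoidal_category = category +
  assumes tensor_ob: "A \<in> Ob C \<Longrightarrow> B \<in> Ob C \<Longrightarrow> A \<odot> B \<in> Ob C"
    and tensor_arr:
      "f \<in> Hom C A B \<Longrightarrow> g \<in> Hom C A' B' \<Longrightarrow> f \<odot>\<^sub>a g \<in> Hom C (A \<odot> A') (B \<odot> B')"
    and tensor_ident:
      "A \<in> Ob C \<Longrightarrow> B \<in> Ob C \<Longrightarrow> Ident C A \<odot>\<^sub>a Ident C B = Ident C (A \<odot> B)"
    and tensor_comp:
      "f \<in> Hom C A B \<Longrightarrow> g \<in> Hom C B D \<Longrightarrow> f' \<in> Hom C A' B' \<Longrightarrow> g' \<in> Hom C B' D' \<Longrightarrow>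
       (g \<cdot> f) \<odot>\<^sub>a (g' \<cdot> f') = (g \<odot>\<^sub>a g') \<cdot> (f \<odot>\<^sub>a f')"
    and unit_ob: "Unit C \<in> Ob C"
    and assoc_iso:
      "A \<in> Ob C \<Longrightarrow> B \<in> Ob C \<Longrightarrow> D \<in> Ob C \<Longrightarrow>
       Assoc C A B D \<in> Hom C ((A \<odot> B) \<odot> D) (A \<odot> (B \<odot> D)) \<and> is_iso C (Assoc C A B D)"
    and assoc_natural:
      "f \<in> Hom C A A' \<Longrightarrow> g \<in> Hom C B B' \<Longrightarrow> h \<in> Hom C D D' \<Longrightarrow>
       Assoc C A' B' D' \<cdot> ((f \<odot>\<^sub>a g) \<odot>\<^sub>a h) = (f \<odot>\<^sub>a (g \<odot>\<^sub>a h)) \<cdot> Assoc C A B D"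
    and lunit_iso:
      "A \<in> Ob C \<Longrightarrow> LUnit C A \<in> Hom C (Unit C \<odot> A) A \<and> is_iso C (LUnit C A)"
    and lunit_natural:
      "f \<in> Hom C A B \<Longrightarrow> LUnit C B \<cdot> (Ident C (Unit C) \<odot>\<^sub>a f) = f \<cdot> LUnit C A"
    and runit_iso:
      "A \<in> Ob C \<Longrightarrow> RUnit C A \<in> Hom C (A \<odot> Unit C) A \<and> is_iso C (RUnit C A)"
    and runit_natural:
      "f \<in> Hom C A B \<Longrightarrow> RUnit C B \<cdot> (f \<odot>\<^sub>a Ident C (Unit C)) = f \<cdot> RUnit C A"
    and braid_iso:
      "A \<in> Ob C \<Longrightarrow> B \<in> Ob C \<Longrightarrow> Braid C A B \<in> Hom C (A \<odot> B) (B \<odot> A) \<and> is_iso C (Braid C A B)"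
    and braid_natural:
      "f \<in> Hom C A A' \<Longrightarrow> g \<in> Hom C B B' \<Longrightarrow>
       Braid C A' B' \<cdot> (f \<odot>\<^sub>a g) = (g \<odot>\<^sub>a f) \<cdot> Braid C A B"
    and pentagon:
      "A \<in> Ob C \<Longrightarrow> B \<in> Ob C \<Longrightarrow> D \<in> Ob C \<Longrightarrow> E \<in> Ob C \<Longrightarrow>
       Assoc C A B (D \<odot> E) \<cdot> Assoc C (A \<odot> B) D E =
       (Ident C A \<odot>\<^sub>a Assoc C B D E) \<cdot> Assoc C A (B \<odot> D) E \<cdot> (Assoc C A B D \<odot>\<^sub>a Ident C E)"
    and triangle:
      "A \<in> Ob C \<Longrightarrow> B \<in> Ob C \<Longrightarrow>
       (Ident C A \<odot>\<^sub>a LUnit C B) \<cdot> Assoc C A (Unit C) B = RUnit C A \<odot>\<^sub>a Ident C B"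
    and hexagon:
      "A \<in> Ob C \<Longrightarrow> B \<in> Ob C \<Longrightarrow> D \<in> Ob C \<Longrightarrow>
       Assoc C B D A \<cdot> Braid C A (B \<odot> D) \<cdot> Assoc C A B D =
       (Ident C B \<odot>\<^sub>a Braid C A D) \<cdot> Assoc C B A D \<cdot> (Braid C A B \<odot>\<^sub>a Ident C D)"
    and symmetry:
      "A \<in> Ob C \<Longrightarrow> B \<in> Ob C \<Longrightarrow> Braid C B A \<cdot> Braid C A B = Ident C (A \<odot> B)"

definition monoidal_closed :: "('o, 'a, 'x) monoidal_cat_scheme \<Rightarrow> bool" where
  "monoidal_closed C \<longleftrightarrow>
     (\<forall>B \<in> Ob C. has_right_adjoint C C (\<lambda>A. A \<odot>\<^bsub>C\<^esub> B) (\<lambda>f. f \<odot>\<^sub>a\<^bsub>C\<^esub> Ident C B))"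


section \<open>Pointed sets and monoids\<close>

record 'a pset =
  pts :: "'a set"
  bpt :: "'a"

definition pointed_set :: "'a pset \<Rightarrow> bool" where
  "pointed_set X \<longleftrightarrow> bpt X \<in> pts X"

definition pset_hom :: "'a pset \<Rightarrow> 'b pset \<Rightarrow> ('a \<Rightarrow> 'b) set" where
  "pset_hom X Y = {f \<in> pts X \<rightarrow>\<^sub>E pts Y. f (bpt X) = bpt Y}"

definition pset_mono :: "'a pset \<Rightarrow> 'b pset \<Rightarrow> ('a \<Rightarrow> 'b) \<Rightarrow> bool" where
  "pset_mono X Y i \<longleftrightarrow> i \<in> pset_hom X Y \<and>
     (\<forall>Z :: 'a pset. \<forall>g \<in> pset_hom Z X. \<forall>h \<in> pset_hom Z X. pointed_set Z \<longrightarrow>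
        compose (pts Z) i g = compose (pts Z) i h \<longrightarrow> g = h)"

lemma pset_mono_iff_inj:
  assumes "pointed_set X"
  shows "pset_mono X Y i \<longleftrightarrow> i \<in> pset_hom X Y \<and> inj_on i (pts X)"
proof
  assume m: "pset_mono X Y i"
  have i: "i \<in> pset_hom X Y" using m by (simp add: pset_mono_def)
  have "inj_on i (pts X)"
  proof (rule inj_onI)
    fix x y assume x: "x \<in> pts X" and y: "y \<in> pts X" and e: "i x = i y"
    show "x = y"
    proof (rule ccontr)
      assume n: "x \<noteq> y"
      obtain z where z: "z \<noteq> bpt X" using n by metis
      define Z where "Z = \<lparr>pts = {bpt X, z}, bpt = bpt X\<rparr>"
      define k where "k w = (\<lambda>a \<in> {bpt X, z}. if a = z then w else bpt X)" for w
      have k: "k w \<in> pset_hom Z X" if "w \<in> pts X" for w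
        using that assms z by (auto simp: pset_hom_def Z_def k_def pointed_set_def)
      have "compose (pts Z) i (k x) = compose (pts Z) i (k y)"
        using e by (auto simp: compose_def Z_def k_def fun_eq_iff restrict_def)
      moreover have "pointed_set Z" by (simp add: pointed_set_def Z_def)
      ultimately have "k x = k y"
        using m k x y unfolding pset_mono_def by blast
      then have "k x z = k y z" by simp
      then show False using n by (simp add: k_def)
    qed
  qed
  with i show "i \<in> pset_hom X Y \<and> inj_on i (pts X)" ..
next
  assume a: "i \<in> pset_hom X Y \<and> inj_on i (pts X)"
  have "g = h" if "g \<in> pset_hom Z X" "h \<in> pset_hom Z X"
    "compose (pts Z) i g = compose (pts Z) i h" for Z :: "'a pset" and g h
  proof (rule extensionalityI)
    show "g \<in> extensional (pts Z)" "h \<in> extensional (pts Z)"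
      using that by (auto simp: pset_hom_def PiE_def)
    fix z assume z: "z \<in> pts Z"
    then have "i (g z) = i (h z)" using fun_cong[OF that(3), of z] by (simp add: compose_def)
    moreover have "g z \<in> pts X" "h z \<in> pts X" using that z by (auto simp: pset_hom_def)
    ultimately show "g z = h z" using a by (auto dest: inj_onD)
  qed
  with a show "pset_mono X Y i" by (auto simp: pset_mono_def)
qed

text \<open>The objects of \<open>Mon\<^sub>0\<close>, whose monoid objects are semirings, are the (additive) commutative
  monoids with neutral element 0; they are rendered by the locale \<^locale>\<open>comm_monoid\<close>, whose
  multiplicative notation \<open>\<otimes>\<close>, \<open>\<one>\<close> stands for \<open>+\<close>, \<open>0\<close>.\<close>

definition mon_hom :: "('a, 'x) monoid_scheme \<Rightarrow> ('b, 'y) monoid_scheme \<Rightarrow> ('a \<Rightarrow> 'b) set" where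
  "mon_hom M N = {h \<in> hom M N \<inter> extensional (carrier M). h \<one>\<^bsub>M\<^esub> = \<one>\<^bsub>N\<^esub>}"

definition underlying :: "('a, 'x) monoid_scheme \<Rightarrow> 'a pset" where
  "underlying M = \<lparr>pts = carrier M, bpt = \<one>\<^bsub>M\<^esub>\<rparr>"

text \<open>\<open>\<nat>[X]\<close>: formal sums of elements of \<open>X\<close>, the base point being 0.\<close>

definition free_mon :: "'a pset \<Rightarrow> 'a multiset monoid" where
  "free_mon X = \<lparr>carrier = {m. set_mset m \<subseteq> pts X - {bpt X}}, monoid.mult = (+), one = {#}\<rparr>"

definition free_unit :: "'a pset \<Rightarrow> 'a \<Rightarrow> 'a multiset" where
  "free_unit X = (\<lambda>x \<in> pts X. if x = bpt X then {#} else {#x#})"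

definition free_map :: "'a pset \<Rightarrow> 'b pset \<Rightarrow> ('a \<Rightarrow> 'b) \<Rightarrow> 'a multiset \<Rightarrow> 'b multiset" where
  "free_map X Y f = (\<lambda>m \<in> carrier (free_mon X). \<Sum>x \<in># m. free_unit Y (f x))"

lemma comm_monoid_free_mon: "comm_monoid (free_mon X)"
  by unfold_locales (auto simp: free_mon_def ac_simps)

lemma free_unit_hom: "pointed_set X \<Longrightarrow> free_unit X \<in> pset_hom X (underlying (free_mon X))"
  by (auto simp: free_unit_def pset_hom_def underlying_def free_mon_def pointed_set_def)

text \<open>\<open>\<nat>[\<sqdot>]\<close> is left adjoint to \<open>|\<sqdot>|\<close>.\<close>

lemma free_mon_universal:
  assumes X: "pointed_set X" and N: "comm_monoid N" and f: "f \<in> pset_hom X (underlying N)"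
  shows "\<exists>!h. h \<in> mon_hom (free_mon X) N \<and> (\<forall>x \<in> pts X. h (free_unit X x) = f x)"
proof -
  interpret N: comm_monoid N by fact
  have fin: "f x \<in> carrier N" if "x \<in> pts X" for x
    using f that by (auto simp: pset_hom_def underlying_def)
  define h where "h = (\<lambda>m \<in> carrier (free_mon X).
    finprod N (\<lambda>x. f x [^]\<^bsub>N\<^esub> count m x) (set_mset m))"
  have hfin: "h m = finprod N (\<lambda>x. f x [^]\<^bsub>N\<^esub> count m x) S"
    if "finite S" "set_mset m \<subseteq> S" "S \<subseteq> pts X - {bpt X}" for m S
  proof -
    have "finprod N (\<lambda>x. f x [^]\<^bsub>N\<^esub> count m x) S = finprod N (\<lambda>x. f x [^]\<^bsub>N\<^esub> count m x) (set_mset m)"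
      using that fin by (intro N.finprod_mono_neutral_cong_right)
        (auto simp: Pi_iff not_in_iff)
    then show ?thesis using that by (auto simp: h_def free_mon_def)
  qed
  have h1: "h {#} = \<one>\<^bsub>N\<^esub>" by (simp add: h_def free_mon_def)
  have hx: "h {#x#} = f x" if "x \<in> pts X" "x \<noteq> bpt X" for x
    using that fin by (simp add: hfin[of "{x}"])
  have hadd: "h (m + n) = h m \<otimes>\<^bsub>N\<^esub> h n"
    if "set_mset m \<subseteq> pts X - {bpt X}" "set_mset n \<subseteq> pts X - {bpt X}" for m n
  proof -
    let ?S = "set_mset m \<union> set_mset n"
    have c: "\<And>x. x \<in> ?S \<Longrightarrow> f x \<in> carrier N" using that fin by auto
    have "h (m + n) = finprod N (\<lambda>x. f x [^]\<^bsub>N\<^esub> count (m + n) x) ?S"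
      using that by (intro hfin) auto
    also have "\<dots> = finprod N (\<lambda>x. f x [^]\<^bsub>N\<^esub> count m x \<otimes>\<^bsub>N\<^esub> f x [^]\<^bsub>N\<^esub> count n x) ?S"
      using c by (intro N.finprod_cong') (simp_all add: N.nat_pow_mult Pi_iff)
    also have "\<dots> = finprod N (\<lambda>x. f x [^]\<^bsub>N\<^esub> count m x) ?S \<otimes>\<^bsub>N\<^esub>
        finprod N (\<lambda>x. f x [^]\<^bsub>N\<^esub> count n x) ?S"
      using c by (intro N.finprod_multf) auto
    also have "\<dots> = h m \<otimes>\<^bsub>N\<^esub> h n"
      using that by (simp add: hfin[of ?S m] hfin[of ?S n] Un_least)
    finally show ?thesis .
  qed
  have hc: "h m \<in> carrier N" if "set_mset m \<subseteq> pts X - {bpt X}" for m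
    using that fin by (auto simp: h_def free_mon_def intro!: N.finprod_closed)
  have hh: "h \<in> mon_hom (free_mon X) N"
    using hc hadd h1 by (auto simp: mon_hom_def hom_def free_mon_def) (auto simp: h_def free_mon_def)
  have hu: "h (free_unit X x) = f x" if "x \<in> pts X" for x
    using that h1 hx f by (auto simp: free_unit_def pset_hom_def underlying_def)
  show ?thesis
  proof (intro ex1I[of _ h] conjI ballI hh hu)
    fix k assume k: "k \<in> mon_hom (free_mon X) N \<and> (\<forall>x \<in> pts X. k (free_unit X x) = f x)"
    have kx: "k {#x#} = f x" if "x \<in> pts X" "x \<noteq> bpt X" for x
      using k that by (auto simp: free_unit_def split: if_splits)
    have "k m = h m" if "set_mset m \<subseteq> pts X - {bpt X}" for m
      using that
    proof (induction m)
      case empty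
      then show ?case using k h1 by (simp add: mon_hom_def free_mon_def)
    next
      case (add x m)
      have "k ({#x#} + m) = k {#x#} \<otimes>\<^bsub>N\<^esub> k m"
        using k add.prems unfolding mon_hom_def hom_def free_mon_def
        by (auto simp del: union_mset_add_mset_left)
      moreover have "h ({#x#} + m) = h {#x#} \<otimes>\<^bsub>N\<^esub> h m" using add.prems by (intro hadd) auto
      ultimately show ?case using add hx kx by simp
    qed
    then show "k = h"
      using k hh by (intro extensionalityI[where A = "carrier (free_mon X)"])
        (auto simp: mon_hom_def free_mon_def)
  qed
qed

definition smash :: "'a pset \<Rightarrow> 'b pset \<Rightarrow> ('a \<times> 'b) pset" where
  "smash X Y = \<lparr>pts = insert (bpt X, bpt Y) ((pts X - {bpt X}) \<times> (pts Y - {bpt Y})),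
                bpt = (bpt X, bpt Y)\<rparr>"

text \<open>The quotient map \<open>X \<times> Y \<rightarrow> X \<and> Y\<close>.\<close>

definition smash_pair :: "'a pset \<Rightarrow> 'b pset \<Rightarrow> 'a \<Rightarrow> 'b \<Rightarrow> 'a \<times> 'b" where
  "smash_pair X Y x y = (if x = bpt X \<or> y = bpt Y then (bpt X, bpt Y) else (x, y))"

definition sphere0 :: "bool pset" where
  "sphere0 = \<lparr>pts = UNIV, bpt = False\<rparr>"

text \<open>The tensor product of commutative monoids: the monoid of formal sums of pairs modulo
  the congruence generated by biadditivity.\<close>

inductive tensor_eq :: "('a, 'x) monoid_scheme \<Rightarrow> ('b, 'y) monoid_scheme
    \<Rightarrow> ('a \<times> 'b) multiset \<Rightarrow> ('a \<times> 'b) multiset \<Rightarrow> bool"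
  for M :: "('a, 'x) monoid_scheme" and N :: "('b, 'y) monoid_scheme" where
  refl: "set_mset s \<subseteq> carrier M \<times> carrier N \<Longrightarrow> tensor_eq M N s s"
| sym: "tensor_eq M N s t \<Longrightarrow> tensor_eq M N t s"
| trans: "tensor_eq M N s t \<Longrightarrow> tensor_eq M N t u \<Longrightarrow> tensor_eq M N s u"
| add: "tensor_eq M N s t \<Longrightarrow> tensor_eq M N s' t' \<Longrightarrow> tensor_eq M N (s + s') (t + t')"
| add_left: "a \<in> carrier M \<Longrightarrow> a' \<in> carrier M \<Longrightarrow> b \<in> carrier N \<Longrightarrow>
    tensor_eq M N {#(a \<otimes>\<^bsub>M\<^esub> a', b)#} {#(a, b), (a', b)#}"
| add_right: "a \<in> carrier M \<Longrightarrow> b \<in> carrier N \<Longrightarrow> b' \<in> carrier N \<Longrightarrow>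
    tensor_eq M N {#(a, b \<otimes>\<^bsub>N\<^esub> b')#} {#(a, b), (a, b')#}"
| zero_left: "b \<in> carrier N \<Longrightarrow> tensor_eq M N {#(\<one>\<^bsub>M\<^esub>, b)#} {#}"
| zero_right: "a \<in> carrier M \<Longrightarrow> tensor_eq M N {#(a, \<one>\<^bsub>N\<^esub>)#} {#}"

lemma tensor_eq_map:
  assumes "tensor_eq M N s t" "g \<in> mon_hom M M'" "h \<in> mon_hom N N'"
  shows "tensor_eq M' N' (image_mset (map_prod g h) s) (image_mset (map_prod g h) t)"
proof -
  have g: "g a \<in> carrier M'" "g (a \<otimes>\<^bsub>M\<^esub> a') = g a \<otimes>\<^bsub>M'\<^esub> g a'" "g \<one>\<^bsub>M\<^esub> = \<one>\<^bsub>M'\<^esub>"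
    if "a \<in> carrier M" "a' \<in> carrier M" for a a'
    using that assms by (auto simp: mon_hom_def hom_def)
  have h: "h b \<in> carrier N'" "h (b \<otimes>\<^bsub>N\<^esub> b') = h b \<otimes>\<^bsub>N'\<^esub> h b'" "h \<one>\<^bsub>N\<^esub> = \<one>\<^bsub>N'\<^esub>"
    if "b \<in> carrier N" "b' \<in> carrier N" for b b'
    using that assms by (auto simp: mon_hom_def hom_def)
  have one: "g \<one>\<^bsub>M\<^esub> = \<one>\<^bsub>M'\<^esub>" "h \<one>\<^bsub>N\<^esub> = \<one>\<^bsub>N'\<^esub>"
    using assms by (auto simp: mon_hom_def)
  show ?thesis
    using assms(1)
  proof (induction rule: tensor_eq.induct)
    case (refl s)
    then show ?case using g h by (intro tensor_eq.refl) auto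
  next
    case (trans s t u)
    then show ?case by (blast intro: tensor_eq.trans)
  qed (use g h one in \<open>auto intro: tensor_eq.sym tensor_eq.add tensor_eq.add_left tensor_eq.add_right
        tensor_eq.zero_left tensor_eq.zero_right\<close>)
qed

definition tensor_rel :: "('a, 'x) monoid_scheme \<Rightarrow> ('b, 'y) monoid_scheme
    \<Rightarrow> (('a \<times> 'b) multiset \<times> ('a \<times> 'b) multiset) set" where
  "tensor_rel M N = {(s, t). tensor_eq M N s t}"

definition tensor_mon :: "('a, 'x) monoid_scheme \<Rightarrow> ('b, 'y) monoid_scheme
    \<Rightarrow> ('a \<times> 'b) multiset set monoid" where
  "tensor_mon M N =
     \<lparr>carrier = {s. set_mset s \<subseteq> carrier M \<times> carrier N} // tensor_rel M N,
      monoid.mult = (\<lambda>c d. tensor_rel M N `` {s + t | s t. s \<in> c \<and> t \<in> d}),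
      one = tensor_rel M N `` {{#}}\<rparr>"

definition tensor_hom :: "('a, 'x) monoid_scheme \<Rightarrow> ('b, 'y) monoid_scheme
    \<Rightarrow> ('c, 'z) monoid_scheme \<Rightarrow> ('d, 'w) monoid_scheme
    \<Rightarrow> ('a \<Rightarrow> 'c) \<Rightarrow> ('b \<Rightarrow> 'd) \<Rightarrow> ('a \<times> 'b) multiset set \<Rightarrow> ('c \<times> 'd) multiset set" where
  "tensor_hom M N M' N' g h =
     (\<lambda>c \<in> carrier (tensor_mon M N). tensor_rel M' N' `` (image_mset (map_prod g h) ` c))"

text \<open>The isomorphism \<open>\<nat>[X \<and> Y] \<cong> \<nat>[X] \<otimes> \<nat>[Y]\<close>, \<open>n (x, y) \<mapsto> n x \<otimes> y\<close>.\<close>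

definition free_smash :: "'a pset \<Rightarrow> 'b pset
    \<Rightarrow> ('a \<times> 'b) multiset \<Rightarrow> ('a multiset \<times> 'b multiset) multiset set" where
  "free_smash X Y = (\<lambda>m \<in> carrier (free_mon (smash X Y)).
     tensor_rel (free_mon X) (free_mon Y) `` {image_mset (map_prod (free_unit X) (free_unit Y)) m})"


section \<open>The comma category and its subcategory B\<close>

record ('a, 'b) cobj =
  pset_of :: "'a pset"
  mon_of :: "'b monoid"
  str :: "'a multiset \<Rightarrow> 'b"

text \<open>Objects, morphisms and products of the comma category are introduced for arbitrary
  carrier types, so that \<open>X \<and> X'\<close> and \<open>M \<otimes> M'\<close> need not be encoded in \<open>'u\<close>.\<close>

definition comma_obj :: "('a, 'b) cobj \<Rightarrow> bool" where
  "comma_obj A \<longleftrightarrow> pointed_set (pset_of A) \<and> comm_monoid (mon_of A) \<and>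
     str A \<in> mon_hom (free_mon (pset_of A)) (mon_of A)"

definition comma_hom :: "('a, 'b) cobj \<Rightarrow> ('c, 'd) cobj \<Rightarrow> (('a \<Rightarrow> 'c) \<times> ('b \<Rightarrow> 'd)) set" where
  "comma_hom A B =
     {(f, g). f \<in> pset_hom (pset_of A) (pset_of B) \<and> g \<in> mon_hom (mon_of A) (mon_of B) \<and>
        (\<forall>m \<in> carrier (free_mon (pset_of A)).
           g (str A m) = str B (free_map (pset_of A) (pset_of B) f m))}"

datatype ('a, 'b) carrow =
  CArrow (src: "('a, 'b) cobj") (tgt: "('a, 'b) cobj") (pmap: "'a \<Rightarrow> 'a") (mmap: "'b \<Rightarrow> 'b")

definition small_cobj :: "'u itself \<Rightarrow> ('a, 'b) cobj \<Rightarrow> bool" where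
  "small_cobj U A \<longleftrightarrow> small U (pts (pset_of A)) \<and> small U (carrier (mon_of A))"

definition comma_category :: "(('u, 'u) cobj, ('u, 'u) carrow) cat" where
  "comma_category =
     \<lparr>Ob = {A. comma_obj A \<and> small_cobj TYPE('u) A},
      Arr = {h. comma_obj (src h) \<and> small_cobj TYPE('u) (src h) \<and>
                comma_obj (tgt h) \<and> small_cobj TYPE('u) (tgt h) \<and>
                (pmap h, mmap h) \<in> comma_hom (src h) (tgt h)},
      Dom = src,
      Cod = tgt,
      Ident = (\<lambda>A. CArrow A A (restrict id (pts (pset_of A))) (restrict id (carrier (mon_of A)))),
      Comp = (\<lambda>k h. CArrow (src h) (tgt k)
                (compose (pts (pset_of (src h))) (pmap k) (pmap h))
                (compose (carrier (mon_of (src h))) (mmap k) (mmap h)))\<rparr>"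

definition surjective_obj :: "('a, 'b) cobj \<Rightarrow> bool" where
  "surjective_obj A \<longleftrightarrow> str A ` carrier (free_mon (pset_of A)) = carrier (mon_of A)"

definition point_map :: "('a, 'b) cobj \<Rightarrow> 'a \<Rightarrow> 'b" where
  "point_map A = compose (pts (pset_of A)) (str A) (free_unit (pset_of A))"

definition monic_obj :: "('a, 'b) cobj \<Rightarrow> bool" where
  "monic_obj A \<longleftrightarrow> pset_mono (pset_of A) (underlying (mon_of A)) (point_map A)"

definition cat_B :: "(('u, 'u) cobj, ('u, 'u) carrow) cat" where
  "cat_B = full_subcategory comma_category {A. surjective_obj A \<and> monic_obj A}"

subsection \<open>The natural monoidal product\<close>

definition comma_tensor ::
  "('a, 'b) cobj \<Rightarrow> ('c, 'd) cobj \<Rightarrow> ('a \<times> 'c, ('b \<times> 'd) multiset set) cobj" where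
  "comma_tensor A A' =
     \<lparr>pset_of = smash (pset_of A) (pset_of A'),
      mon_of = tensor_mon (mon_of A) (mon_of A'),
      str = compose (carrier (free_mon (smash (pset_of A) (pset_of A'))))
              (tensor_hom (free_mon (pset_of A)) (free_mon (pset_of A')) (mon_of A) (mon_of A')
                 (str A) (str A'))
              (free_smash (pset_of A) (pset_of A'))\<rparr>"

definition comma_unit :: "(bool, bool multiset) cobj" where
  "comma_unit = \<lparr>pset_of = sphere0, mon_of = free_mon sphere0,
                 str = restrict id (carrier (free_mon sphere0))\<rparr>"

text \<open>
  For \<open>A\<close>, \<open>A'\<close> in B the object \<open>comma_tensor A A'\<close> always satisfies condition (a), but not always
  condition (b): see \<open>comma_tensor_not_monic\<close> below. The product in B is therefore
  \<open>comma_tensor A A'\<close> with those points identified that have the same image in \<open>M \<otimes> M'\<close>, that is,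
  its reflection into B: an object \<open>T\<close> of B with a morphism \<open>(p, q) : comma_tensor A A' \<rightarrow> T\<close> whose
  component \<open>q\<close> is an isomorphism and whose component \<open>p\<close> is surjective. If \<open>comma_tensor A A'\<close>
  satisfies (b), then \<open>p\<close> is an isomorphism as well (\<open>product_map_monic\<close>).
\<close>

definition product_map :: "('a, 'b) cobj \<Rightarrow> ('c, 'd) cobj \<Rightarrow> ('e, 'f) cobj
    \<Rightarrow> ('a \<times> 'c \<Rightarrow> 'e) \<Rightarrow> (('b \<times> 'd) multiset set \<Rightarrow> 'f) \<Rightarrow> bool" where
  "product_map A A' T p q \<longleftrightarrow>
     (p, q) \<in> comma_hom (comma_tensor A A') T \<and>
     p ` pts (pset_of (comma_tensor A A')) = pts (pset_of T) \<and>
     bij_betw q (carrier (mon_of (comma_tensor A A'))) (carrier (mon_of T))"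

definition comma_iso :: "('a, 'b) cobj \<Rightarrow> ('c, 'd) cobj \<Rightarrow> ('a \<Rightarrow> 'c) \<Rightarrow> ('b \<Rightarrow> 'd) \<Rightarrow> bool" where
  "comma_iso A B f g \<longleftrightarrow> (f, g) \<in> comma_hom A B \<and>
     bij_betw f (pts (pset_of A)) (pts (pset_of B)) \<and>
     bij_betw g (carrier (mon_of A)) (carrier (mon_of B))"

lemma product_map_monic:
  assumes "product_map A A' T p q" and m: "monic_obj (comma_tensor A A')"
  shows "comma_iso (comma_tensor A A') T p q"
proof -
  let ?W = "comma_tensor A A'"
  have h: "(p, q) \<in> comma_hom ?W T" and s: "p ` pts (pset_of ?W) = pts (pset_of T)"
    and b: "bij_betw q (carrier (mon_of ?W)) (carrier (mon_of T))"
    using assms(1) by (simp_all add: product_map_def)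
  have pt: "point_map ?W \<in> pset_hom (pset_of ?W) (underlying (mon_of ?W))"
    using m by (simp add: monic_obj_def pset_mono_def)
  have W: "pointed_set (pset_of ?W)" by (simp add: pointed_set_def comma_tensor_def smash_def)
  have inj: "inj_on (point_map ?W) (pts (pset_of ?W))"
    using m by (simp add: monic_obj_def pset_mono_iff_inj[OF W])
  have T: "bpt (pset_of T) \<in> pts (pset_of T)"
    using h s W by (force simp: comma_hom_def pset_hom_def pointed_set_def)
  have q: "q (point_map ?W x) = str T (free_unit (pset_of T) (p x))" if "x \<in> pts (pset_of ?W)" for x
  proof -
    have "free_unit (pset_of ?W) x \<in> carrier (free_mon (pset_of ?W))"
      using that by (auto simp: free_unit_def free_mon_def)
    moreover from this
    have "free_map (pset_of ?W) (pset_of T) p (free_unit (pset_of ?W) x) = free_unit (pset_of T) (p x)"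
      using that h s T by (auto simp: free_map_def free_unit_def comma_hom_def pset_hom_def)
    ultimately show ?thesis
      using that h by (auto simp: comma_hom_def point_map_def compose_def)
  qed
  have "inj_on p (pts (pset_of ?W))"
  proof (rule inj_onI)
    fix x y assume x: "x \<in> pts (pset_of ?W)" and y: "y \<in> pts (pset_of ?W)" and e: "p x = p y"
    have "q (point_map ?W x) = q (point_map ?W y)" using q x y e by simp
    moreover have "point_map ?W x \<in> carrier (mon_of ?W)" "point_map ?W y \<in> carrier (mon_of ?W)"
      using pt x y by (auto simp: pset_hom_def underlying_def)
    ultimately have "point_map ?W x = point_map ?W y"
      using b by (auto simp: bij_betw_def dest: inj_onD)
    then show "x = y" using inj x y by (auto dest: inj_onD)
  qed
  then show ?thesis using h s b by (simp add: comma_iso_def bij_betw_def)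
qed

text \<open>The cyclic groups \<open>\<int>/2\<close> and \<open>\<int>/3\<close>, each with the points 0 and 1, are objects satisfying (a) and
  (b), but \<open>\<int>/2 \<otimes> \<int>/3 = 0\<close> while the smash product of the sets of points has two elements.\<close>

definition cyclic_obj :: "nat \<Rightarrow> (nat, nat) cobj" where
  "cyclic_obj n =
     \<lparr>pset_of = \<lparr>pts = {0, 1}, bpt = 0\<rparr>,
      mon_of = \<lparr>carrier = {..<n}, monoid.mult = (\<lambda>a b. (a + b) mod n), one = 0\<rparr>,
      str = (\<lambda>m \<in> carrier (free_mon \<lparr>pts = {0, 1}, bpt = 0\<rparr>). sum_mset m mod n)\<rparr>"

lemma comma_obj_cyclic_obj:
  assumes "n > 1"
  shows "comma_obj (cyclic_obj n)"
proof -
  have "comm_monoid (mon_of (cyclic_obj n))"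
    using assms by unfold_locales (auto simp: cyclic_obj_def mod_simps ac_simps)
  moreover have "str (cyclic_obj n) \<in> mon_hom (free_mon (pset_of (cyclic_obj n))) (mon_of (cyclic_obj n))"
    using assms by (auto simp: mon_hom_def hom_def cyclic_obj_def free_mon_def mod_simps)
  ultimately show ?thesis by (simp add: comma_obj_def pointed_set_def cyclic_obj_def)
qed

lemma surjective_cyclic_obj:
  assumes "n > 1"
  shows "surjective_obj (cyclic_obj n)"
proof -
  have "a \<in> str (cyclic_obj n) ` carrier (free_mon (pset_of (cyclic_obj n)))" if "a < n" for a
    using that by (intro image_eqI[of _ _ "replicate_mset a 1"])
      (auto simp: cyclic_obj_def free_mon_def sum_mset_replicate_mset split: if_splits)
  then show ?thesis
    using assms by (auto simp: surjective_obj_def cyclic_obj_def)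
qed

lemma monic_cyclic_obj:
  assumes "n > 1"
  shows "monic_obj (cyclic_obj n)"
  using assms unfolding monic_obj_def
  by (subst pset_mono_iff_inj)
    (auto simp: pointed_set_def cyclic_obj_def pset_hom_def underlying_def point_map_def
      compose_def free_unit_def free_mon_def)

lemma comma_tensor_not_monic:
  "\<not> monic_obj (comma_tensor (cyclic_obj 2) (cyclic_obj 3))"
proof
  let ?A = "cyclic_obj 2" and ?B = "cyclic_obj 3"
  let ?M = "mon_of ?A" and ?N = "mon_of ?B" and ?W = "comma_tensor ?A ?B"
  let ?X = "pset_of ?A" and ?Y = "pset_of ?B"
  let ?F = "free_mon ?X" and ?G = "free_mon ?Y"
  assume m: "monic_obj ?W"
  have W: "pointed_set (pset_of ?W)" by (simp add: pointed_set_def comma_tensor_def smash_def)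
  have pt: "(1, 1) \<in> pts (pset_of ?W)" "bpt (pset_of ?W) = (0, 0)"
    by (simp_all add: comma_tensor_def smash_def cyclic_obj_def)
  have inj: "inj_on (point_map ?W) (pts (pset_of ?W))"
    and base: "point_map ?W (0, 0) = \<one>\<^bsub>mon_of ?W\<^esub>"
    using m pt by (simp_all add: monic_obj_def pset_mono_iff_inj[OF W] pset_hom_def underlying_def)
  define P where "P = {#({#1::nat#}, {#1::nat#})#}"
  have P: "set_mset P \<subseteq> carrier ?F \<times> carrier ?G" by (simp add: P_def free_mon_def cyclic_obj_def)
  have s1: "tensor_eq ?M ?N {#(1,1)#} {#}"
  proof -
    have eqs: "1 \<otimes>\<^bsub>?M\<^esub> 1 = \<one>\<^bsub>?M\<^esub>" "1 \<otimes>\<^bsub>?N\<^esub> 1 = 2" "2 \<otimes>\<^bsub>?N\<^esub> 1 = \<one>\<^bsub>?N\<^esub>"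
      by (simp_all add: cyclic_obj_def)
    have c: "1 \<in> carrier ?M" "1 \<in> carrier ?N" "2 \<in> carrier ?N"
      by (simp_all add: cyclic_obj_def)
    have "tensor_eq ?M ?N {#(1 \<otimes>\<^bsub>?M\<^esub> 1, 1)#} {#(1,1), (1,1)#}"
      using c by (intro tensor_eq.add_left)
    then have "tensor_eq ?M ?N {#(\<one>\<^bsub>?M\<^esub>, 1)#} {#(1,1), (1,1)#}" by (simp only: eqs)
    then have two: "tensor_eq ?M ?N {#(1,1), (1,1)#} {#}"
      using tensor_eq.zero_left[OF c(2)] by (rule tensor_eq.trans[OF tensor_eq.sym])
    have "tensor_eq ?M ?N {#(1, 1 \<otimes>\<^bsub>?N\<^esub> 1)#} {#(1,1), (1,1)#}"
      using c by (intro tensor_eq.add_right)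
    then have "tensor_eq ?M ?N {#(1, 2)#} {#(1,1), (1,1)#}" by (simp only: eqs)
    then have t2: "tensor_eq ?M ?N {#(1, 2)#} {#}" using two by (rule tensor_eq.trans)
    have "tensor_eq ?M ?N {#(1, 2 \<otimes>\<^bsub>?N\<^esub> 1)#} {#(1,2), (1,1)#}"
      using c by (intro tensor_eq.add_right)
    then have "tensor_eq ?M ?N {#(1, \<one>\<^bsub>?N\<^esub>)#} {#(1,2), (1,1)#}" by (simp only: eqs)
    then have t3: "tensor_eq ?M ?N {#(1,2), (1,1)#} {#}"
      using tensor_eq.zero_right[OF c(1)] by (rule tensor_eq.trans[OF tensor_eq.sym])
    have "tensor_eq ?M ?N ({#(1,2)#} + {#(1,1)#}) ({#} + {#(1,1)#})"
      using t2 by (rule tensor_eq.add) (rule tensor_eq.refl, simp add: cyclic_obj_def)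
    then have "tensor_eq ?M ?N {#(1,2), (1,1)#} {#(1,1)#}" by (simp add: add_mset_commute)
    then show ?thesis using t3 by (rule tensor_eq.trans[OF tensor_eq.sym])
  qed
  have A: "str ?A \<in> mon_hom ?F ?M" and B: "str ?B \<in> mon_hom ?G ?N"
    using comma_obj_cyclic_obj[of 2] comma_obj_cyclic_obj[of 3] by (auto simp: comma_obj_def)
  have fP: "image_mset (map_prod (str ?A) (str ?B)) P = {#(1, 1)#}"
    by (simp add: P_def cyclic_obj_def free_mon_def)
  have "point_map ?W (1, 1) = tensor_rel ?M ?N ``
      (image_mset (map_prod (str ?A) (str ?B)) ` (tensor_rel ?F ?G `` {P}))"
  proof -
    have c: "{#(1, 1)#} \<in> carrier (free_mon (smash ?X ?Y))"
      by (simp add: free_mon_def smash_def cyclic_obj_def)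
    have "free_unit (pset_of ?W) (1, 1) = {#(1, 1)#}"
      using pt by (simp add: free_unit_def)
    moreover have "free_smash ?X ?Y {#(1, 1)#} = tensor_rel ?F ?G `` {P}"
      using c by (simp add: free_smash_def P_def free_unit_def cyclic_obj_def)
    moreover have "tensor_rel ?F ?G `` {P} \<in> carrier (tensor_mon ?F ?G)"
      using P by (auto simp: tensor_mon_def intro: quotientI)
    ultimately show ?thesis
      using pt c by (simp add: point_map_def compose_def comma_tensor_def tensor_hom_def)
  qed
  also have "\<dots> = tensor_rel ?M ?N `` {{#}}"
  proof -
    have 1: "tensor_eq ?M ?N {#(1, 1)#} (image_mset (map_prod (str ?A) (str ?B)) s)"
      if "tensor_eq ?F ?G P s" for s
      using tensor_eq_map[OF that A B] fP by simp
    have 2: "tensor_eq ?F ?G P P" by (rule tensor_eq.refl) (fact P)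
    show ?thesis
    proof (intro equalityI subsetI)
      fix t assume "t \<in> tensor_rel ?M ?N ``
        (image_mset (map_prod (str ?A) (str ?B)) ` (tensor_rel ?F ?G `` {P}))"
      then have "tensor_eq ?M ?N {#(1, 1)#} t"
        using 1 tensor_eq.trans unfolding tensor_rel_def by fast
      then show "t \<in> tensor_rel ?M ?N `` {{#}}"
        using tensor_eq.trans[OF tensor_eq.sym[OF s1]] by (simp add: tensor_rel_def)
    next
      fix t assume "t \<in> tensor_rel ?M ?N `` {{#}}"
      then have "tensor_eq ?M ?N {#(1, 1)#} t"
        using tensor_eq.trans[OF s1] by (simp add: tensor_rel_def)
      then have "(image_mset (map_prod (str ?A) (str ?B)) P, t) \<in> tensor_rel ?M ?N"
        by (simp add: tensor_rel_def fP)
      moreover have "P \<in> tensor_rel ?F ?G `` {P}" using 2 by (simp add: tensor_rel_def)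
      ultimately show "t \<in> tensor_rel ?M ?N ``
        (image_mset (map_prod (str ?A) (str ?B)) ` (tensor_rel ?F ?G `` {P}))"
        by blast
    qed
  qed
  also have "\<dots> = point_map ?W (0, 0)"
    using base by (simp add: comma_tensor_def tensor_mon_def)
  finally show False
    using inj pt W by (auto simp: pointed_set_def dest: inj_onD)
qed


text \<open>
  A monoidal structure is natural if its product and unit are, through maps \<open>p\<close>, \<open>q\<close> and \<open>u\<close>, \<open>v\<close>,
  the ones described above, if \<open>f \<otimes> f'\<close> sends \<open>x \<otimes> x'\<close> to \<open>f x \<otimes> f' x'\<close>, and if the structural
  isomorphisms are the canonical ones. Equations for \<open>pmap\<close> suffice: the component \<open>mmap\<close> of an
  arrow of B is determined by \<open>pmap\<close>, by condition (a).
\<close>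

definition natural_structure ::
  "(('u, 'u) cobj, ('u, 'u) carrow) monoidal_cat \<Rightarrow> bool" where
  "natural_structure C \<longleftrightarrow>
     (\<exists>(p :: ('u, 'u) cobj \<Rightarrow> ('u, 'u) cobj \<Rightarrow> 'u \<times> 'u \<Rightarrow> 'u)
       (q :: ('u, 'u) cobj \<Rightarrow> ('u, 'u) cobj \<Rightarrow> ('u \<times> 'u) multiset set \<Rightarrow> 'u)
       (u :: bool \<Rightarrow> 'u) (v :: bool multiset \<Rightarrow> 'u).
        let pure = (\<lambda>A A' x x'. p A A' (smash_pair (pset_of A) (pset_of A') x x'));
            P = (\<lambda>A. pts (pset_of A))
        in
        (\<forall>A \<in> Ob C. \<forall>A' \<in> Ob C. product_map A A' (A \<odot>\<^bsub>C\<^esub> A') (p A A') (q A A')) \<and>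
        comma_iso comma_unit (Unit C) u v \<and>
        (\<forall>f \<in> Arr C. \<forall>f' \<in> Arr C. \<forall>x \<in> P (Dom C f). \<forall>x' \<in> P (Dom C f').
           pmap (f \<odot>\<^sub>a\<^bsub>C\<^esub> f') (pure (Dom C f) (Dom C f') x x') =
           pure (Cod C f) (Cod C f') (pmap f x) (pmap f' x')) \<and>
        (\<forall>A \<in> Ob C. \<forall>A' \<in> Ob C. \<forall>A'' \<in> Ob C. \<forall>x \<in> P A. \<forall>x' \<in> P A'. \<forall>x'' \<in> P A''.
           pmap (Assoc C A A' A'') (pure (A \<odot>\<^bsub>C\<^esub> A') A'' (pure A A' x x') x'') =
           pure A (A' \<odot>\<^bsub>C\<^esub> A'') x (pure A' A'' x' x'')) \<and>
        (\<forall>A \<in> Ob C. \<forall>x \<in> P A. pmap (LUnit C A) (pure (Unit C) A (u True) x) = x) \<and>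
        (\<forall>A \<in> Ob C. \<forall>x \<in> P A. pmap (RUnit C A) (pure A (Unit C) x (u True)) = x) \<and>
        (\<forall>A \<in> Ob C. \<forall>A' \<in> Ob C. \<forall>x \<in> P A. \<forall>x' \<in> P A'.
           pmap (Braid C A A') (pure A A' x x') = pure A' A x' x))"

end

theory Submission
  imports Defs "HOL-Algebra.Product_Groups"
begin

text \<open>
  By condition (a) an arrow of B is determined by its monoid component, and by condition (b) an
  object is a commutative monoid \<open>M\<close> with a set \<open>S\<close> of generators containing 0; arrows are the
  homomorphisms that preserve the generators. In these terms
  \<^item> the product of \<open>(M, S)\<close> and \<open>(M', S')\<close> is \<open>M \<otimes> M'\<close> with the generators \<open>x \<otimes> x'\<close>, so that the
    coherence laws hold because they hold on pure tensors of generators;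
  \<^item> the internal hom is the submonoid of \<open>Hom(M, M')\<close> generated by the arrows
    \<open>(M, S) \<rightarrow> (M', S')\<close>;
  \<^item> a limit is the submonoid of the product of the monoids generated by the compatible families of
    generators;
  \<^item> a colimit is the colimit of the monoids, with the images of all generators.
  Each of these monoids has a small generating set, hence is small and can be encoded in the
  universe.
\<close>

section \<open>Small sets\<close>

text \<open>Each construction on commutative monoids comes with evident generators, but the pairs,
  families or maps that index them may coincide as elements of the monoid, and they need not
  generate all of it. Taking the set of their values restores condition (b); passing to the
  submonoid generated by this set S restores (a). The second passage loses no arrows into the
  object: a homomorphism that starts at an object of B and sends its generators into S takes all its
  values in the submonoid generated by S. The other obstacle is that objects live on the type of the
  universe, while tensor products, function monoids, products and quotients live on other types. A
  single construction, \<open>obj_of M S\<close>, therefore turns a commutative monoid on any type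
  with a small set S containing 0 into an object of B, and \<open>arrow_to_obj_of\<close> and
  \<open>arrow_from_obj_of\<close> carry homomorphisms across the encoding. Inaccessibility is used
  only for smallness: regularity for unions, the strong limit property for power sets and hence for
  function spaces, uncountability for sets of multisets.\<close>

lemma small_subset: "small U T \<Longrightarrow> S \<subseteq> T \<Longrightarrow> small U S"
  unfolding small_def using card_of_mono1 ordLeq_ordLess_trans by blast

lemma small_image: "small U S \<Longrightarrow> small U (f ` S)"
  unfolding small_def using card_of_image ordLeq_ordLess_trans by blast

lemma small_inj_on: "small U (f ` S) \<Longrightarrow> inj_on f S \<Longrightarrow> small U S"
  unfolding small_def
  by (meson bij_betw_imageI card_of_ordIso ordIso_ordLess_trans)

lemma small_imp_inj_on:
  assumes "small TYPE('u) S"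
  obtains e :: "'b \<Rightarrow> 'u" where "inj_on e S"
  using assms unfolding small_def
  by (metis card_of_ordLeq ordLess_imp_ordLeq)

context
  assumes U: "inaccessible TYPE('u)"
begin

lemma Cinfinite_universe: "Cinfinite |UNIV :: 'u set|"
proof -
  have "|UNIV :: nat set| \<le>o |UNIV :: 'u set|"
    using U ordLess_imp_ordLeq by (auto simp: inaccessible_def)
  then have "infinite (UNIV :: 'u set)"
    using infinite_iff_card_of_nat by blast
  then show ?thesis using card_of_Card_order[of "UNIV :: 'u set"]
    by (simp only: cinfinite_def Field_card_of not_False_eq_True simp_thms)
qed

text \<open>The universe is strictly larger than the natural numbers, so a countable set is small
  and not merely encodable.\<close>

lemma small_countable: "countable S \<Longrightarrow> small TYPE('u) S" for S :: "'b set"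
  using U unfolding countable_def small_def inaccessible_def
  by (metis card_of_ordLeq ordLeq_ordLess_trans subset_UNIV)

text \<open>This is regularity of the cardinal of the universe.\<close>

lemma small_UN:
  assumes "small TYPE('u) I" "\<And>i. i \<in> I \<Longrightarrow> small TYPE('u) (A i)"
  shows "small TYPE('u) (\<Union>i \<in> I. A i)"
  using card_of_UNION_ordLess_infinite_Field_regularCard[of "|UNIV :: 'u set|" I A]
    Cinfinite_universe U assms unfolding small_def inaccessible_def by blast

lemma small_Sigma:
  assumes "small TYPE('u) I" "\<And>i. i \<in> I \<Longrightarrow> small TYPE('u) (A i)"
  shows "small TYPE('u) (Sigma I A)"
proof -
  have "Sigma I A = (\<Union>i \<in> I. Pair i ` A i)" by auto
  then show ?thesis using assms by (simp add: small_UN small_image)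
qed

text \<open>The strong limit property is assumed for subsets of the universe only, hence the
  transport along an injection of S.\<close>

lemma small_Pow:
  fixes S :: "'b set"
  assumes "small TYPE('u) S"
  shows "small TYPE('u) (Pow S)"
proof -
  obtain e :: "'b \<Rightarrow> 'u" where e: "inj_on e S"
    using assms by (rule small_imp_inj_on)
  have "small TYPE('u) (Pow (e ` S))"
    using U small_image[OF assms, of e] unfolding small_def inaccessible_def by blast
  then have "small TYPE('u) ((`) e ` Pow S)"
    by (rule small_subset) blast
  then show ?thesis
    by (rule small_inj_on) (simp add: e inj_on_image_Pow)
qed

text \<open>A function is coded by its graph, a subset of the small set \<open>Sigma I A\<close>.
  The graph determines the function because its values outside I are fixed.\<close>

lemma small_PiE:
  assumes "small TYPE('u) I" "\<And>i. i \<in> I \<Longrightarrow> small TYPE('u) (A i)"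
  shows "small TYPE('u) (PiE I A)"
proof -
  let ?graph = "\<lambda>f. (\<lambda>i. (i, f i)) ` I"
  have "small TYPE('u) (?graph ` PiE I A)"
    by (rule small_subset[OF small_Pow[OF small_Sigma[OF assms]]]) auto
  then show ?thesis
  proof (rule small_inj_on, intro inj_onI)
    fix f g assume fg: "f \<in> PiE I A" "g \<in> PiE I A" "?graph f = ?graph g"
    have "f i = g i" if "i \<in> I" for i
    proof -
      have "(i, f i) \<in> ?graph f" using that by (rule imageI)
      then have "(i, f i) \<in> ?graph g" by (simp only: fg(3))
      then show ?thesis by auto
    qed
    then show "f = g" by (rule PiE_ext[OF fg(1,2)])
  qed
qed

text \<open>Multisets are images of lists, and the lists over S form a countable union of the sets
  of lists of length n, which are small by induction on n.\<close>

lemma small_multisets: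
  assumes "small TYPE('u) S"
  shows "small TYPE('u) {m. set_mset m \<subseteq> S}"
proof -
  have n: "small TYPE('u) {xs \<in> lists S. length xs = n}" for n
  proof (induction n)
    case 0
    have "{xs \<in> lists S. length xs = 0} = {[]}" by auto
    then show ?case by (simp add: small_countable)
  next
    case (Suc n)
    have "{xs \<in> lists S. length xs = Suc n} =
        (\<lambda>(x, xs). x # xs) ` (S \<times> {xs \<in> lists S. length xs = n})"
      by (force simp: length_Suc_conv image_iff)
    then show ?case using Suc assms by (simp add: small_image small_Sigma)
  qed
  have "lists S = (\<Union>n \<in> (UNIV :: nat set). {xs \<in> lists S. length xs = n})" by auto
  moreover have "small TYPE('u) (\<Union>n \<in> (UNIV :: nat set). {xs \<in> lists S. length xs = n})"
    by (intro small_UN small_countable n) simp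
  ultimately have "small TYPE('u) (mset ` lists S)" by (simp add: small_image)
  then show ?thesis
    by (rule small_subset) (metis (mono_tags, lifting) ex_mset imageI in_listsI mem_Collect_eq set_mset_mset subsetI subset_iff)
qed

end

section \<open>Commutative monoids\<close>

lemma mon_homI:
  assumes "h \<in> extensional (carrier M)" "\<And>a. a \<in> carrier M \<Longrightarrow> h a \<in> carrier N"
    "\<And>a b. a \<in> carrier M \<Longrightarrow> b \<in> carrier M \<Longrightarrow> h (a \<otimes>\<^bsub>M\<^esub> b) = h a \<otimes>\<^bsub>N\<^esub> h b"
    "h \<one>\<^bsub>M\<^esub> = \<one>\<^bsub>N\<^esub>"
  shows "h \<in> mon_hom M N"
  using assms by (auto simp: mon_hom_def hom_def)

lemma mon_homD:
  assumes "h \<in> mon_hom M N"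
  shows "h \<in> extensional (carrier M)" "\<And>a. a \<in> carrier M \<Longrightarrow> h a \<in> carrier N"
    "\<And>a b. a \<in> carrier M \<Longrightarrow> b \<in> carrier M \<Longrightarrow> h (a \<otimes>\<^bsub>M\<^esub> b) = h a \<otimes>\<^bsub>N\<^esub> h b"
    "h \<one>\<^bsub>M\<^esub> = \<one>\<^bsub>N\<^esub>"
  using assms by (auto simp: mon_hom_def hom_def)

lemma mon_hom_compose:
  assumes "g \<in> mon_hom M N" "h \<in> mon_hom N P" "monoid M"
  shows "compose (carrier M) h g \<in> mon_hom M P"
  by (rule mon_homI)
    (simp_all add: compose_def mon_homD[OF assms(1)] mon_homD[OF assms(2)]
      monoid.m_closed[OF assms(3)] monoid.one_closed[OF assms(3)])

lemma comm_monoid_product_group: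
  assumes "\<And>i. i \<in> I \<Longrightarrow> comm_monoid (M i)"
  shows "comm_monoid (product_group I M)"
proof -
  have c: "\<And>i a b. i \<in> I \<Longrightarrow> a \<in> carrier (M i) \<Longrightarrow> b \<in> carrier (M i) \<Longrightarrow> a \<otimes>\<^bsub>M i\<^esub> b \<in> carrier (M i)"
    "\<And>i. i \<in> I \<Longrightarrow> \<one>\<^bsub>M i\<^esub> \<in> carrier (M i)"
    "\<And>i a b c. i \<in> I \<Longrightarrow> a \<in> carrier (M i) \<Longrightarrow> b \<in> carrier (M i) \<Longrightarrow> c \<in> carrier (M i) \<Longrightarrow>
      a \<otimes>\<^bsub>M i\<^esub> b \<otimes>\<^bsub>M i\<^esub> c = a \<otimes>\<^bsub>M i\<^esub> (b \<otimes>\<^bsub>M i\<^esub> c)"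
    "\<And>i a b. i \<in> I \<Longrightarrow> a \<in> carrier (M i) \<Longrightarrow> b \<in> carrier (M i) \<Longrightarrow> a \<otimes>\<^bsub>M i\<^esub> b = b \<otimes>\<^bsub>M i\<^esub> a"
    "\<And>i a. i \<in> I \<Longrightarrow> a \<in> carrier (M i) \<Longrightarrow> \<one>\<^bsub>M i\<^esub> \<otimes>\<^bsub>M i\<^esub> a = a"
    using assms by (auto simp: comm_monoid_def comm_monoid_axioms_def monoid.m_closed
        monoid.one_closed monoid.m_assoc monoid.l_one)
  show ?thesis
    by (rule comm_monoidI)
      (auto simp: c(1-3,5) PiE_iff extensional_def fun_eq_iff, simp add: c(4))
qed

text \<open>\<open>finprod\<close> runs over a set, so multiplicities enter as exponents. In
  additive language this is the homomorphism from formal sums to N that extends f, as in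
  \<open>free_mon_universal\<close>.\<close>

definition mprod :: "('b, 'x) monoid_scheme \<Rightarrow> ('a \<Rightarrow> 'b) \<Rightarrow> 'a multiset \<Rightarrow> 'b" where
  "mprod N f m = finprod N (\<lambda>x. f x [^]\<^bsub>N\<^esub> count m x) (set_mset m)"



context comm_monoid
begin

lemma mprod_empty [simp]: "mprod G f {#} = \<one>"
  by (simp add: mprod_def)

lemma mprod_cong:
  assumes "\<And>x. x \<in># m \<Longrightarrow> f x = g x" "g \<in> set_mset m \<rightarrow> carrier G"
  shows "mprod G f m = mprod G g m"
  unfolding mprod_def using assms by (intro finprod_cong') auto

text \<open>Outside the support the exponent is 0 and the factor is one. This permits two multisets
  to be compared over a common index set, as in \<open>mprod_union\<close>.\<close>

lemma mprod_superset:
  assumes "finite S" "set_mset m \<subseteq> S" "f \<in> S \<rightarrow> carrier G"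
  shows "mprod G f m = finprod G (\<lambda>x. f x [^] count m x) S"
  unfolding mprod_def using assms
  by (intro finprod_mono_neutral_cong_left) (auto simp: Pi_iff not_in_iff)

lemma mprod_single [simp]: "f x \<in> carrier G \<Longrightarrow> mprod G f {#x#} = f x"
  by (simp add: mprod_def)

lemma mprod_closed: "f \<in> set_mset m \<rightarrow> carrier G \<Longrightarrow> mprod G f m \<in> carrier G"
  unfolding mprod_def by (intro finprod_closed) auto

lemma mprod_union:
  assumes "f \<in> set_mset m \<union> set_mset n \<rightarrow> carrier G"
  shows "mprod G f (m + n) = mprod G f m \<otimes> mprod G f n"
proof -
  let ?S = "set_mset m \<union> set_mset n"
  have "mprod G f (m + n) = finprod G (\<lambda>x. f x [^] count m x \<otimes> f x [^] count n x) ?S"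
    using assms by (subst mprod_superset[of ?S])
      (auto intro!: finprod_cong' simp: nat_pow_mult Pi_iff simp del: finprod_multf)
  also have "\<dots> = mprod G f m \<otimes> mprod G f n"
    using assms by (subst finprod_multf) (auto simp: mprod_superset[of ?S] Pi_iff)
  finally show ?thesis .
qed

lemma mprod_add:
  assumes "f \<in> set_mset m \<rightarrow> carrier G" "f x \<in> carrier G"
  shows "mprod G f (add_mset x m) = f x \<otimes> mprod G f m"
  using mprod_union[of f "{#x#}" m] assms by auto

lemma mprod_hom:
  assumes "h \<in> mon_hom G N" "comm_monoid N" "f \<in> set_mset m \<rightarrow> carrier G"
  shows "h (mprod G f m) = mprod N (\<lambda>x. h (f x)) m"
proof -
  interpret N: comm_monoid N by fact
  show ?thesis using assms(3)
    by (induction m)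
      (auto simp: mprod_add N.mprod_add mon_homD[OF assms(1)] mprod_closed Pi_iff)
qed

end

section \<open>Generated submonoids\<close>

text \<open>Adding one generator at a time gives an induction with a single induction hypothesis;
  closure under arbitrary products is derived in \<open>generated_mult\<close>.\<close>

inductive_set generated :: "('b, 'x) monoid_scheme \<Rightarrow> 'b set \<Rightarrow> 'b set"
  for M :: "('b, 'x) monoid_scheme" and S :: "'b set" where
  one: "\<one>\<^bsub>M\<^esub> \<in> generated M S"
| mult: "s \<in> S \<Longrightarrow> a \<in> generated M S \<Longrightarrow> s \<otimes>\<^bsub>M\<^esub> a \<in> generated M S"

context comm_monoid
begin

lemma generated_closed: "S \<subseteq> carrier G \<Longrightarrow> a \<in> generated G S \<Longrightarrow> a \<in> carrier G"
  by (rotate_tac, induction rule: generated.induct) auto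

lemma generated_mult:
  assumes "S \<subseteq> carrier G" "a \<in> generated G S" "b \<in> generated G S"
  shows "a \<otimes> b \<in> generated G S"
  using assms(2)
proof induction
  case one
  then show ?case using assms generated_closed by auto
next
  case (mult s a)
  then show ?case using assms generated_closed
    by (metis generated.mult m_assoc subset_iff)
qed

lemma generated_incl: "S \<subseteq> carrier G \<Longrightarrow> s \<in> S \<Longrightarrow> s \<in> generated G S"
  using generated.mult[OF _ generated.one, of s S G] by auto

lemma mprod_in_generated:
  assumes "T \<subseteq> carrier G" "f \<in> set_mset m \<rightarrow> T"
  shows "mprod G f m \<in> generated G T"
  using assms(2)
proof (induction m)
  case empty
  then show ?case by (simp add: generated.one)
next
  case (add x m)
  then show ?case using assms(1) by (subst mprod_add) (auto intro: generated.mult)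
qed

text \<open>This is the source of smallness: the submonoid is an image of a set of multisets over S,
  to which \<open>small_multisets\<close> applies.\<close>

lemma generated_eq_mprod:
  assumes "S \<subseteq> carrier G"
  shows "generated G S = mprod G (\<lambda>a. a) ` {m. set_mset m \<subseteq> S}"
proof (intro equalityI subsetI)
  fix a assume "a \<in> generated G S"
  then show "a \<in> mprod G (\<lambda>a. a) ` {m. set_mset m \<subseteq> S}"
  proof induction
    case one
    then show ?case by (auto intro!: image_eqI[of _ _ "{#}"])
  next
    case (mult s a)
    then obtain m where "set_mset m \<subseteq> S" "a = mprod G (\<lambda>a. a) m" by blast
    with mult assms show ?case
      by (intro image_eqI[of _ _ "add_mset s m"]) (auto simp: mprod_add Pi_iff subset_iff)
  qed
next
  fix a assume "a \<in> mprod G (\<lambda>a. a) ` {m. set_mset m \<subseteq> S}"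
  then show "a \<in> generated G S" using assms by (auto intro!: mprod_in_generated)
qed

end

lemma mon_hom_eq_on_generated:
  assumes "g \<in> mon_hom M N" "h \<in> mon_hom M N" "generated M S = carrier M" "S \<subseteq> carrier M"
    "\<And>s. s \<in> S \<Longrightarrow> g s = h s"
  shows "g = h"
proof (rule extensionalityI[of _ "carrier M"])
  fix a assume "a \<in> carrier M"
  then have "a \<in> generated M S" using assms(3) by simp
  then show "g a = h a"
  proof induction
    case (mult s a)
    moreover have "s \<in> carrier M" "a \<in> carrier M" using mult assms(3,4) by auto
    ultimately show ?case using assms(5) by (simp add: mon_homD[OF assms(1)] mon_homD[OF assms(2)])
  qed (simp add: mon_homD[OF assms(1)] mon_homD[OF assms(2)])
qed (use assms mon_homD in blast)+

section \<open>The category B\<close>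

abbreviation carr :: "('a, 'b) cobj \<Rightarrow> 'b set" where
  "carr A \<equiv> carrier (mon_of A)"

text \<open>The set S of the pair (M, S). Under condition (b) the point map identifies the points
  with it.\<close>

definition gens :: "('a, 'b) cobj \<Rightarrow> 'b set" where
  "gens A = point_map A ` pts (pset_of A)"

lemma Ob_cat_B:
  "A \<in> Ob (cat_B :: (('u, 'u) cobj, ('u, 'u) carrow) cat) \<longleftrightarrow>
    comma_obj A \<and> small_cobj TYPE('u) A \<and> surjective_obj A \<and> monic_obj A"
  by (auto simp: cat_B_def full_subcategory_def comma_category_def)

lemma Hom_cat_B:
  "h \<in> Hom cat_B A A' \<longleftrightarrow> A \<in> Ob cat_B \<and> A' \<in> Ob cat_B \<and> src h = A \<and> tgt h = A' \<and>
    (pmap h, mmap h) \<in> comma_hom A A'"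
  by (auto simp: cat_B_def full_subcategory_def comma_category_def Hom_def)

lemma free_unit_closed: "x \<in> pts X \<Longrightarrow> free_unit X x \<in> carrier (free_mon X)"
  by (auto simp: free_unit_def free_mon_def)

lemma free_map_unit:
  assumes "f \<in> pset_hom X Y" "x \<in> pts X" "pointed_set Y"
  shows "free_map X Y f (free_unit X x) = free_unit Y (f x)"
proof -
  have "free_map X Y f (free_unit X x) = (\<Sum>y \<in># free_unit X x. free_unit Y (f y))"
    using free_unit_closed[OF assms(2)] by (simp add: free_map_def)
  then show ?thesis
    using assms by (auto simp: free_unit_def pset_hom_def pointed_set_def)
qed

lemma point_map_eq: "x \<in> pts (pset_of A) \<Longrightarrow> point_map A x = str A (free_unit (pset_of A) x)"
  by (simp add: point_map_def compose_def)

locale comma_object =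
  fixes A :: "('a, 'b) cobj"
  assumes comma_obj: "comma_obj A"
begin

sublocale comm_monoid "mon_of A"
  using comma_obj by (simp add: comma_obj_def)

lemma pointed: "pointed_set (pset_of A)"
  and str_hom: "str A \<in> mon_hom (free_mon (pset_of A)) (mon_of A)"
  using comma_obj by (simp_all add: comma_obj_def)

lemma point_map_hom: "point_map A \<in> pset_hom (pset_of A) (underlying (mon_of A))"
proof -
  have "str A (free_unit (pset_of A) (bpt (pset_of A))) = \<one>\<^bsub>mon_of A\<^esub>"
    using mon_homD(4)[OF str_hom] pointed
    by (simp add: free_unit_def free_mon_def pointed_set_def)
  then show ?thesis
    using mon_homD(2)[OF str_hom free_unit_closed] pointed
    by (auto simp: pset_hom_def underlying_def point_map_def compose_def pointed_set_def)
qed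

lemma point_map_closed: "x \<in> pts (pset_of A) \<Longrightarrow> point_map A x \<in> carr A"
  and point_map_bpt: "point_map A (bpt (pset_of A)) = \<one>\<^bsub>mon_of A\<^esub>"
  using point_map_hom by (auto simp: pset_hom_def underlying_def)

lemma gens_closed: "x \<in> gens A \<Longrightarrow> x \<in> carr A"
  and gens_subset: "gens A \<subseteq> carr A"
  by (auto simp: gens_def point_map_closed)

lemma one_in_gens: "\<one>\<^bsub>mon_of A\<^esub> \<in> gens A"
  using pointed point_map_bpt unfolding gens_def pointed_set_def by (metis imageI)

text \<open>Some \<open>f x\<close> may be the base point; its unit is the empty multiset and its
  factor in the product is one, so both sides ignore it. The map f is there so that the lemma also
  evaluates \<open>str A\<close> on values of \<open>free_map\<close>.\<close>

lemma str_sum_units: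
  assumes "\<And>x. x \<in># m \<Longrightarrow> f x \<in> pts (pset_of A)"
  shows "str A (\<Sum>x \<in># m. free_unit (pset_of A) (f x)) = mprod (mon_of A) (\<lambda>x. point_map A (f x)) m"
  using assms
proof (induction m)
  case empty
  then show ?case using mon_homD(4)[OF str_hom] by (simp add: free_mon_def)
next
  case (add x m)
  have "set_mset (\<Sum>x \<in># m. free_unit (pset_of A) (f x)) \<subseteq> pts (pset_of A) - {bpt (pset_of A)}"
    using add.prems by (induction m) (auto simp: free_unit_def split: if_splits)
  then have c: "(\<Sum>x \<in># m. free_unit (pset_of A) (f x)) \<in> carrier (free_mon (pset_of A))"
    by (simp add: free_mon_def)
  have "str A (free_unit (pset_of A) (f x) + (\<Sum>x \<in># m. free_unit (pset_of A) (f x))) =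
      point_map A (f x) \<otimes>\<^bsub>mon_of A\<^esub> str A (\<Sum>x \<in># m. free_unit (pset_of A) (f x))"
    using mon_homD(3)[OF str_hom free_unit_closed c, of "f x"] add.prems
    by (simp add: free_mon_def point_map_eq)
  also have "\<dots> = mprod (mon_of A) (\<lambda>x. point_map A (f x)) (add_mset x m)"
    using add point_map_closed by (simp add: mprod_add Pi_iff)
  finally show ?case by simp
qed

lemma str_eq_mprod:
  assumes "m \<in> carrier (free_mon (pset_of A))"
  shows "str A m = mprod (mon_of A) (point_map A) m"
proof -
  have m: "set_mset m \<subseteq> pts (pset_of A) - {bpt (pset_of A)}"
    using assms by (simp add: free_mon_def)
  then have "(\<Sum>x \<in># m. free_unit (pset_of A) x) = m"
    by (induction m) (auto simp: free_unit_def)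
  then show ?thesis using str_sum_units[of m "\<lambda>x. x"] m by auto
qed

text \<open>The image of \<open>str A\<close> is the submonoid generated by \<open>gens A\<close>:
  its elements are products of generators by \<open>str_eq_mprod\<close>, and conversely it contains
  one and is stable under multiplication by a generator.\<close>

lemma surjective_obj_iff: "surjective_obj A \<longleftrightarrow> generated (mon_of A) (gens A) = carr A"
proof -
  have "str A ` carrier (free_mon (pset_of A)) = generated (mon_of A) (gens A)"
  proof (intro equalityI subsetI)
    fix a assume "a \<in> str A ` carrier (free_mon (pset_of A))"
    then obtain m where m: "m \<in> carrier (free_mon (pset_of A))" "a = str A m" by blast
    then show "a \<in> generated (mon_of A) (gens A)"
      unfolding m(2) str_eq_mprod[OF m(1)]
      by (intro mprod_in_generated gens_subset) (auto simp: gens_def free_mon_def)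
  next
    fix a assume "a \<in> generated (mon_of A) (gens A)"
    then show "a \<in> str A ` carrier (free_mon (pset_of A))"
    proof induction
      case one
      then show ?case using mon_homD(4)[OF str_hom]
        by (auto simp: free_mon_def intro!: image_eqI[of _ _ "{#}"])
    next
      case (mult s a)
      obtain x where x: "x \<in> pts (pset_of A)" "s = point_map A x"
        using mult by (auto simp: gens_def)
      obtain m where m: "m \<in> carrier (free_mon (pset_of A))" "a = str A m"
        using mult by blast
      have "s \<otimes>\<^bsub>mon_of A\<^esub> a = str A (free_unit (pset_of A) x \<otimes>\<^bsub>free_mon (pset_of A)\<^esub> m)"
        using x m by (simp add: point_map_eq mon_homD(3)[OF str_hom] free_unit_closed)
      moreover have "free_unit (pset_of A) x \<otimes>\<^bsub>free_mon (pset_of A)\<^esub> m \<in> carrier (free_mon (pset_of A))"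
        using free_unit_closed[OF x(1)] m(1) by (auto simp: free_mon_def)
      ultimately show ?case by blast
    qed
  qed
  then show ?thesis by (simp add: surjective_obj_def)
qed

lemma monic_obj_iff: "monic_obj A \<longleftrightarrow> inj_on (point_map A) (pts (pset_of A))"
  unfolding monic_obj_def pset_mono_iff_inj[OF pointed] using point_map_hom by simp

end

text \<open>The free monoid is generated by the points, so the square commutes as soon as it
  commutes on them. Both of its sides are products over the multiset m with equal factors.\<close>

lemma comma_hom_iff:
  assumes "comma_obj A" "comma_obj A'"
  shows "(f, g) \<in> comma_hom A A' \<longleftrightarrow>
    f \<in> pset_hom (pset_of A) (pset_of A') \<and> g \<in> mon_hom (mon_of A) (mon_of A') \<and>
    (\<forall>x \<in> pts (pset_of A). g (point_map A x) = point_map A' (f x))"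
    (is "?lhs \<longleftrightarrow> ?f \<and> ?g \<and> ?p")
proof -
  interpret A: comma_object A by unfold_locales fact
  interpret A': comma_object A' by unfold_locales fact
  have "g (str A m) = str A' (free_map (pset_of A) (pset_of A') f m)"
    if fg: ?f ?g and p: ?p and m: "m \<in> carrier (free_mon (pset_of A))" for m
  proof -
    have sub: "set_mset m \<subseteq> pts (pset_of A)" using m by (auto simp: free_mon_def)
    have fc: "f x \<in> pts (pset_of A')" if "x \<in># m" for x
      using that sub fg by (auto simp: pset_hom_def)
    have "g (str A m) = mprod (mon_of A') (\<lambda>x. g (point_map A x)) m"
      unfolding A.str_eq_mprod[OF m] using sub A.point_map_closed
      by (intro A.mprod_hom fg A'.comm_monoid_axioms) auto
    also have "\<dots> = mprod (mon_of A') (\<lambda>x. point_map A' (f x)) m"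
      using p sub fc A'.point_map_closed by (intro A'.mprod_cong) auto
    also have "\<dots> = str A' (\<Sum>x \<in># m. free_unit (pset_of A') (f x))"
      using fc by (simp add: A'.str_sum_units)
    also have "\<dots> = str A' (free_map (pset_of A) (pset_of A') f m)"
      using m by (simp add: free_map_def)
    finally show ?thesis .
  qed
  moreover have "g (point_map A x) = point_map A' (f x)"
    if h: ?lhs and x: "x \<in> pts (pset_of A)" for x
  proof -
    have f: "f \<in> pset_hom (pset_of A) (pset_of A')" using h by (simp add: comma_hom_def)
    then have "f x \<in> pts (pset_of A')" using x by (auto simp: pset_hom_def)
    then show ?thesis
      using h x free_unit_closed[OF x] free_map_unit[OF f x A'.pointed]
      by (simp add: comma_hom_def point_map_eq)
  qed
  ultimately show ?thesis unfolding comma_hom_def by blast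
qed

locale B_object = comma_object A for A :: "('u, 'u) cobj" +
  assumes ob: "A \<in> Ob cat_B"
begin

lemma generated_gens: "generated (mon_of A) (gens A) = carr A"
  using ob surjective_obj_iff by (simp add: Ob_cat_B)

lemma inj_point_map: "inj_on (point_map A) (pts (pset_of A))"
  using ob monic_obj_iff by (simp add: Ob_cat_B)

lemma small_carr: "small TYPE('u) (carr A)"
  using ob by (simp add: Ob_cat_B small_cobj_def)

lemma small_gens: "small TYPE('u) (gens A)"
  using small_carr gens_subset by (rule small_subset)

end

lemma B_objectI: "A \<in> Ob cat_B \<Longrightarrow> B_object A"
  by unfold_locales (simp_all add: Ob_cat_B)

lemma mmap_hom: "h \<in> Hom cat_B A A' \<Longrightarrow> mmap h \<in> mon_hom (mon_of A) (mon_of A')"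
  by (simp add: Hom_cat_B comma_hom_def)

lemma pmap_hom: "h \<in> Hom cat_B A A' \<Longrightarrow> pmap h \<in> pset_hom (pset_of A) (pset_of A')"
  by (simp add: Hom_cat_B comma_hom_def)

lemma mmap_point:
  assumes "h \<in> Hom cat_B A A'" "x \<in> pts (pset_of A)"
  shows "mmap h (point_map A x) = point_map A' (pmap h x)"
  using assms comma_hom_iff[of A A' "pmap h" "mmap h"] by (simp add: Hom_cat_B Ob_cat_B)

lemma mmap_gens:
  assumes "h \<in> Hom cat_B A A'" "x \<in> gens A"
  shows "mmap h x \<in> gens A'"
  using assms mmap_point[OF assms(1)] pmap_hom[OF assms(1)] by (auto simp: gens_def pset_hom_def)

lemma Hom_cat_B_ob: "h \<in> Hom cat_B A A' \<Longrightarrow> A \<in> Ob cat_B" "h \<in> Hom cat_B A A' \<Longrightarrow> A' \<in> Ob cat_B"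
  by (simp_all add: Hom_cat_B)

text \<open>Values on generators determine \<open>mmap\<close> by condition (a) for the source. Then
  \<open>pmap\<close> is recovered because the point map of the target is injective, which is
  condition (b).\<close>

lemma arrow_eqI:
  assumes h: "h \<in> Hom cat_B A A'" and k: "k \<in> Hom cat_B A A'"
    and e: "\<And>x. x \<in> gens A \<Longrightarrow> mmap h x = mmap k x"
  shows "h = k"
proof -
  interpret A: B_object A using h by (intro B_objectI Hom_cat_B_ob)
  interpret A': B_object A' using h by (intro B_objectI Hom_cat_B_ob)
  have "mmap h = mmap k"
    by (rule mon_hom_eq_on_generated[OF mmap_hom[OF h] mmap_hom[OF k] A.generated_gens A.gens_subset e])
  moreover have "pmap h = pmap k"
  proof (rule PiE_ext)
    show "pmap h \<in> pts (pset_of A) \<rightarrow>\<^sub>E pts (pset_of A')" "pmap k \<in> pts (pset_of A) \<rightarrow>\<^sub>E pts (pset_of A')"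
      using pmap_hom[OF h] pmap_hom[OF k] by (simp_all add: pset_hom_def)
    fix x assume x: "x \<in> pts (pset_of A)"
    have "point_map A' (pmap h x) = point_map A' (pmap k x)"
      using e[of "point_map A x"] x mmap_point[OF h x] mmap_point[OF k x] by (simp add: gens_def)
    then show "pmap h x = pmap k x"
      using pmap_hom[OF h] pmap_hom[OF k] x A'.inj_point_map
      by (auto simp: pset_hom_def dest: inj_onD)
  qed
  ultimately show ?thesis
    using h k by (cases h, cases k) (simp add: Hom_cat_B)
qed

text \<open>The point component is forced by g: the point map of the target has to send it to the
  value of g at the generator, and this point map is injective in B.\<close>

definition arrow :: "('u, 'u) cobj \<Rightarrow> ('u, 'u) cobj \<Rightarrow> ('u \<Rightarrow> 'u) \<Rightarrow> ('u, 'u) carrow" where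
  "arrow A A' g = CArrow A A'
     (\<lambda>x \<in> pts (pset_of A). inv_into (pts (pset_of A')) (point_map A') (g (point_map A x))) g"

lemma mmap_arrow [simp]: "mmap (arrow A A' g) = g"
  by (simp add: arrow_def)

lemma arrow_in_Hom:
  assumes "A \<in> Ob cat_B" "A' \<in> Ob cat_B" and g: "g \<in> mon_hom (mon_of A) (mon_of A')"
    and gg: "\<And>x. x \<in> gens A \<Longrightarrow> g x \<in> gens A'"
  shows "arrow A A' g \<in> Hom cat_B A A'"
proof -
  interpret A: B_object A using assms by (intro B_objectI)
  interpret A': B_object A' using assms by (intro B_objectI)
  let ?f = "pmap (arrow A A' g)"
  have f: "?f x \<in> pts (pset_of A')" "point_map A' (?f x) = g (point_map A x)"
    if "x \<in> pts (pset_of A)" for x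
  proof -
    have "g (point_map A x) \<in> point_map A' ` pts (pset_of A')"
      using gg[of "point_map A x"] that by (simp add: gens_def)
    then show "?f x \<in> pts (pset_of A')" "point_map A' (?f x) = g (point_map A x)"
      using that by (simp_all add: arrow_def inv_into_into f_inv_into_f)
  qed
  \<comment> \<open>The point map of the target sends both points to the neutral element, and it is
    injective.\<close>
  have "?f (bpt (pset_of A)) = bpt (pset_of A')"
    using f[of "bpt (pset_of A)"] A.pointed A'.pointed mon_homD(4)[OF g]
      inj_on_eq_iff[OF A'.inj_point_map, of "?f (bpt (pset_of A))" "bpt (pset_of A')"]
    by (simp add: pointed_set_def A.point_map_bpt A'.point_map_bpt)
  then have "?f \<in> pset_hom (pset_of A) (pset_of A')"
    using f(1) by (auto simp: pset_hom_def) (simp add: arrow_def)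
  then show ?thesis
    unfolding Hom_cat_B using assms f(2) A.comma_obj A'.comma_obj
    by (simp add: comma_hom_iff) (simp add: arrow_def)
qed

lemma mmap_Ident:
  "a \<in> carr A \<Longrightarrow> mmap (Ident cat_B A) a = a"
  by (simp add: cat_B_def full_subcategory_def comma_category_def)

lemma mmap_Comp:
  assumes "h \<in> Hom cat_B A A'" "a \<in> carr A"
  shows "mmap (k \<cdot>\<^bsub>cat_B\<^esub> h) a = mmap k (mmap h a)"
  using assms by (simp add: cat_B_def full_subcategory_def comma_category_def compose_def Hom_def)

lemma Ident_in_Hom:
  assumes "A \<in> Ob cat_B"
  shows "Ident cat_B A \<in> Hom cat_B A A"
proof -
  interpret A: B_object A using assms by (rule B_objectI)
  have "restrict id (pts (pset_of A)) \<in> pset_hom (pset_of A) (pset_of A)"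
    using A.pointed by (simp add: pset_hom_def pointed_set_def)
  moreover have "restrict id (carr A) \<in> mon_hom (mon_of A) (mon_of A)"
    by (rule mon_homI) simp_all
  ultimately show ?thesis
    unfolding Hom_cat_B using assms A.comma_obj A.point_map_closed
    by (simp add: comma_hom_iff) (simp add: cat_B_def full_subcategory_def comma_category_def)
qed

lemma Comp_in_Hom:
  assumes h: "h \<in> Hom cat_B A B" and k: "k \<in> Hom cat_B B D"
  shows "k \<cdot>\<^bsub>cat_B\<^esub> h \<in> Hom cat_B A D"
proof -
  interpret A: B_object A using h by (intro B_objectI Hom_cat_B_ob)
  interpret B: B_object B using k by (intro B_objectI Hom_cat_B_ob)
  interpret D: B_object D using k by (intro B_objectI Hom_cat_B_ob)
  have e: "k \<cdot>\<^bsub>cat_B\<^esub> h = CArrow A D (compose (pts (pset_of A)) (pmap k) (pmap h))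
      (compose (carr A) (mmap k) (mmap h))"
    using h k by (simp add: cat_B_def full_subcategory_def comma_category_def Hom_def)
  have p: "pmap h x \<in> pts (pset_of B)" if "x \<in> pts (pset_of A)" for x
    using that pmap_hom[OF h] by (auto simp: pset_hom_def)
  have "compose (pts (pset_of A)) (pmap k) (pmap h) \<in> pset_hom (pset_of A) (pset_of D)"
    using pmap_hom[OF h] pmap_hom[OF k] p A.pointed
    by (auto simp: pset_hom_def compose_def pointed_set_def)
  moreover have "compose (carr A) (mmap k) (mmap h) \<in> mon_hom (mon_of A) (mon_of D)"
    by (rule mon_hom_compose[OF mmap_hom[OF h] mmap_hom[OF k] A.monoid_axioms])
  moreover have "compose (carr A) (mmap k) (mmap h) (point_map A x) =
      point_map D (compose (pts (pset_of A)) (pmap k) (pmap h) x)" if "x \<in> pts (pset_of A)" for x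
    using that p mmap_point[OF h that] mmap_point[OF k] A.point_map_closed by (simp add: compose_def)
  ultimately show ?thesis
    unfolding Hom_cat_B e using h k A.comma_obj D.comma_obj
    by (simp add: comma_hom_iff Hom_cat_B)
qed

lemma mmap_closed: "h \<in> Hom cat_B A A' \<Longrightarrow> a \<in> carr A \<Longrightarrow> mmap h a \<in> carr A'"
  by (rule mon_homD(2)[OF mmap_hom])

lemma Hom_cat_B_gens:
  "h \<in> Hom cat_B A A' \<Longrightarrow> x \<in> gens A \<Longrightarrow> x \<in> carr A"
  using comma_object.gens_closed[of A x] by (simp add: Hom_cat_B Ob_cat_B comma_object_def)

lemma category_cat_B: "category cat_B"
proof
  fix f assume "f \<in> Arr cat_B"
  then show "Dom cat_B f \<in> Ob cat_B \<and> Cod cat_B f \<in> Ob cat_B"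
    by (auto simp: cat_B_def full_subcategory_def comma_category_def)
next
  fix f g h A B D E assume fgh: "f \<in> Hom cat_B A B" "g \<in> Hom cat_B B D" "h \<in> Hom cat_B D E"
  show "h \<cdot>\<^bsub>cat_B\<^esub> (g \<cdot>\<^bsub>cat_B\<^esub> f) = (h \<cdot>\<^bsub>cat_B\<^esub> g) \<cdot>\<^bsub>cat_B\<^esub> f"
    using fgh Comp_in_Hom[OF fgh(1,2)] Comp_in_Hom[OF fgh(2,3)]
    by (intro arrow_eqI[of _ A E])
      (auto simp: mmap_Comp[of _ A D] mmap_Comp[of _ A B] mmap_Comp[of _ B D] mmap_closed
        Hom_cat_B_gens intro: Comp_in_Hom)
next
  fix f A B assume f: "f \<in> Hom cat_B A B"
  note ob = Hom_cat_B_ob[OF f]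
  show "f \<cdot>\<^bsub>cat_B\<^esub> Ident cat_B A = f"
    using f Ident_in_Hom[OF ob(1)]
    by (intro arrow_eqI[of _ A B])
      (auto simp: mmap_Comp[of _ A A] mmap_Ident Hom_cat_B_gens intro: Comp_in_Hom)
  show "Ident cat_B B \<cdot>\<^bsub>cat_B\<^esub> f = f"
    using f Ident_in_Hom[OF ob(2)]
    by (intro arrow_eqI[of _ A B])
      (auto simp: mmap_Comp[of _ A B] mmap_Ident Hom_cat_B_gens mmap_closed intro: Comp_in_Hom)
qed (auto intro: Ident_in_Hom Comp_in_Hom)

section \<open>Encoding a monoid with small generating set as an object of B\<close>

text \<open>An arbitrary injection into the universe; it exists when S is small, see
  \<open>inj_enc\<close>. Only the generated submonoid is encoded, which yields condition
  (a).\<close>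

definition enc :: "('b, 'x) monoid_scheme \<Rightarrow> 'b set \<Rightarrow> 'b \<Rightarrow> 'u" where
  "enc M S = (SOME e. inj_on e (generated M S))"

definition dec :: "('b, 'x) monoid_scheme \<Rightarrow> 'b set \<Rightarrow> 'u \<Rightarrow> 'b" where
  "dec M S = inv_into (generated M S) (enc M S)"

text \<open>The points are themselves elements of the encoded monoid and \<open>str\<close> sums
  them there, so the point map is the inclusion and condition (b) is immediate.\<close>

definition obj_of :: "'b monoid \<Rightarrow> 'b set \<Rightarrow> ('u, 'u) cobj" where
  "obj_of M S =
     (let X = \<lparr>pts = enc M S ` S, bpt = enc M S \<one>\<^bsub>M\<^esub>\<rparr>;
          N = \<lparr>carrier = enc M S ` generated M S,
               monoid.mult = (\<lambda>t u. enc M S (dec M S t \<otimes>\<^bsub>M\<^esub> dec M S u)),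
               one = enc M S \<one>\<^bsub>M\<^esub>\<rparr>
      in \<lparr>pset_of = X, mon_of = N, str = restrict (mprod N (\<lambda>x. x)) (carrier (free_mon X))\<rparr>)"

text \<open>The hypotheses under which \<open>obj_of M S\<close> is an object of B. The instances
  are the tensor product, its unit, the internal hom, limits and colimits. The parameter U fixes the
  type of the universe.\<close>

locale small_generators = comm_monoid M for M :: "'b monoid" (structure) +
  fixes S :: "'b set" and U :: "'u itself"
  assumes inaccessible: "inaccessible TYPE('u)" and S_closed: "S \<subseteq> carrier M"
    and one_in_S: "\<one> \<in> S" and small_S: "small TYPE('u) S"
begin

abbreviation T :: "('u, 'u) cobj" where "T \<equiv> obj_of M S"
abbreviation e :: "'b \<Rightarrow> 'u" where "e \<equiv> enc M S"
abbreviation d :: "'u \<Rightarrow> 'b" where "d \<equiv> dec M S"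

lemma small_generated: "small TYPE('u) (generated M S)"
  unfolding generated_eq_mprod[OF S_closed]
  by (intro small_image small_multisets inaccessible small_S)

lemma inj_enc: "inj_on e (generated M S)"
  unfolding enc_def using small_imp_inj_on[OF small_generated] by (metis someI_ex)

lemma dec_enc: "a \<in> generated M S \<Longrightarrow> d (e a) = a"
  by (simp add: dec_def inj_enc)

lemma carr_obj_of: "carr T = e ` generated M S"
  and mult_obj_of: "t \<otimes>\<^bsub>mon_of T\<^esub> u = e (d t \<otimes> d u)"
  and one_obj_of: "\<one>\<^bsub>mon_of T\<^esub> = e \<one>"
  and pset_obj_of: "pset_of T = \<lparr>pts = e ` S, bpt = e \<one>\<rparr>"
  and str_obj_of: "str T = restrict (mprod (mon_of T) (\<lambda>x. x)) (carrier (free_mon (pset_of T)))"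
  by (simp_all add: obj_of_def Let_def)

lemma dec_closed: "t \<in> carr T \<Longrightarrow> d t \<in> generated M S"
  and enc_dec: "t \<in> carr T \<Longrightarrow> e (d t) = t"
  by (simp_all add: carr_obj_of dec_def inv_into_into f_inv_into_f)

lemma enc_closed: "a \<in> generated M S \<Longrightarrow> e a \<in> carr T"
  by (simp add: carr_obj_of)

lemma enc_mult:
  "a \<in> generated M S \<Longrightarrow> b \<in> generated M S \<Longrightarrow> e (a \<otimes> b) = e a \<otimes>\<^bsub>mon_of T\<^esub> e b"
  by (simp add: mult_obj_of dec_enc)

lemma dec_mult: "t \<in> carr T \<Longrightarrow> u \<in> carr T \<Longrightarrow> d (t \<otimes>\<^bsub>mon_of T\<^esub> u) = d t \<otimes> d u"
  by (simp add: mult_obj_of dec_enc dec_closed generated_mult S_closed)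

lemma dec_one: "d \<one>\<^bsub>mon_of T\<^esub> = \<one>"
  by (simp add: one_obj_of dec_enc generated.one)

lemma comm_monoid_obj_of: "comm_monoid (mon_of T)"
proof (rule comm_monoidI)
  have c: "t \<otimes>\<^bsub>mon_of T\<^esub> u \<in> carr T" if "t \<in> carr T" "u \<in> carr T" for t u
    using that by (simp add: mult_obj_of enc_closed dec_closed generated_mult S_closed)
  then show "t \<otimes>\<^bsub>mon_of T\<^esub> u \<in> carr T" if "t \<in> carr T" "u \<in> carr T" for t u
    using that by simp
  show "\<one>\<^bsub>mon_of T\<^esub> \<in> carr T" by (simp add: one_obj_of enc_closed generated.one)
  have g: "d t \<in> carrier M" if "t \<in> carr T" for t
    using that dec_closed generated_closed S_closed by blast
  show "t \<otimes>\<^bsub>mon_of T\<^esub> u \<otimes>\<^bsub>mon_of T\<^esub> v = t \<otimes>\<^bsub>mon_of T\<^esub> (u \<otimes>\<^bsub>mon_of T\<^esub> v)"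
    if "t \<in> carr T" "u \<in> carr T" "v \<in> carr T" for t u v
    unfolding mult_obj_of[of "t \<otimes>\<^bsub>mon_of T\<^esub> u"] mult_obj_of[of t "u \<otimes>\<^bsub>mon_of T\<^esub> v"]
    using that g by (simp add: dec_mult m_assoc)
  show "t \<otimes>\<^bsub>mon_of T\<^esub> u = u \<otimes>\<^bsub>mon_of T\<^esub> t" if "t \<in> carr T" "u \<in> carr T" for t u
    using that g by (simp add: mult_obj_of m_comm)
  show "\<one>\<^bsub>mon_of T\<^esub> \<otimes>\<^bsub>mon_of T\<^esub> t = t" if "t \<in> carr T" for t
    using that g by (simp add: mult_obj_of dec_one enc_dec)
qed

lemma S_generated: "s \<in> S \<Longrightarrow> s \<in> generated M S"
  using S_closed by (rule generated_incl)

lemma comma_obj_obj_of: "comma_obj T"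
proof -
  interpret T: comm_monoid "mon_of T" by (rule comm_monoid_obj_of)
  have p: "pts (pset_of T) \<subseteq> carr T" using S_generated by (auto simp: pset_obj_of carr_obj_of)
  have "str T \<in> mon_hom (free_mon (pset_of T)) (mon_of T)"
    using p unfolding str_obj_of
    by (intro mon_homI)
      (auto simp: free_mon_def Pi_iff subset_iff intro!: T.mprod_closed T.mprod_union)
  then show ?thesis
    using comm_monoid_obj_of one_in_S by (auto simp: comma_obj_def pointed_set_def pset_obj_of)
qed

lemma point_map_obj_of: "x \<in> pts (pset_of T) \<Longrightarrow> point_map T x = x"
proof -
  interpret T: comm_monoid "mon_of T" by (rule comm_monoid_obj_of)
  assume x: "x \<in> pts (pset_of T)"
  then have "x \<in> carr T" using S_generated by (auto simp: pset_obj_of carr_obj_of)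
  then show ?thesis
    using x free_unit_closed[OF x] unfolding point_map_eq[OF x]
    by (auto simp: str_obj_of free_unit_def pset_obj_of one_obj_of)
qed

lemma gens_obj_of: "gens T = e ` S"
  using point_map_obj_of by (auto simp: gens_def) (auto simp: pset_obj_of image_iff)

lemma generated_obj_of: "a \<in> generated M S \<Longrightarrow> e a \<in> generated (mon_of T) (gens T)"
proof (induction rule: generated.induct)
  case one
  then show ?case unfolding one_obj_of[symmetric] by (rule generated.one)
next
  case (mult s a)
  then show ?case
    by (simp add: enc_mult S_generated gens_obj_of generated.mult)
qed

lemma obj_of_in_Ob: "T \<in> Ob cat_B"
proof -
  interpret T: comma_object T by unfold_locales (rule comma_obj_obj_of)
  have "generated (mon_of T) (gens T) = carr T"
    using T.generated_closed[OF T.gens_subset] generated_obj_of by (auto simp: carr_obj_of)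
  moreover have "small TYPE('u) (pts (pset_of T))" "small TYPE('u) (carr T)"
    by (simp_all add: pset_obj_of carr_obj_of small_image small_S small_generated)
  ultimately show ?thesis
    by (simp add: Ob_cat_B comma_obj_obj_of small_cobj_def T.surjective_obj_iff T.monic_obj_iff)
      (simp add: inj_on_def point_map_obj_of)
qed

text \<open>Since \<open>gens A\<close> generates A and is sent into S, all values of g lie in
  \<open>generated M S\<close>, where encoding is injective and can be undone by decoding.\<close>

lemma arrow_to_obj_of:
  assumes "A \<in> Ob cat_B" and g: "g \<in> mon_hom (mon_of A) M" and gg: "\<And>x. x \<in> gens A \<Longrightarrow> g x \<in> S"
  obtains h where "h \<in> Hom cat_B A T" "\<And>a. a \<in> carr A \<Longrightarrow> d (mmap h a) = g a"
proof -
  interpret A: B_object A using assms(1) by (rule B_objectI)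
  have c: "g a \<in> generated M S" if "a \<in> carr A" for a
  proof -
    have "a \<in> generated (mon_of A) (gens A)" using that by (simp add: A.generated_gens)
    then show ?thesis
    proof induction
      case one
      then show ?case using mon_homD(4)[OF g] by (simp add: generated.one)
    next
      case (mult s a)
      moreover have "s \<in> carr A" "a \<in> carr A"
        using mult A.gens_closed by (simp_all add: A.generated_gens)
      ultimately show ?case using gg by (simp add: mon_homD(3)[OF g] generated.mult)
    qed
  qed
  have "arrow A T (\<lambda>a \<in> carr A. e (g a)) \<in> Hom cat_B A T"
    using c gg mon_homD[OF g] assms(1)
    by (intro arrow_in_Hom obj_of_in_Ob mon_homI)
      (auto simp: enc_closed enc_mult one_obj_of gens_obj_of A.gens_closed)
  then show ?thesis using c dec_enc by (intro that) auto
qed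

text \<open>Serves for the projections of a limit and for the mediating arrows out of a
  colimit.\<close>

lemma arrow_from_obj_of:
  assumes "A \<in> Ob cat_B" and g: "g \<in> mon_hom (M\<lparr>carrier := generated M S\<rparr>) (mon_of A)"
    and gg: "\<And>x. x \<in> S \<Longrightarrow> g x \<in> gens A"
  obtains h where "h \<in> Hom cat_B T A" "\<And>t. t \<in> carr T \<Longrightarrow> mmap h t = g (d t)"
    "\<And>a. a \<in> generated M S \<Longrightarrow> mmap h (e a) = g a"
proof -
  interpret A: B_object A using assms(1) by (rule B_objectI)
  interpret T: comm_monoid "mon_of T" by (rule comm_monoid_obj_of)
  have "arrow T A (\<lambda>t \<in> carr T. g (d t)) \<in> Hom cat_B T A"
    using mon_homD[OF g] assms(1) gg
    by (intro arrow_in_Hom obj_of_in_Ob mon_homI)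
      (auto simp: dec_closed dec_mult dec_one gens_obj_of dec_enc S_generated enc_closed)
  then show ?thesis using enc_closed dec_enc by (intro that) auto
qed

end

section \<open>Tensor products\<close>

text \<open>The common form of \<open>tensor_mon\<close> and of the colimit of a diagram of monoids;
  both are quotients of formal sums and differ in the relation R.\<close>

definition quot_mon :: "'a set \<Rightarrow> ('a multiset \<times> 'a multiset) set \<Rightarrow> 'a multiset set monoid" where
  "quot_mon S R =
     \<lparr>carrier = {s. set_mset s \<subseteq> S} // R,
      monoid.mult = (\<lambda>c d. R `` {s + t | s t. s \<in> c \<and> t \<in> d}),
      one = R `` {{#}}\<rparr>"

locale mset_congruence =
  fixes S :: "'a set" and R :: "('a multiset \<times> 'a multiset) set"
  assumes equiv: "equiv {s. set_mset s \<subseteq> S} R"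
    and add: "(s, t) \<in> R \<Longrightarrow> (s', t') \<in> R \<Longrightarrow> (s + s', t + t') \<in> R"
begin

abbreviation Q :: "'a multiset set monoid" where "Q \<equiv> quot_mon S R"
abbreviation cls :: "'a multiset \<Rightarrow> 'a multiset set" where "cls s \<equiv> R `` {s}"

lemma cls_eq_iff:
  "set_mset s \<subseteq> S \<Longrightarrow> set_mset t \<subseteq> S \<Longrightarrow> cls s = cls t \<longleftrightarrow> (s, t) \<in> R"
  using eq_equiv_class_iff[OF equiv] by simp

lemma cls_closed: "set_mset s \<subseteq> S \<Longrightarrow> cls s \<in> carrier Q"
  by (auto simp: quot_mon_def intro: quotientI)

lemma carrier_quot_mon: "carrier Q = cls ` {s. set_mset s \<subseteq> S}"
  by (auto simp: quot_mon_def quotient_def)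

lemma one_quot_mon: "\<one>\<^bsub>Q\<^esub> = cls {#}"
  by (simp add: quot_mon_def)

text \<open>The product of two classes saturates the set of all sums of representatives. These sums
  are all related to one another because R respects addition, and \<open>s + t\<close> is one of
  them by reflexivity.\<close>

lemma mult_cls:
  assumes "set_mset s \<subseteq> S" "set_mset t \<subseteq> S"
  shows "cls s \<otimes>\<^bsub>Q\<^esub> cls t = cls (s + t)"
proof -
  have "(s, s) \<in> R" "(t, t) \<in> R"
    using equiv assms by (auto simp: equiv_def refl_on_def)
  then have "R `` {s' + t' | s' t'. s' \<in> cls s \<and> t' \<in> cls t} = cls (s + t)"
    using add equivE[OF equiv] by (auto dest: transD) (metis (mono_tags, lifting) transD)+
  then show ?thesis by (simp add: quot_mon_def)
qed

lemma comm_monoid_quot_mon: "comm_monoid Q"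
  by (rule comm_monoidI)
    (auto simp: carrier_quot_mon one_quot_mon mult_cls ac_simps)

lemma cls_eq_mprod:
  assumes "set_mset s \<subseteq> S"
  shows "cls s = mprod Q (\<lambda>x. cls {#x#}) s"
proof -
  interpret Q: comm_monoid Q by (rule comm_monoid_quot_mon)
  show ?thesis using assms
  proof (induction s)
    case empty
    then show ?case by (simp add: one_quot_mon)
  next
    case (add x s)
    then have "mprod Q (\<lambda>x. cls {#x#}) (add_mset x s) = cls {#x#} \<otimes>\<^bsub>Q\<^esub> mprod Q (\<lambda>x. cls {#x#}) s"
      by (intro Q.mprod_add) (auto simp: cls_closed)
    also have "\<dots> = cls ({#x#} + s)" using add by (subst mult_cls[symmetric]) auto
    finally show ?case by simp
  qed
qed

text \<open>The extension of f to formal sums is constant on classes, so it can be evaluated at a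
  chosen representative.\<close>

lemma quot_mon_lift:
  assumes "comm_monoid N" and f: "f \<in> S \<rightarrow> carrier N"
    and R: "\<And>s t. (s, t) \<in> R \<Longrightarrow> mprod N f s = mprod N f t"
  obtains h where "h \<in> mon_hom Q N" "\<And>s. set_mset s \<subseteq> S \<Longrightarrow> h (cls s) = mprod N f s"
proof -
  interpret N: comm_monoid N by fact
  define h where "h = (\<lambda>c \<in> carrier Q. mprod N f (SOME s. s \<in> c))"
  have h: "h (cls s) = mprod N f s" if "set_mset s \<subseteq> S" for s
  proof -
    have "s \<in> cls s" using equiv that by (auto simp: equiv_def refl_on_def)
    then have "(SOME t. t \<in> cls s) \<in> cls s" by (rule someI)
    then show ?thesis using R[of s "SOME t. t \<in> cls s"] that by (simp add: h_def cls_closed)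
  qed
  have c: "mprod N f s \<in> carrier N" if "set_mset s \<subseteq> S" for s
    using that f by (intro N.mprod_closed) auto
  have "h \<in> mon_hom Q N"
  proof (rule mon_homI)
    show "h \<in> extensional (carrier Q)" by (simp add: h_def)
    show "h \<one>\<^bsub>Q\<^esub> = \<one>\<^bsub>N\<^esub>" by (simp add: one_quot_mon h)
    fix a assume "a \<in> carrier Q"
    then obtain s where s: "set_mset s \<subseteq> S" "a = cls s" by (auto simp: carrier_quot_mon)
    then show "h a \<in> carrier N" by (simp add: h c)
    fix b assume "b \<in> carrier Q"
    then obtain t where t: "set_mset t \<subseteq> S" "b = cls t" by (auto simp: carrier_quot_mon)
    have "mprod N f (s + t) = mprod N f s \<otimes>\<^bsub>N\<^esub> mprod N f t"
      using s t f by (intro N.mprod_union) auto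
    then show "h (a \<otimes>\<^bsub>Q\<^esub> b) = h a \<otimes>\<^bsub>N\<^esub> h b"
      using s t by (simp add: mult_cls h)
  qed
  then show ?thesis using h by (rule that)
qed

end

lemma (in comm_monoid) generated_least:
  assumes "T \<subseteq> carrier G" "S \<subseteq> generated G T" "a \<in> generated G S"
  shows "a \<in> generated G T"
  using assms(3)
  by induction (use assms in \<open>auto intro: generated.one generated_mult\<close>)

section \<open>Biadditive maps and the universal property of the tensor product\<close>

text \<open>The two conditions on neutral elements are separate since without cancellation they do
  not follow from additivity.\<close>

definition biadditive :: "('a, 'x) monoid_scheme \<Rightarrow> ('b, 'y) monoid_scheme \<Rightarrow> ('c, 'z) monoid_scheme
    \<Rightarrow> ('a \<Rightarrow> 'b \<Rightarrow> 'c) \<Rightarrow> bool" where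
  "biadditive M N P \<beta> \<longleftrightarrow>
     (\<forall>a \<in> carrier M. \<forall>b \<in> carrier N. \<beta> a b \<in> carrier P) \<and>
     (\<forall>a \<in> carrier M. \<forall>a' \<in> carrier M. \<forall>b \<in> carrier N. \<beta> (a \<otimes>\<^bsub>M\<^esub> a') b = \<beta> a b \<otimes>\<^bsub>P\<^esub> \<beta> a' b) \<and>
     (\<forall>a \<in> carrier M. \<forall>b \<in> carrier N. \<forall>b' \<in> carrier N. \<beta> a (b \<otimes>\<^bsub>N\<^esub> b') = \<beta> a b \<otimes>\<^bsub>P\<^esub> \<beta> a b') \<and>
     (\<forall>b \<in> carrier N. \<beta> \<one>\<^bsub>M\<^esub> b = \<one>\<^bsub>P\<^esub>) \<and> (\<forall>a \<in> carrier M. \<beta> a \<one>\<^bsub>N\<^esub> = \<one>\<^bsub>P\<^esub>)"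

lemma biadditiveI:
  assumes "\<And>a b. a \<in> carrier M \<Longrightarrow> b \<in> carrier N \<Longrightarrow> \<beta> a b \<in> carrier P"
    "\<And>a a' b. a \<in> carrier M \<Longrightarrow> a' \<in> carrier M \<Longrightarrow> b \<in> carrier N \<Longrightarrow> \<beta> (a \<otimes>\<^bsub>M\<^esub> a') b = \<beta> a b \<otimes>\<^bsub>P\<^esub> \<beta> a' b"
    "\<And>a b b'. a \<in> carrier M \<Longrightarrow> b \<in> carrier N \<Longrightarrow> b' \<in> carrier N \<Longrightarrow> \<beta> a (b \<otimes>\<^bsub>N\<^esub> b') = \<beta> a b \<otimes>\<^bsub>P\<^esub> \<beta> a b'"
    "\<And>b. b \<in> carrier N \<Longrightarrow> \<beta> \<one>\<^bsub>M\<^esub> b = \<one>\<^bsub>P\<^esub>" "\<And>a. a \<in> carrier M \<Longrightarrow> \<beta> a \<one>\<^bsub>N\<^esub> = \<one>\<^bsub>P\<^esub>"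
  shows "biadditive M N P \<beta>"
  using assms unfolding biadditive_def by blast

lemma biadditiveD:
  assumes "biadditive M N P \<beta>"
  shows "\<And>a b. a \<in> carrier M \<Longrightarrow> b \<in> carrier N \<Longrightarrow> \<beta> a b \<in> carrier P"
    "\<And>a a' b. a \<in> carrier M \<Longrightarrow> a' \<in> carrier M \<Longrightarrow> b \<in> carrier N \<Longrightarrow> \<beta> (a \<otimes>\<^bsub>M\<^esub> a') b = \<beta> a b \<otimes>\<^bsub>P\<^esub> \<beta> a' b"
    "\<And>a b b'. a \<in> carrier M \<Longrightarrow> b \<in> carrier N \<Longrightarrow> b' \<in> carrier N \<Longrightarrow> \<beta> a (b \<otimes>\<^bsub>N\<^esub> b') = \<beta> a b \<otimes>\<^bsub>P\<^esub> \<beta> a b'"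
    "\<And>b. b \<in> carrier N \<Longrightarrow> \<beta> \<one>\<^bsub>M\<^esub> b = \<one>\<^bsub>P\<^esub>" "\<And>a. a \<in> carrier M \<Longrightarrow> \<beta> a \<one>\<^bsub>N\<^esub> = \<one>\<^bsub>P\<^esub>"
  using assms unfolding biadditive_def by blast+

definition tpure :: "('a, 'x) monoid_scheme \<Rightarrow> ('b, 'y) monoid_scheme \<Rightarrow> 'a \<Rightarrow> 'b \<Rightarrow> ('a \<times> 'b) multiset set" where
  "tpure M N a b = tensor_rel M N `` {{#(a, b)#}}"

locale monoid_pair = M: comm_monoid M + N: comm_monoid N
  for M :: "('a, 'x) monoid_scheme" and N :: "('b, 'y) monoid_scheme"
begin

lemma tensor_eq_closed:
  "tensor_eq M N s t \<Longrightarrow> set_mset s \<subseteq> carrier M \<times> carrier N \<and> set_mset t \<subseteq> carrier M \<times> carrier N"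
  by (induction rule: tensor_eq.induct) auto

sublocale mset_congruence "carrier M \<times> carrier N" "tensor_rel M N"
proof
  show "equiv {s. set_mset s \<subseteq> carrier M \<times> carrier N} (tensor_rel M N)"
    using tensor_eq_closed
    by (auto simp: equiv_def refl_on_def sym_def trans_def tensor_rel_def
        intro: tensor_eq.refl tensor_eq.sym tensor_eq.trans)
qed (auto simp: tensor_rel_def intro: tensor_eq.add)

lemma tensor_mon_eq: "tensor_mon M N = quot_mon (carrier M \<times> carrier N) (tensor_rel M N)"
  by (simp add: tensor_mon_def quot_mon_def)

lemma comm_monoid_tensor_mon: "comm_monoid (tensor_mon M N)"
  unfolding tensor_mon_eq by (rule comm_monoid_quot_mon)

lemma biadditive_tpure: "biadditive M N (tensor_mon M N) (tpure M N)"
  unfolding tensor_mon_eq tpure_def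
proof (rule biadditiveI, goal_cases)
  case (2 a a' b)
  then have "cls {#(a \<otimes>\<^bsub>M\<^esub> a', b)#} = cls {#(a, b), (a', b)#}"
    by (subst cls_eq_iff) (auto simp: tensor_rel_def intro: tensor_eq.add_left)
  then show ?case using 2 by (simp add: mult_cls add_mset_commute)
next
  case (3 a b b')
  then have "cls {#(a, b \<otimes>\<^bsub>N\<^esub> b')#} = cls {#(a, b), (a, b')#}"
    by (subst cls_eq_iff) (auto simp: tensor_rel_def intro: tensor_eq.add_right)
  then show ?case using 3 by (simp add: mult_cls add_mset_commute)
next
  case (4 b)
  then show ?case unfolding one_quot_mon
    by (subst cls_eq_iff) (auto simp: tensor_rel_def intro: tensor_eq.zero_left)
next
  case (5 a)
  then show ?case unfolding one_quot_mon
    by (subst cls_eq_iff) (auto simp: tensor_rel_def intro: tensor_eq.zero_right)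
qed (auto intro: cls_closed)

text \<open>Pure tensors are expanded one variable at a time: first the second factor over Y, with
  the first one in X; then the first factor over X. Every class is a sum of pure tensors by
  \<open>cls_eq_mprod\<close>.\<close>

lemma generated_tpure:
  assumes "generated M X = carrier M" "generated N Y = carrier N" "X \<subseteq> carrier M" "Y \<subseteq> carrier N"
  shows "generated (tensor_mon M N) (case_prod (tpure M N) ` (X \<times> Y)) = carrier (tensor_mon M N)"
    (is "generated ?T ?G = _")
proof -
  interpret T: comm_monoid ?T by (rule comm_monoid_tensor_mon)
  note bi = biadditiveD[OF biadditive_tpure]
  have G: "?G \<subseteq> carrier ?T" using assms(3,4) by (auto intro!: bi(1))
  have 1: "tpure M N x b \<in> generated ?T ?G" if x: "x \<in> X" and b: "b \<in> carrier N" for x b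
  proof -
    have "b \<in> generated N Y" using b assms(2) by simp
    then show ?thesis
    proof induction
      case one
      have "x \<in> carrier M" using x assms(3) by blast
      then show ?case by (simp add: bi(5) generated.one)
    next
      case (mult y b)
      moreover have "y \<in> carrier N" "b \<in> carrier N" "x \<in> carrier M" using mult x assms by auto
      ultimately show ?case using x by (auto simp: bi(3) intro: generated.mult)
    qed
  qed
  have 2: "tpure M N a b \<in> generated ?T ?G" if a: "a \<in> carrier M" and b: "b \<in> carrier N" for a b
  proof -
    have "a \<in> generated M X" using a assms(1) by simp
    then show ?thesis
    proof induction
      case one
      then show ?case using b by (auto simp: bi(4) intro: generated.one)
    next
      case (mult x a)
      moreover have "x \<in> carrier M" "a \<in> carrier M" using mult assms by auto
      ultimately show ?case using b 1 by (auto simp: bi(2) intro: T.generated_mult[OF G])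
    qed
  qed
  have "c \<in> generated ?T ?G" if c: "c \<in> carrier ?T" for c
  proof -
    obtain s where s: "set_mset s \<subseteq> carrier M \<times> carrier N" "c = cls s"
      using c by (auto simp: tensor_mon_eq carrier_quot_mon)
    have "mprod ?T (\<lambda>(a, b). tpure M N a b) s \<in> generated ?T (case_prod (tpure M N) ` (carrier M \<times> carrier N))"
      using s(1) bi(1) by (intro T.mprod_in_generated) auto
    moreover have "mprod ?T (\<lambda>(a, b). tpure M N a b) s = c"
      using cls_eq_mprod[OF s(1)] by (simp add: s(2) tensor_mon_eq tpure_def case_prod_unfold)
    moreover have "case_prod (tpure M N) ` (carrier M \<times> carrier N) \<subseteq> generated ?T ?G"
      using 2 by auto
    ultimately show ?thesis using T.generated_least[OF G] by metis
  qed
  then show ?thesis using T.generated_closed[OF G] by blast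
qed

text \<open>The extension of \<beta> to formal sums respects \<open>tensor_eq\<close> by induction:
  each generating relation becomes one of the equations of biadditivity.\<close>

lemma tensor_mon_lift:
  assumes "comm_monoid P" and b: "biadditive M N P \<beta>"
  obtains h where "h \<in> mon_hom (tensor_mon M N) P"
    "\<And>a b. a \<in> carrier M \<Longrightarrow> b \<in> carrier N \<Longrightarrow> h (tpure M N a b) = \<beta> a b"
proof -
  interpret P: comm_monoid P by fact
  note bi = biadditiveD[OF b]
  have c: "case_prod \<beta> \<in> carrier M \<times> carrier N \<rightarrow> carrier P" by (auto intro!: bi(1))
  have "mprod P (case_prod \<beta>) s = mprod P (case_prod \<beta>) t" if "tensor_eq M N s t" for s t
    using that
  proof induction
    case (add s t s' t')
    have "case_prod \<beta> \<in> set_mset u \<union> set_mset v \<rightarrow> carrier P"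
      if "set_mset u \<subseteq> carrier M \<times> carrier N" "set_mset v \<subseteq> carrier M \<times> carrier N" for u v
      using c that by blast
    note cl = this
    have "mprod P (case_prod \<beta>) (s + s') = mprod P (case_prod \<beta>) s \<otimes>\<^bsub>P\<^esub> mprod P (case_prod \<beta>) s'"
      "mprod P (case_prod \<beta>) (t + t') = mprod P (case_prod \<beta>) t \<otimes>\<^bsub>P\<^esub> mprod P (case_prod \<beta>) t'"
      using tensor_eq_closed[OF add(1)] tensor_eq_closed[OF add(2)]
      by (simp_all only: P.mprod_union cl)
    then show ?case using add(3,4) by simp
  qed (simp_all add: P.mprod_add bi)
  then have "\<And>s t. (s, t) \<in> tensor_rel M N \<Longrightarrow> mprod P (case_prod \<beta>) s = mprod P (case_prod \<beta>) t"
    by (simp add: tensor_rel_def)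
  then obtain h where h: "h \<in> mon_hom (tensor_mon M N) P"
    "\<And>s. set_mset s \<subseteq> carrier M \<times> carrier N \<Longrightarrow> h (cls s) = mprod P (case_prod \<beta>) s"
    using quot_mon_lift[OF assms(1) c] unfolding tensor_mon_eq by blast
  show ?thesis by (rule that[OF h(1)]) (simp add: tpure_def h(2) bi)
qed

text \<open>\<open>tensor_hom\<close> saturates the image of a whole class; by
  \<open>tensor_eq_map\<close> that image lies in a single class, so one representative
  suffices.\<close>

lemma tensor_hom_cls:
  assumes s: "set_mset s \<subseteq> carrier M \<times> carrier N" and g: "g \<in> mon_hom M M'" "h \<in> mon_hom N N'"
  shows "tensor_hom M N M' N' g h (cls s) = tensor_rel M' N' `` {image_mset (map_prod g h) s}"
proof -
  have "tensor_eq M N s s" using s by (rule tensor_eq.refl)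
  then have "tensor_rel M' N' `` (image_mset (map_prod g h) ` cls s) =
      tensor_rel M' N' `` {image_mset (map_prod g h) s}"
    using tensor_eq_map[OF _ g] tensor_eq.trans unfolding tensor_rel_def by fast
  then show ?thesis using cls_closed[OF s] by (simp add: tensor_hom_def tensor_mon_eq)
qed

end

section \<open>The tensor product in the comma category\<close>

locale comma_pair = A: comma_object A + B: comma_object B
  for A :: "('a, 'b) cobj" and B :: "('c, 'd) cobj"
begin

sublocale monoid_pair "mon_of A" "mon_of B" ..

text \<open>The isomorphism \<open>free_smash\<close> replaces each point by its free unit, and the
  structure map on a free unit is the point map.\<close>

lemma str_comma_tensor:
  assumes "m \<in> carrier (free_mon (smash (pset_of A) (pset_of B)))"
  shows "str (comma_tensor A B) m = cls (image_mset (map_prod (point_map A) (point_map B)) m)"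
proof -
  let ?X = "pset_of A" and ?Y = "pset_of B"
  interpret F: monoid_pair "free_mon ?X" "free_mon ?Y"
    by (simp add: monoid_pair_def comm_monoid_free_mon)
  have m: "set_mset m \<subseteq> (pts ?X - {bpt ?X}) \<times> (pts ?Y - {bpt ?Y})"
    using assms by (auto simp: free_mon_def smash_def)
  have "set_mset (image_mset (map_prod (free_unit ?X) (free_unit ?Y)) m)
      \<subseteq> carrier (free_mon ?X) \<times> carrier (free_mon ?Y)"
    using m by (auto intro!: free_unit_closed)
  moreover have "map_prod (str A) (str B) (map_prod (free_unit ?X) (free_unit ?Y) z) =
      map_prod (point_map A) (point_map B) z" if "z \<in># m" for z
    using that m by (auto simp: point_map_eq)
  then have "image_mset (map_prod (str A) (str B)) (image_mset (map_prod (free_unit ?X) (free_unit ?Y)) m) =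
      image_mset (map_prod (point_map A) (point_map B)) m"
    by (simp add: multiset.map_comp comp_def cong: image_mset_cong)
  ultimately show ?thesis
    using assms F.tensor_hom_cls[OF _ A.str_hom B.str_hom]
    by (simp add: comma_tensor_def compose_def free_smash_def)
qed

lemma comma_obj_comma_tensor: "comma_obj (comma_tensor A B)"
proof -
  let ?X = "pset_of A" and ?Y = "pset_of B" and ?W = "comma_tensor A B"
  have c: "set_mset (image_mset (map_prod (point_map A) (point_map B)) m) \<subseteq> carr A \<times> carr B"
    if "m \<in> carrier (free_mon (smash ?X ?Y))" for m
    using that A.point_map_closed B.point_map_closed by (auto simp: free_mon_def smash_def)
  have a: "m \<otimes>\<^bsub>free_mon (smash ?X ?Y)\<^esub> n = m + n" "\<one>\<^bsub>free_mon (smash ?X ?Y)\<^esub> = {#}" for m n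
    by (simp_all add: free_mon_def)
  have d: "m + n \<in> carrier (free_mon (smash ?X ?Y))" "{#} \<in> carrier (free_mon (smash ?X ?Y))"
    if "m \<in> carrier (free_mon (smash ?X ?Y))" "n \<in> carrier (free_mon (smash ?X ?Y))" for m n
    using that by (auto simp: free_mon_def)
  have mon: "mon_of ?W = tensor_mon (mon_of A) (mon_of B)" and ps: "pset_of ?W = smash ?X ?Y"
    by (simp_all add: comma_tensor_def)
  have "str ?W \<in> mon_hom (free_mon (smash ?X ?Y)) (tensor_mon (mon_of A) (mon_of B))"
  proof (rule mon_homI)
    show "str ?W \<in> extensional (carrier (free_mon (smash ?X ?Y)))"
      by (simp add: comma_tensor_def)
    show "str ?W \<one>\<^bsub>free_mon (smash ?X ?Y)\<^esub> = \<one>\<^bsub>tensor_mon (mon_of A) (mon_of B)\<^esub>"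
      unfolding a by (subst str_comma_tensor) (simp_all add: free_mon_def tensor_mon_eq one_quot_mon)
  qed (simp_all only: a str_comma_tensor d tensor_mon_eq cls_closed c mult_cls image_mset_union)
  then show ?thesis
    unfolding comma_obj_def mon ps
    by (simp add: comm_monoid_tensor_mon) (simp add: pointed_set_def smash_def)
qed

text \<open>Pairs containing a base point are collapsed in the smash product; correspondingly, a
  pure tensor with a neutral factor is neutral.\<close>

lemma point_map_comma_tensor:
  assumes "x \<in> pts (pset_of A)" "y \<in> pts (pset_of B)"
  shows "point_map (comma_tensor A B) (smash_pair (pset_of A) (pset_of B) x y) =
    tpure (mon_of A) (mon_of B) (point_map A x) (point_map B y)"
proof -
  let ?X = "pset_of A" and ?Y = "pset_of B" and ?W = "comma_tensor A B"
  interpret W: comma_object ?W by unfold_locales (rule comma_obj_comma_tensor)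
  note bi = biadditiveD[OF biadditive_tpure]
  have ps: "pset_of ?W = smash ?X ?Y" and mon: "mon_of ?W = tensor_mon (mon_of A) (mon_of B)"
    by (simp_all add: comma_tensor_def)
  show ?thesis
  proof (cases "x = bpt ?X \<or> y = bpt ?Y")
    case True
    then have "smash_pair ?X ?Y x y = bpt (pset_of ?W)" by (simp add: smash_pair_def ps smash_def)
    moreover have "tpure (mon_of A) (mon_of B) (point_map A x) (point_map B y) = \<one>\<^bsub>mon_of ?W\<^esub>"
      using True assms by (auto simp: A.point_map_bpt B.point_map_bpt A.point_map_closed B.point_map_closed bi mon)
    ultimately show ?thesis by (simp add: W.point_map_bpt)
  next
    case False
    then have p: "smash_pair ?X ?Y x y = (x, y)" by (simp add: smash_pair_def)
    have xy: "(x, y) \<in> pts (smash ?X ?Y)" using False assms by (simp add: smash_def)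
    have u: "free_unit (smash ?X ?Y) (x, y) = {#(x, y)#}"
      using xy False by (auto simp: free_unit_def smash_def)
    have "{#(x, y)#} \<in> carrier (free_mon (smash ?X ?Y))"
      using free_unit_closed[OF xy] unfolding u .
    then show ?thesis
      unfolding p by (simp add: point_map_eq ps xy u str_comma_tensor tpure_def)
  qed
qed

end

section \<open>The monoidal product of B\<close>

text \<open>Different pairs of generators may have the same pure tensor. Taking the set of pure
  tensors makes the identification of points that reflects the product into B.\<close>

definition ten_gens :: "('a, 'b) cobj \<Rightarrow> ('c, 'd) cobj \<Rightarrow> ('b \<times> 'd) multiset set set" where
  "ten_gens A B = case_prod (tpure (mon_of A) (mon_of B)) ` (gens A \<times> gens B)"

definition ten :: "('u, 'u) cobj \<Rightarrow> ('u, 'u) cobj \<Rightarrow> ('u, 'u) cobj" where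
  "ten A B = obj_of (tensor_mon (mon_of A) (mon_of B)) (ten_gens A B)"

definition tp :: "('u, 'u) cobj \<Rightarrow> ('u, 'u) cobj \<Rightarrow> 'u \<Rightarrow> 'u \<Rightarrow> 'u" where
  "tp A B a b = enc (tensor_mon (mon_of A) (mon_of B)) (ten_gens A B) (tpure (mon_of A) (mon_of B) a b)"

locale universe =
  fixes U :: "'u itself"
  assumes inaccessible: "inaccessible TYPE('u)"

locale B_pair = universe U + A: B_object A + B: B_object B
  for U :: "'u itself" and A B :: "('u, 'u) cobj"
begin

sublocale comma_pair A B ..

lemma tpure_closed:
  "a \<in> carr A \<Longrightarrow> b \<in> carr B \<Longrightarrow> tpure (mon_of A) (mon_of B) a b \<in> carrier (tensor_mon (mon_of A) (mon_of B))"
  by (rule biadditiveD(1)[OF biadditive_tpure])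

sublocale T: small_generators "tensor_mon (mon_of A) (mon_of B)" "ten_gens A B" U
proof (intro small_generators.intro small_generators_axioms.intro comm_monoid_tensor_mon inaccessible)
  show "ten_gens A B \<subseteq> carrier (tensor_mon (mon_of A) (mon_of B))"
    by (auto simp: ten_gens_def A.gens_closed B.gens_closed tpure_closed)
  have "tpure (mon_of A) (mon_of B) \<one>\<^bsub>mon_of A\<^esub> \<one>\<^bsub>mon_of B\<^esub> = \<one>\<^bsub>tensor_mon (mon_of A) (mon_of B)\<^esub>"
    by (simp add: biadditiveD[OF biadditive_tpure])
  then show "\<one>\<^bsub>tensor_mon (mon_of A) (mon_of B)\<^esub> \<in> ten_gens A B"
    unfolding ten_gens_def using A.one_in_gens B.one_in_gens by force
  show "small TYPE('u) (ten_gens A B)"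
    unfolding ten_gens_def
    by (intro small_image small_Sigma inaccessible A.small_gens B.small_gens)
qed

text \<open>Hence the encoding covers the whole tensor product, as the bijectivity of q in
  \<open>product_map\<close> requires.\<close>

lemma generated_ten_gens:
  "generated (tensor_mon (mon_of A) (mon_of B)) (ten_gens A B) = carrier (tensor_mon (mon_of A) (mon_of B))"
  unfolding ten_gens_def
  by (rule generated_tpure[OF A.generated_gens B.generated_gens A.gens_subset B.gens_subset])

lemma ten_ob: "ten A B \<in> Ob cat_B"
  unfolding ten_def by (rule T.obj_of_in_Ob)

sublocale ten: B_object "ten A B"
  using ten_ob by (rule B_objectI)

lemma biadditive_tp: "biadditive (mon_of A) (mon_of B) (mon_of (ten A B)) (tp A B)"
  by (rule biadditiveI)
    (simp_all add: tp_def ten_def T.enc_closed generated_ten_gens tpure_closed T.enc_mult T.one_obj_of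
      biadditiveD[OF biadditive_tpure])

lemma gens_ten: "gens (ten A B) = case_prod (tp A B) ` (gens A \<times> gens B)"
  unfolding ten_def T.gens_obj_of by (simp add: ten_gens_def tp_def image_image case_prod_unfold)

lemma tp_gens: "x \<in> gens A \<Longrightarrow> y \<in> gens B \<Longrightarrow> tp A B x y \<in> gens (ten A B)"
  by (auto simp: gens_ten)

lemma tp_closed: "a \<in> carr A \<Longrightarrow> b \<in> carr B \<Longrightarrow> tp A B a b \<in> carr (ten A B)"
  by (rule biadditiveD(1)[OF biadditive_tp])

lemma mon_lift:
  assumes "comm_monoid P" and b: "biadditive (mon_of A) (mon_of B) P \<beta>"
  obtains h where "h \<in> mon_hom (mon_of (ten A B)) P"
    "\<And>a b. a \<in> carr A \<Longrightarrow> b \<in> carr B \<Longrightarrow> h (tp A B a b) = \<beta> a b"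
proof -
  obtain h where h: "h \<in> mon_hom (tensor_mon (mon_of A) (mon_of B)) P"
    "\<And>a b. a \<in> carr A \<Longrightarrow> b \<in> carr B \<Longrightarrow> h (tpure (mon_of A) (mon_of B) a b) = \<beta> a b"
    using tensor_mon_lift[OF assms] by blast
  let ?k = "\<lambda>t \<in> carr (ten A B). h (T.d t)"
  have "?k \<in> mon_hom (mon_of (ten A B)) P"
    using mon_homD[OF h(1)] T.dec_closed ten.m_closed ten.one_closed
    by (intro mon_homI) (simp_all add: ten_def T.dec_mult T.dec_one generated_ten_gens)
  moreover have "?k (tp A B a b) = \<beta> a b" if "a \<in> carr A" "b \<in> carr B" for a b
    using that by (simp add: tp_closed h(2)) (simp add: tp_def T.dec_enc generated_ten_gens tpure_closed h(2))
  ultimately show ?thesis by (rule that)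
qed

lemma ten_arrow_eqI:
  assumes "h \<in> Hom cat_B (ten A B) X" "k \<in> Hom cat_B (ten A B) X"
    "\<And>x y. x \<in> gens A \<Longrightarrow> y \<in> gens B \<Longrightarrow> mmap h (tp A B x y) = mmap k (tp A B x y)"
  shows "h = k"
  using assms by (intro arrow_eqI[of h "ten A B" X k]) (auto simp: gens_ten)

text \<open>Needed for the associator, whose auxiliary maps are known only on pure tensors of A and
  B.\<close>

lemma ten_induct [consumes 1, case_names one mult]:
  assumes "t \<in> carr (ten A B)" "P \<one>\<^bsub>mon_of (ten A B)\<^esub>"
    "\<And>a b t. a \<in> carr A \<Longrightarrow> b \<in> carr B \<Longrightarrow> t \<in> carr (ten A B) \<Longrightarrow> P t \<Longrightarrow> P (tp A B a b \<otimes>\<^bsub>mon_of (ten A B)\<^esub> t)"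
  shows "P t"
proof -
  have "t \<in> generated (mon_of (ten A B)) (gens (ten A B))"
    using assms(1) by (simp add: ten.generated_gens)
  then show ?thesis
  proof induction
    case (mult s t)
    then show ?case using assms(3) ten.generated_gens A.gens_closed B.gens_closed
      by (auto simp: gens_ten)
  qed (rule assms)
qed

lemma pts_ten: "pts (pset_of (ten A B)) = gens (ten A B)"
  unfolding ten_def T.gens_obj_of by (simp add: T.pset_obj_of)

lemma point_map_ten: "x \<in> gens (ten A B) \<Longrightarrow> point_map (ten A B) x = x"
  using T.point_map_obj_of[of x] pts_ten by (simp add: ten_def)

text \<open>The map q is the encoding and hence bijective. The map p forgets which pair of points
  gave a pure tensor, so only surjectivity can be claimed.\<close>

lemma product_map_ten:
  "product_map A B (ten A B)
     (\<lambda>z \<in> pts (smash (pset_of A) (pset_of B)). tp A B (point_map A (fst z)) (point_map B (snd z)))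
     (\<lambda>c \<in> carrier (tensor_mon (mon_of A) (mon_of B)). T.e c)"
  (is "product_map _ _ _ ?p ?q")
proof -
  let ?X = "pset_of A" and ?Y = "pset_of B" and ?W = "comma_tensor A B"
  have ps: "pset_of ?W = smash ?X ?Y" and mon: "mon_of ?W = tensor_mon (mon_of A) (mon_of B)"
    by (simp_all add: comma_tensor_def)

  \<comment> \<open>Every point of the smash product, the base point included, is the
    \<open>smash_pair\<close> of its own coordinates.\<close>
  have sp: "\<exists>x \<in> pts ?X. \<exists>y \<in> pts ?Y. z = smash_pair ?X ?Y x y \<and> fst z = x \<and> snd z = y"
    if "z \<in> pts (smash ?X ?Y)" for z
    using that A.pointed B.pointed by (auto simp: smash_def smash_pair_def pointed_set_def)
  have pg: "?p z \<in> gens (ten A B)" if "z \<in> pts (smash ?X ?Y)" for z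
    using sp[OF that] that by (auto simp: gens_def intro!: tp_gens[unfolded gens_def])
  have b: "bpt (smash ?X ?Y) \<in> pts (smash ?X ?Y)" by (simp add: smash_def)
  have "?p (bpt (smash ?X ?Y)) = bpt (pset_of (ten A B))"
    using b A.point_map_bpt B.point_map_bpt
    by (simp add: smash_def biadditiveD[OF biadditive_tp])
      (simp add: ten_def T.pset_obj_of T.one_obj_of)
  then have p: "?p \<in> pset_hom (smash ?X ?Y) (pset_of (ten A B))"
    using pg by (auto simp: pset_hom_def pts_ten)
  have q: "?q \<in> mon_hom (tensor_mon (mon_of A) (mon_of B)) (mon_of (ten A B))"
    by (intro mon_homI)
      (simp_all add: ten_def T.enc_closed generated_ten_gens T.enc_mult T.one_obj_of)
  have "?q (point_map ?W z) = point_map (ten A B) (?p z)" if z: "z \<in> pts (smash ?X ?Y)" for z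
  proof -
    obtain x y where xy: "x \<in> pts ?X" "y \<in> pts ?Y" "z = smash_pair ?X ?Y x y" "fst z = x" "snd z = y"
      using sp[OF z] by blast
    have "point_map ?W z = tpure (mon_of A) (mon_of B) (point_map A x) (point_map B y)"
      using point_map_comma_tensor[OF xy(1,2)] xy(3) by simp
    then show ?thesis
      using pg[OF z] z xy by (simp add: point_map_ten tpure_closed A.point_map_closed B.point_map_closed) (simp add: tp_def)
  qed
  then have "(?p, ?q) \<in> comma_hom ?W (ten A B)"
    unfolding comma_hom_iff[OF comma_obj_comma_tensor ten.comma_obj] using p q
    by (simp only: ps mon) blast
  moreover have "?p ` pts (smash ?X ?Y) = gens (ten A B)"
  proof (intro equalityI subsetI)
    fix t assume "t \<in> gens (ten A B)"
    then have "t \<in> case_prod (tp A B) ` (gens A \<times> gens B)" by (simp only: gens_ten)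
    then obtain x y where xy: "x \<in> pts ?X" "y \<in> pts ?Y" "t = tp A B (point_map A x) (point_map B y)"
      by (auto simp: gens_def)
    have "t = ?p (smash_pair ?X ?Y x y)"
      using xy A.point_map_closed B.point_map_closed
      by (auto simp: smash_pair_def smash_def A.point_map_bpt B.point_map_bpt biadditiveD[OF biadditive_tp])
    moreover have "smash_pair ?X ?Y x y \<in> pts (smash ?X ?Y)"
      using xy by (auto simp: smash_pair_def smash_def)
    ultimately show "t \<in> ?p ` pts (smash ?X ?Y)" by blast
  qed (use pg in auto)
  moreover have "bij_betw ?q (carrier (tensor_mon (mon_of A) (mon_of B))) (carr (ten A B))"
    using T.inj_enc by (auto simp: bij_betw_def ten_def T.carr_obj_of generated_ten_gens inj_on_def)
  ultimately show ?thesis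
    unfolding product_map_def ps mon pts_ten by blast
qed

end

section \<open>The symmetric monoidal structure\<close>

text \<open>The universal property as a function of \<beta>, so that the structure maps can be
  defined outside of proofs. The chosen homomorphism exists when \<beta> is biadditive, and it is
  unique because pure tensors generate.\<close>

definition tlift :: "('u, 'u) cobj \<Rightarrow> ('u, 'u) cobj \<Rightarrow> ('u, 'u) cobj \<Rightarrow> ('u \<Rightarrow> 'u \<Rightarrow> 'u) \<Rightarrow> ('u, 'u) carrow" where
  "tlift A B X \<beta> = arrow (ten A B) X (SOME g. g \<in> mon_hom (mon_of (ten A B)) (mon_of X) \<and>
     (\<forall>a \<in> carr A. \<forall>b \<in> carr B. g (tp A B a b) = \<beta> a b))"

definition tenA :: "('u, 'u) carrow \<Rightarrow> ('u, 'u) carrow \<Rightarrow> ('u, 'u) carrow" where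
  "tenA f g = tlift (src f) (src g) (ten (tgt f) (tgt g))
     (\<lambda>a b. tp (tgt f) (tgt g) (mmap f a) (mmap g b))"

definition braid :: "('u, 'u) cobj \<Rightarrow> ('u, 'u) cobj \<Rightarrow> ('u, 'u) carrow" where
  "braid A B = tlift A B (ten B A) (\<lambda>a b. tp B A b a)"

text \<open>\<open>tlift\<close> would require a formula for arbitrary elements of
  \<open>ten A B\<close> in the first argument, while the map is prescribed on pure tensors only;
  hence a choice of its own.\<close>

definition assoc :: "('u, 'u) cobj \<Rightarrow> ('u, 'u) cobj \<Rightarrow> ('u, 'u) cobj \<Rightarrow> ('u, 'u) carrow" where
  "assoc A B D = arrow (ten (ten A B) D) (ten A (ten B D))
     (SOME g. g \<in> mon_hom (mon_of (ten (ten A B) D)) (mon_of (ten A (ten B D))) \<and>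
       (\<forall>a \<in> carr A. \<forall>b \<in> carr B. \<forall>d \<in> carr D.
          g (tp (ten A B) D (tp A B a b) d) = tp A (ten B D) a (tp B D b d)))"

definition unit_gens :: "bool multiset set" where
  "unit_gens = {{#}, {#True#}}"

definition unit_obj :: "('u, 'u) cobj" where
  "unit_obj = obj_of (free_mon sphere0) unit_gens"

definition unit_pt :: 'u where
  "unit_pt = enc (free_mon sphere0) unit_gens {#True#}"

text \<open>\<open>free_mon sphere0\<close> is the monoid of natural numbers, with
  \<open>size\<close> as the isomorphism. In additive notation this is the multiple n a, that is,
  the action of natural numbers on A that induces the unitors.\<close>

definition unit_pow :: "('u, 'u) cobj \<Rightarrow> 'u \<Rightarrow> 'u \<Rightarrow> 'u" where
  "unit_pow A n a = a [^]\<^bsub>mon_of A\<^esub> size (dec (free_mon sphere0) unit_gens n)"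

definition lunit :: "('u, 'u) cobj \<Rightarrow> ('u, 'u) carrow" where
  "lunit A = tlift unit_obj A A (unit_pow A)"

definition runit :: "('u, 'u) cobj \<Rightarrow> ('u, 'u) carrow" where
  "runit A = tlift A unit_obj A (\<lambda>a n. unit_pow A n a)"

lemma src_tgt [simp]:
  "src (arrow A B \<phi>) = A" "tgt (arrow A B \<phi>) = B"
  "src (tlift A B X \<beta>) = ten A B" "tgt (tlift A B X \<beta>) = X"
  "src (tenA f g) = ten (src f) (src g)" "tgt (tenA f g) = ten (tgt f) (tgt g)"
  "src (braid A B) = ten A B" "tgt (braid A B) = ten B A"
  "src (assoc A B D) = ten (ten A B) D" "tgt (assoc A B D) = ten A (ten B D)"
  "src (lunit A) = ten unit_obj A" "tgt (lunit A) = A"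
  "src (runit A) = ten A unit_obj" "tgt (runit A) = A"
  "src (k \<cdot>\<^bsub>cat_B\<^esub> h) = src h" "tgt (k \<cdot>\<^bsub>cat_B\<^esub> h) = tgt k"
  "src (Ident cat_B A) = A" "tgt (Ident cat_B A) = A"
  by (simp_all add: arrow_def tlift_def tenA_def braid_def assoc_def lunit_def runit_def
      cat_B_def full_subcategory_def comma_category_def)

context universe
begin

abbreviation obs :: "('u, 'u) cobj set" where "obs \<equiv> Ob cat_B"
abbreviation arrs :: "('u, 'u) carrow set" where "arrs \<equiv> Arr cat_B"

text \<open>With \<open>arrs\<close>, \<open>src\<close> and \<open>tgt\<close> in place of
  \<open>Hom\<close>, the simplifier can discharge the typing conditions of composites; the simp
  rules that follow are stated in this form.\<close>

lemma Hom_iff: "h \<in> Hom cat_B A B \<longleftrightarrow> h \<in> arrs \<and> src h = A \<and> tgt h = B"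
  by (auto simp: Hom_def cat_B_def full_subcategory_def comma_category_def)

lemma arrs_ob [simp]: "h \<in> arrs \<Longrightarrow> src h \<in> obs" "h \<in> arrs \<Longrightarrow> tgt h \<in> obs"
  using Hom_iff[of h "src h" "tgt h"] Hom_cat_B_ob by blast+

lemma Comp_arrs [simp]: "h \<in> arrs \<Longrightarrow> k \<in> arrs \<Longrightarrow> src k = tgt h \<Longrightarrow> k \<cdot>\<^bsub>cat_B\<^esub> h \<in> arrs"
  using Comp_in_Hom[of h "src h" "tgt h" k "tgt k"] by (simp add: Hom_iff)

lemma Ident_arrs [simp]: "A \<in> obs \<Longrightarrow> Ident cat_B A \<in> arrs"
  using Ident_in_Hom[of A] by (simp add: Hom_iff)

lemma mmap_Ident_eq [simp]: "A \<in> obs \<Longrightarrow> a \<in> carr A \<Longrightarrow> mmap (Ident cat_B A) a = a"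
  by (simp add: mmap_Ident)

lemma mmap_Comp_eq [simp]:
  "h \<in> arrs \<Longrightarrow> a \<in> carr (src h) \<Longrightarrow> mmap (k \<cdot>\<^bsub>cat_B\<^esub> h) a = mmap k (mmap h a)"
  by (rule mmap_Comp[of h "src h" "tgt h"]) (simp_all add: Hom_iff)

lemma mmap_mon_hom: "h \<in> arrs \<Longrightarrow> mmap h \<in> mon_hom (mon_of (src h)) (mon_of (tgt h))"
  using mmap_hom[of h] by (simp add: Hom_iff)

lemma mmap_carr [simp]: "h \<in> arrs \<Longrightarrow> a \<in> carr (src h) \<Longrightarrow> tgt h = X \<Longrightarrow> mmap h a \<in> carr X"
  using mon_homD(2)[OF mmap_mon_hom] by blast

lemma mmap_mult:
  "h \<in> arrs \<Longrightarrow> src h = X \<Longrightarrow> a \<in> carr X \<Longrightarrow> b \<in> carr X \<Longrightarrow>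
    mmap h (a \<otimes>\<^bsub>mon_of X\<^esub> b) = mmap h a \<otimes>\<^bsub>mon_of (tgt h)\<^esub> mmap h b"
  using mon_homD(3)[OF mmap_mon_hom] by blast

lemma mmap_one [simp]: "h \<in> arrs \<Longrightarrow> src h = X \<Longrightarrow> mmap h \<one>\<^bsub>mon_of X\<^esub> = \<one>\<^bsub>mon_of (tgt h)\<^esub>"
  using mon_homD(4)[OF mmap_mon_hom] by blast

lemma mmap_gens_eq [simp]: "h \<in> arrs \<Longrightarrow> x \<in> gens (src h) \<Longrightarrow> tgt h = X \<Longrightarrow> mmap h x \<in> gens X"
  using mmap_gens[of h] by (simp add: Hom_iff)

lemma gens_carr [simp]: "A \<in> obs \<Longrightarrow> x \<in> gens A \<Longrightarrow> x \<in> carr A"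
  using comma_object.gens_closed[of A x] by (simp add: Ob_cat_B comma_object_def)

lemma one_carr [simp]: "A \<in> obs \<Longrightarrow> \<one>\<^bsub>mon_of A\<^esub> \<in> carr A"
  and one_gens [simp]: "A \<in> obs \<Longrightarrow> \<one>\<^bsub>mon_of A\<^esub> \<in> gens A"
  and mult_carr [simp]: "A \<in> obs \<Longrightarrow> a \<in> carr A \<Longrightarrow> b \<in> carr A \<Longrightarrow> a \<otimes>\<^bsub>mon_of A\<^esub> b \<in> carr A"
  and comm_monoid_ob: "A \<in> obs \<Longrightarrow> comm_monoid (mon_of A)"
proof -
  assume "A \<in> obs"
  then interpret A: B_object A by (rule B_objectI)
  show "\<one>\<^bsub>mon_of A\<^esub> \<in> carr A" "\<one>\<^bsub>mon_of A\<^esub> \<in> gens A" "comm_monoid (mon_of A)"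
    "a \<in> carr A \<Longrightarrow> b \<in> carr A \<Longrightarrow> a \<otimes>\<^bsub>mon_of A\<^esub> b \<in> carr A"
    using A.one_in_gens A.comm_monoid_axioms by auto
qed

lemma arrs_eqI:
  assumes "h \<in> arrs" "k \<in> arrs" "src h = src k" "tgt h = tgt k"
    "\<And>x. x \<in> gens (src h) \<Longrightarrow> mmap h x = mmap k x"
  shows "h = k"
  using assms by (intro arrow_eqI[of h "src h" "tgt h" k]) (simp_all add: Hom_iff)

lemma is_isoI:
  assumes "h \<in> arrs" "k \<in> arrs" "src k = tgt h" "tgt k = src h"
    "\<And>x. x \<in> gens (src h) \<Longrightarrow> mmap k (mmap h x) = x"
    "\<And>y. y \<in> gens (tgt h) \<Longrightarrow> mmap h (mmap k y) = y"
  shows "is_iso cat_B h"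
proof -
  have d: "Dom cat_B h = src h" "Cod cat_B h = tgt h"
    by (simp_all add: cat_B_def full_subcategory_def comma_category_def)
  have "k \<cdot>\<^bsub>cat_B\<^esub> h = Ident cat_B (src h)" "h \<cdot>\<^bsub>cat_B\<^esub> k = Ident cat_B (tgt h)"
    using assms by (intro arrs_eqI; simp)+
  then show ?thesis unfolding is_iso_def d using assms by (auto simp: Hom_iff)
qed

lemma B_pairI: "A \<in> obs \<Longrightarrow> B \<in> obs \<Longrightarrow> B_pair A B"
  by (intro B_pair.intro B_objectI universe_axioms)

lemma ten_obs [simp]: "A \<in> obs \<Longrightarrow> B \<in> obs \<Longrightarrow> ten A B \<in> obs"
  using B_pair.ten_ob[OF B_pairI] .

lemma tp_biadditive: "A \<in> obs \<Longrightarrow> B \<in> obs \<Longrightarrow> biadditive (mon_of A) (mon_of B) (mon_of (ten A B)) (tp A B)"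
  using B_pair.biadditive_tp[OF B_pairI] .

lemma tp_simps [simp]:
  assumes "A \<in> obs" "B \<in> obs"
  shows "a \<in> carr A \<Longrightarrow> b \<in> carr B \<Longrightarrow> tp A B a b \<in> carr (ten A B)"
    "b \<in> carr B \<Longrightarrow> tp A B \<one>\<^bsub>mon_of A\<^esub> b = \<one>\<^bsub>mon_of (ten A B)\<^esub>"
    "a \<in> carr A \<Longrightarrow> tp A B a \<one>\<^bsub>mon_of B\<^esub> = \<one>\<^bsub>mon_of (ten A B)\<^esub>"
    "x \<in> gens A \<Longrightarrow> y \<in> gens B \<Longrightarrow> tp A B x y \<in> gens (ten A B)"
  using biadditiveD[OF tp_biadditive[OF assms]] B_pair.tp_gens[OF B_pairI[OF assms]] by auto

lemma tp_mult:
  assumes "A \<in> obs" "B \<in> obs"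
  shows "a \<in> carr A \<Longrightarrow> a' \<in> carr A \<Longrightarrow> b \<in> carr B \<Longrightarrow>
      tp A B (a \<otimes>\<^bsub>mon_of A\<^esub> a') b = tp A B a b \<otimes>\<^bsub>mon_of (ten A B)\<^esub> tp A B a' b"
    "a \<in> carr A \<Longrightarrow> b \<in> carr B \<Longrightarrow> b' \<in> carr B \<Longrightarrow>
      tp A B a (b \<otimes>\<^bsub>mon_of B\<^esub> b') = tp A B a b \<otimes>\<^bsub>mon_of (ten A B)\<^esub> tp A B a b'"
  using biadditiveD[OF tp_biadditive[OF assms]] by auto

lemma gens_ten_eq: "A \<in> obs \<Longrightarrow> B \<in> obs \<Longrightarrow> gens (ten A B) = case_prod (tp A B) ` (gens A \<times> gens B)"
  using B_pair.gens_ten[OF B_pairI] .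

text \<open>The induced homomorphism is an arrow when \<beta> preserves generators, because the
  generators of \<open>ten A B\<close> are the pure tensors of generators.\<close>

lemma tlift:
  assumes "A \<in> obs" "B \<in> obs" "X \<in> obs" and b: "biadditive (mon_of A) (mon_of B) (mon_of X) \<beta>"
    and g: "\<And>x y. x \<in> gens A \<Longrightarrow> y \<in> gens B \<Longrightarrow> \<beta> x y \<in> gens X"
  shows "tlift A B X \<beta> \<in> arrs"
    "\<And>a b. a \<in> carr A \<Longrightarrow> b \<in> carr B \<Longrightarrow> mmap (tlift A B X \<beta>) (tp A B a b) = \<beta> a b"
proof -
  interpret B_pair U A B using assms by (intro B_pairI)
  let ?g = "mmap (tlift A B X \<beta>)"
  have "\<exists>g. g \<in> mon_hom (mon_of (ten A B)) (mon_of X) \<and>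
     (\<forall>a \<in> carr A. \<forall>b \<in> carr B. g (tp A B a b) = \<beta> a b)"
    by (rule mon_lift[OF comm_monoid_ob[OF assms(3)] b]) blast
  then have "?g \<in> mon_hom (mon_of (ten A B)) (mon_of X) \<and>
     (\<forall>a \<in> carr A. \<forall>b \<in> carr B. ?g (tp A B a b) = \<beta> a b)"
    unfolding tlift_def mmap_arrow by (rule someI_ex)
  then have h: "?g \<in> mon_hom (mon_of (ten A B)) (mon_of X)"
    "\<And>a b. a \<in> carr A \<Longrightarrow> b \<in> carr B \<Longrightarrow> ?g (tp A B a b) = \<beta> a b"
    by auto
  have "arrow (ten A B) X ?g \<in> Hom cat_B (ten A B) X"
    using assms by (intro arrow_in_Hom h) (auto simp: gens_ten h)
  moreover have "tlift A B X \<beta> = arrow (ten A B) X ?g" by (simp add: tlift_def)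
  ultimately show "tlift A B X \<beta> \<in> arrs" by (simp add: Hom_iff)
  show "\<And>a b. a \<in> carr A \<Longrightarrow> b \<in> carr B \<Longrightarrow> ?g (tp A B a b) = \<beta> a b" by (rule h)
qed

lemma tenA:
  assumes "f \<in> arrs" "g \<in> arrs"
  shows "tenA f g \<in> arrs"
    "\<And>a b. a \<in> carr (src f) \<Longrightarrow> b \<in> carr (src g) \<Longrightarrow>
      mmap (tenA f g) (tp (src f) (src g) a b) = tp (tgt f) (tgt g) (mmap f a) (mmap g b)"
proof -
  have "biadditive (mon_of (src f)) (mon_of (src g)) (mon_of (ten (tgt f) (tgt g)))
      (\<lambda>a b. tp (tgt f) (tgt g) (mmap f a) (mmap g b))"
    using assms by (intro biadditiveI) (simp_all add: mmap_mult tp_mult)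
  then show "tenA f g \<in> arrs" "\<And>a b. a \<in> carr (src f) \<Longrightarrow> b \<in> carr (src g) \<Longrightarrow>
      mmap (tenA f g) (tp (src f) (src g) a b) = tp (tgt f) (tgt g) (mmap f a) (mmap g b)"
    unfolding tenA_def using assms by (auto intro!: tlift)
qed

lemma tenA_arrs [simp]: "f \<in> arrs \<Longrightarrow> g \<in> arrs \<Longrightarrow> tenA f g \<in> arrs"
  by (rule tenA)

lemma mmap_tenA [simp]:
  "f \<in> arrs \<Longrightarrow> g \<in> arrs \<Longrightarrow> src f = A \<Longrightarrow> src g = B \<Longrightarrow> a \<in> carr A \<Longrightarrow> b \<in> carr B \<Longrightarrow>
    mmap (tenA f g) (tp A B a b) = tp (tgt f) (tgt g) (mmap f a) (mmap g b)"
  using tenA(2) by blast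

lemma braid [simp]:
  assumes "A \<in> obs" "B \<in> obs"
  shows "braid A B \<in> arrs"
    "a \<in> carr A \<Longrightarrow> b \<in> carr B \<Longrightarrow> mmap (braid A B) (tp A B a b) = tp B A b a"
proof -
  have "biadditive (mon_of A) (mon_of B) (mon_of (ten B A)) (\<lambda>a b. tp B A b a)"
    using assms by (intro biadditiveI) (simp_all add: tp_mult)
  then show "braid A B \<in> arrs"
    "a \<in> carr A \<Longrightarrow> b \<in> carr B \<Longrightarrow> mmap (braid A B) (tp A B a b) = tp B A b a"
    unfolding braid_def using assms tlift[of A B "ten B A" "\<lambda>a b. tp B A b a"] by auto
qed

text \<open>The universal property is used twice. For fixed d, the map of a and b to the triple
  tensor extends to a homomorphism \<open>k d\<close> on \<open>ten A B\<close>; then the map of t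
  and d to \<open>k d t\<close> is biadditive and extends to the tensor product with D.\<close>

lemma assoc [simp]:
  assumes "A \<in> obs" "B \<in> obs" "D \<in> obs"
  shows "assoc A B D \<in> arrs"
    "a \<in> carr A \<Longrightarrow> b \<in> carr B \<Longrightarrow> d \<in> carr D \<Longrightarrow>
      mmap (assoc A B D) (tp (ten A B) D (tp A B a b) d) = tp A (ten B D) a (tp B D b d)"
proof -
  interpret AB: B_pair U A B using assms by (intro B_pairI)
  interpret T: B_pair U "ten A B" D using assms by (intro B_pairI) simp_all
  let ?X = "ten A (ten B D)"
  interpret X: B_object ?X using assms by (intro B_objectI) simp
  have "\<exists>k. k \<in> mon_hom (mon_of (ten A B)) (mon_of ?X) \<and>
      (\<forall>a \<in> carr A. \<forall>b \<in> carr B. k (tp A B a b) = tp A (ten B D) a (tp B D b d))"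
    if d: "d \<in> carr D" for d
  proof -
    have "biadditive (mon_of A) (mon_of B) (mon_of ?X) (\<lambda>a b. tp A (ten B D) a (tp B D b d))"
      using assms d by (intro biadditiveI) (simp_all add: tp_mult)
    then show ?thesis by (rule AB.mon_lift[OF X.comm_monoid_axioms]) blast
  qed
  then obtain k where k: "\<And>d. d \<in> carr D \<Longrightarrow> k d \<in> mon_hom (mon_of (ten A B)) (mon_of ?X)"
    "\<And>a b d. a \<in> carr A \<Longrightarrow> b \<in> carr B \<Longrightarrow> d \<in> carr D \<Longrightarrow>
      k d (tp A B a b) = tp A (ten B D) a (tp B D b d)"
    by metis
  note kD = mon_homD(2-4)[OF k(1)]
  have bi: "biadditive (mon_of (ten A B)) (mon_of D) (mon_of ?X) (\<lambda>t d. k d t)"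
  proof (rule biadditiveI)
    fix t d d' assume t: "t \<in> carr (ten A B)" and d: "d \<in> carr D" "d' \<in> carr D"
    \<comment> \<open>As t need not be pure, additivity in d is proved by induction on t;
      commutativity of the target rearranges the four terms of the inductive step.\<close>
    show "k (d \<otimes>\<^bsub>mon_of D\<^esub> d') t = k d t \<otimes>\<^bsub>mon_of ?X\<^esub> k d' t"
      using t
    proof (induction rule: AB.ten_induct)
      case one
      then show ?case using d assms by (simp add: kD)
    next
      case (mult a b t)
      have "tp A (ten B D) a (tp B D b (d \<otimes>\<^bsub>mon_of D\<^esub> d')) =
          tp A (ten B D) a (tp B D b d) \<otimes>\<^bsub>mon_of ?X\<^esub> tp A (ten B D) a (tp B D b d')"
        using mult d assms by (simp add: tp_mult)
      then show ?case using mult d assms by (simp add: kD k(2) X.m_ac)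
    qed
  next
    fix t assume "t \<in> carr (ten A B)"
    then show "k \<one>\<^bsub>mon_of D\<^esub> t = \<one>\<^bsub>mon_of ?X\<^esub>"
      by (induction rule: AB.ten_induct) (use assms in \<open>simp_all add: kD k(2)\<close>)
  qed (use assms in \<open>simp_all add: kD\<close>)
  let ?g = "mmap (assoc A B D)"
  have "\<exists>g. g \<in> mon_hom (mon_of (ten (ten A B) D)) (mon_of ?X) \<and>
       (\<forall>a \<in> carr A. \<forall>b \<in> carr B. \<forall>d \<in> carr D.
          g (tp (ten A B) D (tp A B a b) d) = tp A (ten B D) a (tp B D b d))"
    by (rule T.mon_lift[OF X.comm_monoid_axioms bi]) (use AB.tp_closed k(2) in force)
  then have "?g \<in> mon_hom (mon_of (ten (ten A B) D)) (mon_of ?X) \<and>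
       (\<forall>a \<in> carr A. \<forall>b \<in> carr B. \<forall>d \<in> carr D.
          ?g (tp (ten A B) D (tp A B a b) d) = tp A (ten B D) a (tp B D b d))"
    unfolding assoc_def mmap_arrow by (rule someI_ex)
  then have g: "?g \<in> mon_hom (mon_of (ten (ten A B) D)) (mon_of ?X)"
    "\<And>a b d. a \<in> carr A \<Longrightarrow> b \<in> carr B \<Longrightarrow> d \<in> carr D \<Longrightarrow>
      ?g (tp (ten A B) D (tp A B a b) d) = tp A (ten B D) a (tp B D b d)"
    by auto
  have "arrow (ten (ten A B) D) ?X ?g \<in> Hom cat_B (ten (ten A B) D) ?X"
    using assms by (intro arrow_in_Hom g) (auto simp: T.gens_ten AB.gens_ten g)
  moreover have "assoc A B D = arrow (ten (ten A B) D) ?X ?g" by (simp add: assoc_def)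
  ultimately show "assoc A B D \<in> arrs" by (simp add: Hom_iff)
  show "a \<in> carr A \<Longrightarrow> b \<in> carr B \<Longrightarrow> d \<in> carr D \<Longrightarrow>
      ?g (tp (ten A B) D (tp A B a b) d) = tp A (ten B D) a (tp B D b d)" by (rule g)
qed

lemma is_iso_braid: "A \<in> obs \<Longrightarrow> B \<in> obs \<Longrightarrow> is_iso cat_B (braid A B)"
  by (rule is_isoI[of _ "braid B A"]) (auto simp: gens_ten_eq)

lemma is_iso_assoc:
  assumes "A \<in> obs" "B \<in> obs" "D \<in> obs"
  shows "is_iso cat_B (assoc A B D)"
proof -
  \<comment> \<open>The inverse comes from the symmetry and the associator of D, B, A. Writing
    juxtaposition for the tensor, it passes from a(bd) to (bd)a, (db)a, d(ba), d(ab) and finally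
    (ab)d.\<close>
  let ?k = "braid D (ten A B) \<cdot>\<^bsub>cat_B\<^esub> tenA (Ident cat_B D) (braid B A) \<cdot>\<^bsub>cat_B\<^esub> assoc D B A
    \<cdot>\<^bsub>cat_B\<^esub> tenA (braid B D) (Ident cat_B A) \<cdot>\<^bsub>cat_B\<^esub> braid A (ten B D)"
  show ?thesis
    by (rule is_isoI[of _ ?k]) (use assms in \<open>auto simp: gens_ten_eq\<close>)
qed

section \<open>The unit object and the unitors\<close>

sublocale I: small_generators "free_mon sphere0" unit_gens U
proof (intro small_generators.intro small_generators_axioms.intro comm_monoid_free_mon inaccessible)
  show "small TYPE('u) unit_gens"
    by (rule small_countable[OF inaccessible]) (simp add: unit_gens_def)
qed (auto simp: unit_gens_def free_mon_def sphere0_def)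

lemma generated_unit_gens: "generated (free_mon sphere0) unit_gens = carrier (free_mon sphere0)"
proof -
  have "m \<in> generated (free_mon sphere0) unit_gens" if "set_mset m \<subseteq> {True}" for m
    using that
  proof (induction m)
    case empty
    have "\<one>\<^bsub>free_mon sphere0\<^esub> \<in> generated (free_mon sphere0) unit_gens" by (rule generated.one)
    then show ?case by (simp add: free_mon_def)
  next
    case (add x m)
    then have "{#True#} \<otimes>\<^bsub>free_mon sphere0\<^esub> m \<in> generated (free_mon sphere0) unit_gens"
      by (intro generated.mult) (simp_all add: unit_gens_def)
    then show ?case using add by (simp add: free_mon_def)
  qed
  then show ?thesis
    using I.generated_closed[OF I.S_closed] by (auto simp: free_mon_def sphere0_def)
qed

lemma unit_obs [simp]: "(unit_obj :: ('u, 'u) cobj) \<in> obs"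
  unfolding unit_obj_def by (rule I.obj_of_in_Ob)

lemma gens_unit: "gens (unit_obj :: ('u, 'u) cobj) = {\<one>\<^bsub>mon_of (unit_obj :: ('u, 'u) cobj)\<^esub>, unit_pt}"
  unfolding unit_obj_def I.gens_obj_of I.one_obj_of unit_pt_def
  by (simp add: unit_gens_def free_mon_def)

lemma unit_pt_gens [simp]: "unit_pt \<in> gens (unit_obj :: ('u, 'u) cobj)"
  and unit_pt_carr [simp]: "unit_pt \<in> carr (unit_obj :: ('u, 'u) cobj)"
  using gens_carr[OF unit_obs, of unit_pt] by (simp_all add: gens_unit)

lemma unit_pow_pt [simp]: "A \<in> obs \<Longrightarrow> a \<in> carr A \<Longrightarrow> unit_pow A (unit_pt :: 'u) a = a"
proof -
  assume "A \<in> obs" "a \<in> carr A"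
  interpret A: comm_monoid "mon_of A" using \<open>A \<in> obs\<close> by (rule comm_monoid_ob)
  show ?thesis
    using \<open>a \<in> carr A\<close> unfolding unit_pow_def unit_pt_def
    by (subst I.dec_enc) (auto intro!: I.S_generated, simp add: unit_gens_def)
qed

lemma unit_pow_biadditive:
  assumes "A \<in> obs"
  shows "biadditive (mon_of unit_obj) (mon_of A) (mon_of A) (unit_pow A)"
proof -
  interpret A: comm_monoid "mon_of A" using assms by (rule comm_monoid_ob)
  have "size (I.d (m \<otimes>\<^bsub>mon_of unit_obj\<^esub> n)) = size (I.d m) + size (I.d n)"
    if "m \<in> carr (unit_obj :: ('u, 'u) cobj)" "n \<in> carr (unit_obj :: ('u, 'u) cobj)" for m n :: 'u
    using that by (simp add: unit_obj_def I.dec_mult) (simp add: free_mon_def)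
  moreover have "size (I.d \<one>\<^bsub>mon_of (unit_obj :: ('u, 'u) cobj)\<^esub>) = 0"
    by (simp add: unit_obj_def I.dec_one) (simp add: free_mon_def)
  ultimately show ?thesis
    by (intro biadditiveI) (simp_all add: unit_pow_def A.nat_pow_mult A.pow_mult_distrib A.m_comm)
qed

lemma lunit [simp]:
  assumes "A \<in> obs"
  shows "lunit A \<in> arrs" "a \<in> carr A \<Longrightarrow> mmap (lunit A) (tp unit_obj A unit_pt a) = a"
proof -
  have g: "unit_pow A x y \<in> gens A" if "x \<in> gens unit_obj" "y \<in> gens A" for x y
    using that assms biadditiveD(4)[OF unit_pow_biadditive[OF assms]] by (auto simp: gens_unit)
  show "lunit A \<in> arrs" "a \<in> carr A \<Longrightarrow> mmap (lunit A) (tp unit_obj A unit_pt a) = a"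
    unfolding lunit_def
    using tlift[OF unit_obs assms assms unit_pow_biadditive[OF assms] g] assms by auto
qed

lemma runit [simp]:
  assumes "A \<in> obs"
  shows "runit A \<in> arrs" "a \<in> carr A \<Longrightarrow> mmap (runit A) (tp A unit_obj a unit_pt) = a"
proof -
  have b: "biadditive (mon_of A) (mon_of unit_obj) (mon_of A) (\<lambda>a n. unit_pow A n a)"
    using unit_pow_biadditive[OF assms] by (auto simp: biadditive_def)
  have g: "unit_pow A x y \<in> gens A" if "y \<in> gens A" "x \<in> gens unit_obj" for x y
    using that assms biadditiveD(4)[OF unit_pow_biadditive[OF assms]] by (auto simp: gens_unit)
  show "runit A \<in> arrs" "a \<in> carr A \<Longrightarrow> mmap (runit A) (tp A unit_obj a unit_pt) = a"
    unfolding runit_def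
    using tlift[OF assms unit_obs assms b g] assms by auto
qed

text \<open>With \<open>unit_pt\<close> as the fixed factor these maps are the inverses of the
  unitors.\<close>

lemma mon_homI_tp:
  assumes "A \<in> obs" "B \<in> obs"
  shows "a \<in> carr A \<Longrightarrow> (\<lambda>b \<in> carr B. tp A B a b) \<in> mon_hom (mon_of B) (mon_of (ten A B))"
    "b \<in> carr B \<Longrightarrow> (\<lambda>a \<in> carr A. tp A B a b) \<in> mon_hom (mon_of A) (mon_of (ten A B))"
  using assms by (auto intro!: mon_homI simp: tp_mult)

lemma is_iso_lunit:
  assumes "A \<in> obs"
  shows "is_iso cat_B (lunit A)"
proof (rule is_isoI)
  let ?k = "arrow A (ten unit_obj A) (\<lambda>a \<in> carr A. tp unit_obj A unit_pt a)"
  have "?k \<in> Hom cat_B A (ten unit_obj A)"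
    using assms by (intro arrow_in_Hom mon_homI_tp) simp_all
  then show "?k \<in> arrs" by (simp add: Hom_iff)
qed (use assms in \<open>auto simp: gens_ten_eq gens_unit\<close>)

lemma is_iso_runit:
  assumes "A \<in> obs"
  shows "is_iso cat_B (runit A)"
proof (rule is_isoI)
  let ?k = "arrow A (ten A unit_obj) (\<lambda>a \<in> carr A. tp A unit_obj a unit_pt)"
  have "?k \<in> Hom cat_B A (ten A unit_obj)"
    using assms by (intro arrow_in_Hom mon_homI_tp) simp_all
  then show "?k \<in> arrs" by (simp add: Hom_iff)
qed (use assms in \<open>auto simp: gens_ten_eq gens_unit\<close>)

end

section \<open>Assembly of the symmetric monoidal category\<close>

text \<open>Domain and codomain are given as \<open>src\<close> and \<open>tgt\<close>, which are
  those of \<open>cat_B\<close> and the form that the simp rules expect.\<close>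

definition monoidal_B :: "(('u, 'u) cobj, ('u, 'u) carrow) monoidal_cat" where
  "monoidal_B =
     \<lparr>Ob = Ob cat_B, Arr = Arr cat_B, Dom = src, Cod = tgt, Ident = Ident cat_B, Comp = Comp cat_B,
      Tensor = ten, TensorA = tenA, Unit = unit_obj, Assoc = assoc, LUnit = lunit, RUnit = runit,
      Braid = braid\<rparr>"

lemma monoidal_B_simps [simp]:
  "Ob monoidal_B = Ob cat_B" "Arr monoidal_B = Arr cat_B" "Dom monoidal_B = src"
  "Cod monoidal_B = tgt" "Ident monoidal_B = Ident cat_B" "Comp monoidal_B = Comp cat_B"
  "Tensor monoidal_B = ten" "TensorA monoidal_B = tenA" "Unit monoidal_B = unit_obj"
  "Assoc monoidal_B = assoc" "LUnit monoidal_B = lunit" "RUnit monoidal_B = runit"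
  "Braid monoidal_B = braid"
  by (simp_all add: monoidal_B_def)

lemma cat_B_dom_cod: "Dom cat_B = src" "Cod cat_B = tgt"
  by (simp_all add: cat_B_def full_subcategory_def comma_category_def)

lemma truncate_monoidal_B: "cat.truncate monoidal_B = cat_B"
  by (simp add: cat.truncate_def cat_B_dom_cod[symmetric])

lemma Hom_monoidal_B [simp]: "Hom monoidal_B = Hom cat_B"
  by (simp add: Hom_def cat_B_dom_cod fun_eq_iff)

lemma is_iso_monoidal_B [simp]: "is_iso monoidal_B = is_iso cat_B"
  by (simp add: is_iso_def cat_B_dom_cod fun_eq_iff)

context universe
begin

lemma category_monoidal_B: "category (monoidal_B :: (('u, 'u) cobj, ('u, 'u) carrow) monoidal_cat)"
  using category_cat_B[where ?'a = 'u] unfolding category_def by (simp add: cat_B_dom_cod)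

lemma symmetric_monoidal_category_monoidal_B:
  "symmetric_monoidal_category (monoidal_B :: (('u, 'u) cobj, ('u, 'u) carrow) monoidal_cat)"
proof (intro symmetric_monoidal_category.intro symmetric_monoidal_category_axioms.intro
    category_monoidal_B, goal_cases)
  \<comment> \<open>The numbered cases are the equational axioms, in the order of the locale; the
    remaining goals concern typing and invertibility.\<close>
  case 3
  then show ?case by (simp, intro arrs_eqI) (auto simp: gens_ten_eq)
next
  case (4 f A B g D f' A' B' g' D')
  then show ?case by (simp add: Hom_iff, intro arrs_eqI) (auto simp: gens_ten_eq)
next
  case (7 f A A' g B B' h D D')
  then show ?case by (simp add: Hom_iff, intro arrs_eqI) (auto simp: gens_ten_eq)
next
  case (9 f A B)
  then show ?case by (simp add: Hom_iff, intro arrs_eqI) (auto simp: gens_ten_eq gens_unit)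
next
  case (11 f A B)
  then show ?case by (simp add: Hom_iff, intro arrs_eqI) (auto simp: gens_ten_eq gens_unit)
next
  case (13 f A A' g B B')
  then show ?case by (simp add: Hom_iff, intro arrs_eqI) (auto simp: gens_ten_eq)
next
  case (14 A B D E)
  then show ?case by (simp, intro arrs_eqI) (auto simp: gens_ten_eq)
next
  case (15 A B)
  then show ?case by (simp, intro arrs_eqI) (auto simp: gens_ten_eq gens_unit)
next
  case (16 A B D)
  then show ?case by (simp, intro arrs_eqI) (auto simp: gens_ten_eq)
next
  case (17 A B)
  then show ?case by (simp, intro arrs_eqI) (auto simp: gens_ten_eq)
qed (simp_all add: Hom_iff is_iso_braid is_iso_assoc is_iso_lunit is_iso_runit)

section \<open>Agreement with the natural product, on points\<close>

lemma pmap_pts: "h \<in> arrs \<Longrightarrow> x \<in> pts (pset_of (src h)) \<Longrightarrow> pmap h x \<in> pts (pset_of (tgt h))"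
  using pmap_hom[of h "src h" "tgt h"] by (auto simp: Hom_iff pset_hom_def)

lemma point_map_pmap:
  "h \<in> arrs \<Longrightarrow> x \<in> pts (pset_of (src h)) \<Longrightarrow> point_map (tgt h) (pmap h x) = mmap h (point_map (src h) x)"
  using mmap_point[of h "src h" "tgt h" x] by (simp add: Hom_iff)

text \<open>\<open>natural_structure\<close> is stated for points; injectivity of the point map of
  the target reduces its equations to equations for \<open>mmap\<close>.\<close>

lemma pmap_eqI:
  assumes "h \<in> arrs" "x \<in> pts (pset_of (src h))" "y \<in> pts (pset_of (tgt h))"
    "mmap h (point_map (src h) x) = point_map (tgt h) y"
  shows "pmap h x = y"
proof -
  interpret B_object "tgt h" using assms(1) by (intro B_objectI) simp
  show ?thesis
    using assms by - (rule inj_onD[OF inj_point_map], simp_all add: point_map_pmap pmap_pts)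
qed

lemma point_map_ten_eq: "A \<in> obs \<Longrightarrow> B \<in> obs \<Longrightarrow> x \<in> gens (ten A B) \<Longrightarrow> point_map (ten A B) x = x"
  and pts_ten_eq: "A \<in> obs \<Longrightarrow> B \<in> obs \<Longrightarrow> pts (pset_of (ten A B)) = gens (ten A B)"
  using B_pair.point_map_ten[OF B_pairI] B_pair.pts_ten[OF B_pairI] by auto

lemma point_map_gens: "x \<in> pts (pset_of A) \<Longrightarrow> point_map A x \<in> gens A"
  by (simp add: gens_def)

definition prod_p :: "('u, 'u) cobj \<Rightarrow> ('u, 'u) cobj \<Rightarrow> 'u \<times> 'u \<Rightarrow> 'u" where
  "prod_p A B = (\<lambda>z \<in> pts (smash (pset_of A) (pset_of B)).
     tp A B (point_map A (fst z)) (point_map B (snd z)))"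

text \<open>The pure tensors of points in \<open>natural_structure\<close> thus become values of
  \<open>tp\<close>, on which all structure maps are known.\<close>

lemma prod_p_smash_pair:
  assumes "A \<in> obs" "B \<in> obs" "x \<in> pts (pset_of A)" "y \<in> pts (pset_of B)"
  shows "prod_p A B (smash_pair (pset_of A) (pset_of B) x y) = tp A B (point_map A x) (point_map B y)"
proof -
  interpret B_pair U A B using assms(1,2) by (rule B_pairI)
  show ?thesis
    using assms
    by (auto simp: prod_p_def smash_def smash_pair_def A.point_map_bpt B.point_map_bpt
        A.point_map_closed B.point_map_closed)
qed

lemma comma_iso_unit:
  "comma_iso comma_unit (unit_obj :: ('u, 'u) cobj)
     (\<lambda>b. I.e (if b then {#True#} else {#})) (\<lambda>m \<in> carrier (free_mon sphere0). I.e m)"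
    (is "comma_iso _ ?I ?u ?v")
proof -
  have str: "restrict id (carrier (free_mon sphere0)) \<in> mon_hom (free_mon sphere0) (free_mon sphere0)"
    by (rule mon_homI) (auto simp: free_mon_def)
  have "comma_obj comma_unit"
    unfolding comma_obj_def using str comm_monoid_free_mon
    by (simp add: comma_unit_def pointed_set_def sphere0_def)
  moreover have "comma_obj ?I" using unit_obs by (simp add: Ob_cat_B)
  moreover have one: "\<one>\<^bsub>free_mon sphere0\<^esub> = {#}" by (simp add: free_mon_def)
  have "unit_gens = range (\<lambda>b. if b then {#True#} else {#})"
    by (simp add: unit_gens_def UNIV_bool insert_commute)
  then have "I.e ` unit_gens = range ?u" by (metis image_image)
  then have pts: "pts (pset_of ?I) = range ?u" "bpt (pset_of ?I) = ?u False"
    by (simp_all add: unit_obj_def I.pset_obj_of one)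
  then have "?u \<in> pset_hom sphere0 (pset_of ?I)"
    by (auto simp: pset_hom_def sphere0_def PiE_iff)
  moreover have "?v \<in> mon_hom (free_mon sphere0) (mon_of ?I)"
    by (rule mon_homI)
      (simp_all add: unit_obj_def I.enc_closed generated_unit_gens I.enc_mult I.one_obj_of)
  moreover have "?v (point_map comma_unit b) = point_map ?I (?u b)" for b
  proof -
    have "point_map comma_unit b = (if b then {#True#} else {#})"
      using free_unit_closed[of b sphere0]
      by (simp add: point_map_eq comma_unit_def sphere0_def free_unit_def)
    moreover have "point_map ?I (?u b) = ?u b"
      using pts unfolding unit_obj_def by (intro I.point_map_obj_of) auto
    ultimately show ?thesis by (simp add: free_mon_def sphere0_def)
  qed
  ultimately have "(?u, ?v) \<in> comma_hom comma_unit ?I"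
    by (subst comma_hom_iff) (auto simp: comma_unit_def)
  moreover have "inj ?u"
  proof (rule injI)
    fix b c assume "?u b = ?u c"
    then have "I.d (?u b) = I.d (?u c)" by (rule arg_cong)
    moreover have "(if a then {#True#} else {#}) \<in> generated (free_mon sphere0) unit_gens" for a
      by (rule I.S_generated) (simp add: unit_gens_def)
    ultimately have "(if b then {#True#} else {#}) = (if c then {#True#} else {#})"
      by (simp only: I.dec_enc)
    then show "b = c" by (simp split: if_splits)
  qed
  moreover have "bij_betw ?v (carrier (free_mon sphere0)) (carr ?I)"
    using I.inj_enc
    by (auto simp: bij_betw_def unit_obj_def I.carr_obj_of generated_unit_gens inj_on_def)
  ultimately show ?thesis
    unfolding comma_iso_def using pts(1)
    by (simp add: bij_betw_def comma_unit_def) (simp add: sphere0_def)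
qed

lemma natural_structure_monoidal_B:
  "natural_structure (monoidal_B :: (('u, 'u) cobj, ('u, 'u) carrow) monoidal_cat)"
proof -
  let ?q = "\<lambda>A B :: ('u, 'u) cobj. \<lambda>c \<in> carrier (tensor_mon (mon_of A) (mon_of B)).
    enc (tensor_mon (mon_of A) (mon_of B)) (ten_gens A B) c :: 'u"
  let ?u = "\<lambda>b. I.e (if b then {#True#} else {#})"
  let ?v = "\<lambda>m \<in> carrier (free_mon sphere0). I.e m"
  have ut: "?u True = unit_pt" by (simp add: unit_pt_def)
  have pu: "unit_pt \<in> pts (pset_of (unit_obj :: ('u, 'u) cobj))"
    by (simp add: unit_obj_def I.pset_obj_of unit_pt_def) (simp add: unit_gens_def)
  have pmu: "point_map (unit_obj :: ('u, 'u) cobj) unit_pt = unit_pt"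
    using pu unfolding unit_obj_def by (rule I.point_map_obj_of)
  have pm: "product_map A B (ten A B) (prod_p A B) (?q A B)" if "A \<in> obs" "B \<in> obs" for A B
    using B_pair.product_map_ten[OF B_pairI[OF that]] by (simp add: prod_p_def)
  note s = prod_p_smash_pair pmu point_map_ten_eq pts_ten_eq point_map_gens point_map_pmap pmap_pts
  show ?thesis
    unfolding natural_structure_def Let_def
  proof (intro exI[of _ prod_p] exI[of _ ?q] exI[of _ ?u] exI[of _ ?v] conjI ballI,
      unfold monoidal_B_simps ut)
    show "comma_iso comma_unit unit_obj ?u ?v" by (rule comma_iso_unit)
  qed (auto intro!: pmap_eqI simp: pm s pu)
qed

section \<open>Internal homs\<close>

text \<open>For objects of B these are exactly the monoid components of arrows from B to D, by
  \<open>arrow_in_Hom\<close> and \<open>mmap_gens\<close>.\<close>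

definition hom_gens :: "('u, 'u) cobj \<Rightarrow> ('u, 'u) cobj \<Rightarrow> ('u \<Rightarrow> 'u) set" where
  "hom_gens B D = {g \<in> mon_hom (mon_of B) (mon_of D). g ` gens B \<subseteq> gens D}"

definition fun_mon :: "('u, 'u) cobj \<Rightarrow> ('u, 'u) cobj \<Rightarrow> ('u \<Rightarrow> 'u) monoid" where
  "fun_mon B D = product_group (carr B) (\<lambda>_. mon_of D)"

definition ihom :: "('u, 'u) cobj \<Rightarrow> ('u, 'u) cobj \<Rightarrow> ('u, 'u) cobj" where
  "ihom B D = obj_of (fun_mon B D) (hom_gens B D)"

definition ev :: "('u, 'u) cobj \<Rightarrow> ('u, 'u) cobj \<Rightarrow> 'u \<Rightarrow> 'u \<Rightarrow> 'u" where
  "ev B D t b = dec (fun_mon B D) (hom_gens B D) t b"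

lemma small_generators_hom_gens:
  assumes "B \<in> obs" "D \<in> obs"
  shows "small_generators TYPE('u) (fun_mon B D) (hom_gens B D)"
proof -
  interpret B: B_object B using assms(1) by (rule B_objectI)
  interpret D: B_object D using assms(2) by (rule B_objectI)
  have c: "comm_monoid (fun_mon B D)"
    unfolding fun_mon_def by (intro comm_monoid_product_group D.comm_monoid_axioms)
  have sub: "hom_gens B D \<subseteq> (carr B \<rightarrow>\<^sub>E carr D)"
    by (auto simp: hom_gens_def PiE_def mon_homD)
  show ?thesis
  proof (intro small_generators.intro small_generators_axioms.intro c inaccessible)
    show "hom_gens B D \<subseteq> carrier (fun_mon B D)" using sub by (simp add: fun_mon_def)
    show "\<one>\<^bsub>fun_mon B D\<^esub> \<in> hom_gens B D"
      using assms by (auto simp: fun_mon_def hom_gens_def intro!: mon_homI)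
    show "small TYPE('u) (hom_gens B D)"
      using sub small_PiE[OF inaccessible B.small_carr D.small_carr] by (rule small_subset[rotated])
  qed
qed

text \<open>A pointwise sum of homomorphisms is a homomorphism because D is commutative.\<close>

lemma generated_hom_gens:
  assumes "B \<in> obs" "D \<in> obs" "g \<in> generated (fun_mon B D) (hom_gens B D)"
  shows "g \<in> mon_hom (mon_of B) (mon_of D)"
proof -
  interpret D: B_object D using assms(2) by (rule B_objectI)
  show ?thesis using assms(3)
  proof induction
    case one
    show ?case using assms by (auto simp: fun_mon_def extensional_def intro!: mon_homI)
  next
    case (mult s g)
    then have s: "s \<in> mon_hom (mon_of B) (mon_of D)" by (simp add: hom_gens_def)
    show ?case
      by (rule mon_homI)
        (use assms in \<open>auto simp: fun_mon_def extensional_def mon_homD[OF s] mon_homD[OF mult(3)] D.m_ac\<close>)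
  qed
qed

lemma ihom_obs [simp]: "B \<in> obs \<Longrightarrow> D \<in> obs \<Longrightarrow> ihom B D \<in> obs"
  unfolding ihom_def by (rule small_generators.obj_of_in_Ob[OF small_generators_hom_gens])

lemma ev_biadditive:
  assumes "B \<in> obs" "D \<in> obs"
  shows "biadditive (mon_of (ihom B D)) (mon_of B) (mon_of D) (ev B D)"
proof -
  interpret T: small_generators "fun_mon B D" "hom_gens B D" U
    using small_generators_hom_gens[OF assms] .
  have h: "T.d t \<in> mon_hom (mon_of B) (mon_of D)" if "t \<in> carr (ihom B D)" for t
    using that T.dec_closed by (intro generated_hom_gens[OF assms]) (simp add: ihom_def)
  show ?thesis
  proof (rule biadditiveI)
    show "ev B D (t \<otimes>\<^bsub>mon_of (ihom B D)\<^esub> t') b = ev B D t b \<otimes>\<^bsub>mon_of D\<^esub> ev B D t' b"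
      if "t \<in> carr (ihom B D)" "t' \<in> carr (ihom B D)" "b \<in> carr B" for t t' b
      using that T.dec_mult[of t t'] by (simp add: ev_def ihom_def) (simp add: fun_mon_def)
    show "ev B D \<one>\<^bsub>mon_of (ihom B D)\<^esub> b = \<one>\<^bsub>mon_of D\<^esub>" if "b \<in> carr B" for b
      using that T.dec_one by (simp add: ev_def ihom_def) (simp add: fun_mon_def)
  qed (use mon_homD[OF h] in \<open>auto simp: ev_def\<close>)
qed

lemma ev_simps [simp]:
  assumes "B \<in> obs" "D \<in> obs"
  shows "t \<in> carr (ihom B D) \<Longrightarrow> b \<in> carr B \<Longrightarrow> ev B D t b \<in> carr D"
    "b \<in> carr B \<Longrightarrow> ev B D \<one>\<^bsub>mon_of (ihom B D)\<^esub> b = \<one>\<^bsub>mon_of D\<^esub>"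
    "t \<in> carr (ihom B D) \<Longrightarrow> ev B D t \<one>\<^bsub>mon_of B\<^esub> = \<one>\<^bsub>mon_of D\<^esub>"
  using biadditiveD[OF ev_biadditive[OF assms]] by auto

lemma ev_mult:
  assumes "B \<in> obs" "D \<in> obs"
  shows "t \<in> carr (ihom B D) \<Longrightarrow> t' \<in> carr (ihom B D) \<Longrightarrow> b \<in> carr B \<Longrightarrow>
      ev B D (t \<otimes>\<^bsub>mon_of (ihom B D)\<^esub> t') b = ev B D t b \<otimes>\<^bsub>mon_of D\<^esub> ev B D t' b"
    "t \<in> carr (ihom B D) \<Longrightarrow> b \<in> carr B \<Longrightarrow> b' \<in> carr B \<Longrightarrow>
      ev B D t (b \<otimes>\<^bsub>mon_of B\<^esub> b') = ev B D t b \<otimes>\<^bsub>mon_of D\<^esub> ev B D t b'"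
  using biadditiveD[OF ev_biadditive[OF assms]] by auto

lemma ev_gens [simp]:
  assumes "B \<in> obs" "D \<in> obs" "t \<in> gens (ihom B D)" "y \<in> gens B"
  shows "ev B D t y \<in> gens D"
proof -
  interpret T: small_generators "fun_mon B D" "hom_gens B D" U
    using small_generators_hom_gens[OF assms(1,2)] .
  obtain g where "g \<in> hom_gens B D" "t = T.e g"
    using assms(3) by (auto simp: ihom_def T.gens_obj_of)
  then have "ev B D t y = g y" "g ` gens B \<subseteq> gens D"
    by (simp_all add: ev_def T.dec_enc T.S_generated) (simp add: hom_gens_def)
  then show ?thesis using assms(4) by auto
qed

lemma ev_eqI:
  assumes "B \<in> obs" "D \<in> obs" "t \<in> carr (ihom B D)" "t' \<in> carr (ihom B D)"
    "\<And>b. b \<in> carr B \<Longrightarrow> ev B D t b = ev B D t' b"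
  shows "t = t'"
proof -
  interpret T: small_generators "fun_mon B D" "hom_gens B D" U
    using small_generators_hom_gens[OF assms(1,2)] .
  have "T.d t \<in> mon_hom (mon_of B) (mon_of D)" "T.d t' \<in> mon_hom (mon_of B) (mon_of D)"
    using assms T.dec_closed by (auto intro!: generated_hom_gens simp: ihom_def)
  then have "T.d t = T.d t'"
    using assms(5) by (intro extensionalityI[of _ "carr B"]) (auto simp: mon_homD ev_def)
  then show ?thesis using assms(3,4) T.enc_dec unfolding ihom_def by metis
qed

section \<open>Currying and the adjunction\<close>

definition cur :: "('u, 'u) cobj \<Rightarrow> ('u, 'u) cobj \<Rightarrow> ('u, 'u) cobj \<Rightarrow> ('u \<Rightarrow> 'u \<Rightarrow> 'u) \<Rightarrow> ('u, 'u) carrow" where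
  "cur A B X \<beta> = (SOME h. h \<in> Hom cat_B A (ihom B X) \<and>
     (\<forall>a \<in> carr A. \<forall>b \<in> carr B. ev B X (mmap h a) b = \<beta> a b))"

text \<open>For a generator x, the map \<beta> x is a homomorphism that preserves generators, hence
  an element of \<open>hom_gens\<close>. For other elements of A it need only lie in the generated
  submonoid, which \<open>arrow_to_obj_of\<close> takes care of.\<close>

lemma cur:
  assumes "A \<in> obs" "B \<in> obs" "X \<in> obs" and b: "biadditive (mon_of A) (mon_of B) (mon_of X) \<beta>"
    and g: "\<And>x y. x \<in> gens A \<Longrightarrow> y \<in> gens B \<Longrightarrow> \<beta> x y \<in> gens X"
  shows "cur A B X \<beta> \<in> arrs" "src (cur A B X \<beta>) = A" "tgt (cur A B X \<beta>) = ihom B X"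
    "a \<in> carr A \<Longrightarrow> b \<in> carr B \<Longrightarrow> ev B X (mmap (cur A B X \<beta>) a) b = \<beta> a b"
proof -
  interpret T: small_generators "fun_mon B X" "hom_gens B X" U
    using small_generators_hom_gens[OF assms(2,3)] .
  note bi = biadditiveD[OF b]
  let ?g = "\<lambda>a \<in> carr A. \<lambda>b \<in> carr B. \<beta> a b"
  have "?g \<in> mon_hom (mon_of A) (fun_mon B X)"
    by (rule mon_homI) (use assms(1) in \<open>auto simp: fun_mon_def bi\<close>)
  moreover have "?g x \<in> hom_gens B X" if "x \<in> gens A" for x
    using that assms(1,2,3) g by (auto simp: hom_gens_def bi intro!: mon_homI)
  ultimately obtain h where h: "h \<in> Hom cat_B A T.T" "\<And>a. a \<in> carr A \<Longrightarrow> T.d (mmap h a) = ?g a"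
    using T.arrow_to_obj_of[OF assms(1)] by blast
  have "\<exists>h. h \<in> Hom cat_B A (ihom B X) \<and>
     (\<forall>a \<in> carr A. \<forall>b \<in> carr B. ev B X (mmap h a) b = \<beta> a b)"
    by (intro exI[of _ h]) (simp add: h ihom_def ev_def)
  then have "cur A B X \<beta> \<in> Hom cat_B A (ihom B X) \<and>
     (\<forall>a \<in> carr A. \<forall>b \<in> carr B. ev B X (mmap (cur A B X \<beta>) a) b = \<beta> a b)"
    unfolding cur_def by (rule someI_ex)
  then show "cur A B X \<beta> \<in> arrs" "src (cur A B X \<beta>) = A" "tgt (cur A B X \<beta>) = ihom B X"
    "a \<in> carr A \<Longrightarrow> b \<in> carr B \<Longrightarrow> ev B X (mmap (cur A B X \<beta>) a) b = \<beta> a b"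
    by (auto simp: Hom_iff)
qed

lemma ihom_arrs_eqI:
  assumes "B \<in> obs" "X \<in> obs" "h \<in> arrs" "k \<in> arrs" "src h = src k" "tgt h = ihom B X" "tgt k = ihom B X"
    "\<And>a b. a \<in> carr (src h) \<Longrightarrow> b \<in> carr B \<Longrightarrow> ev B X (mmap h a) b = ev B X (mmap k a) b"
  shows "h = k"
proof (rule arrs_eqI)
  fix x assume x: "x \<in> gens (src h)"
  then have c: "x \<in> carr (src h)" using assms by simp
  show "mmap h x = mmap k x"
    using assms c by - (rule ev_eqI[OF assms(1,2)], simp_all)
qed (use assms in simp_all)

definition ihomA :: "('u, 'u) cobj \<Rightarrow> ('u, 'u) carrow \<Rightarrow> ('u, 'u) carrow" where
  "ihomA B k = cur (ihom B (src k)) B (tgt k) (\<lambda>t b. mmap k (ev B (src k) t b))"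

definition curry_arr :: "('u, 'u) cobj \<Rightarrow> ('u, 'u) cobj \<Rightarrow> ('u, 'u) cobj \<Rightarrow> ('u, 'u) carrow \<Rightarrow> ('u, 'u) carrow" where
  "curry_arr B A X f = cur A B X (\<lambda>a b. mmap f (tp A B a b))"

lemma ihomA [simp]:
  assumes "B \<in> obs" "k \<in> arrs"
  shows "ihomA B k \<in> arrs" "src (ihomA B k) = ihom B (src k)" "tgt (ihomA B k) = ihom B (tgt k)"
    "src k = X \<Longrightarrow> tgt k = Y \<Longrightarrow> t \<in> carr (ihom B X) \<Longrightarrow> b \<in> carr B \<Longrightarrow>
      ev B Y (mmap (ihomA B k) t) b = mmap k (ev B X t b)"
proof -
  let ?\<beta> = "\<lambda>t b. mmap k (ev B (src k) t b)"
  have b: "biadditive (mon_of (ihom B (src k))) (mon_of B) (mon_of (tgt k)) ?\<beta>"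
    using assms by (intro biadditiveI) (simp_all add: ev_mult mmap_mult)
  have g: "?\<beta> x y \<in> gens (tgt k)" if "x \<in> gens (ihom B (src k))" "y \<in> gens B" for x y
    using that assms by simp
  note c = cur[OF ihom_obs[OF assms(1) arrs_ob(1)[OF assms(2)]] assms(1) arrs_ob(2)[OF assms(2)] b g]
  show "ihomA B k \<in> arrs" "src (ihomA B k) = ihom B (src k)" "tgt (ihomA B k) = ihom B (tgt k)"
    "src k = X \<Longrightarrow> tgt k = Y \<Longrightarrow> t \<in> carr (ihom B X) \<Longrightarrow> b \<in> carr B \<Longrightarrow>
      ev B Y (mmap (ihomA B k) t) b = mmap k (ev B X t b)"
    unfolding ihomA_def using c by auto
qed

lemma curry_arr [simp]:
  assumes "B \<in> obs" "A \<in> obs" "f \<in> arrs" "src f = ten A B" "tgt f = X"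
  shows "curry_arr B A X f \<in> arrs" "src (curry_arr B A X f) = A" "tgt (curry_arr B A X f) = ihom B X"
    "a \<in> carr A \<Longrightarrow> b \<in> carr B \<Longrightarrow> ev B X (mmap (curry_arr B A X f) a) b = mmap f (tp A B a b)"
proof -
  let ?\<beta> = "\<lambda>a b. mmap f (tp A B a b)"
  have X: "X \<in> obs" using arrs_ob(2)[OF assms(3)] assms(5) by simp
  have b: "biadditive (mon_of A) (mon_of B) (mon_of X) ?\<beta>"
    using assms by (intro biadditiveI) (simp_all add: tp_mult mmap_mult)
  have g: "?\<beta> x y \<in> gens X" if "x \<in> gens A" "y \<in> gens B" for x y
    using that assms by simp
  show "curry_arr B A X f \<in> arrs" "src (curry_arr B A X f) = A" "tgt (curry_arr B A X f) = ihom B X"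
    "a \<in> carr A \<Longrightarrow> b \<in> carr B \<Longrightarrow> ev B X (mmap (curry_arr B A X f) a) b = mmap f (tp A B a b)"
    unfolding curry_arr_def using cur[OF assms(2,1) X b g] by auto
qed

text \<open>Both sides amount to the biadditive maps from A and B to X that send pairs of generators
  to generators. The preimage of h is \<open>tlift\<close> of its evaluation.\<close>

lemma bij_betw_curry_arr:
  assumes "B \<in> obs" "A \<in> obs" "X \<in> obs"
  shows "bij_betw (curry_arr B A X) (Hom cat_B (ten A B) X) (Hom cat_B A (ihom B X))"
proof (rule bij_betw_imageI)
  show "inj_on (curry_arr B A X) (Hom cat_B (ten A B) X)"
  proof (rule inj_onI)
    fix f f' assume f: "f \<in> Hom cat_B (ten A B) X" "f' \<in> Hom cat_B (ten A B) X"
      and e: "curry_arr B A X f = curry_arr B A X f'"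
    have "mmap f (tp A B x y) = mmap f' (tp A B x y)" if "x \<in> gens A" "y \<in> gens B" for x y
    proof -
      have "ev B X (mmap (curry_arr B A X f) x) y = ev B X (mmap (curry_arr B A X f') x) y"
        by (simp only: e)
      then show ?thesis using that f assms by (simp add: Hom_iff)
    qed
    then show "f = f'" using f by (intro B_pair.ten_arrow_eqI[OF B_pairI[OF assms(2,1)]])
  qed
  show "curry_arr B A X ` Hom cat_B (ten A B) X = Hom cat_B A (ihom B X)"
  proof (intro equalityI subsetI)
    fix h assume "h \<in> Hom cat_B A (ihom B X)"
    then have h: "h \<in> arrs" "src h = A" "tgt h = ihom B X" by (simp_all add: Hom_iff)
    let ?\<beta> = "\<lambda>a b. ev B X (mmap h a) b"
    have b: "biadditive (mon_of A) (mon_of B) (mon_of X) ?\<beta>"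
      using assms h by (intro biadditiveI) (simp_all add: ev_mult mmap_mult)
    have g: "?\<beta> x y \<in> gens X" if "x \<in> gens A" "y \<in> gens B" for x y
      using that assms h by simp
    note l = tlift[OF assms(2,1,3) b g]
    have "h = curry_arr B A X (tlift A B X ?\<beta>)"
      using h assms l by (intro ihom_arrs_eqI[OF assms(1,3)]) simp_all
    moreover have "tlift A B X ?\<beta> \<in> Hom cat_B (ten A B) X"
      using l by (simp add: Hom_iff)
    ultimately show "h \<in> curry_arr B A X ` Hom cat_B (ten A B) X" by blast
  qed (use assms in \<open>auto simp: Hom_iff\<close>)
qed

lemma is_functor_ihom:
  assumes "B \<in> obs"
  shows "is_functor monoidal_B monoidal_B (ihom B) (ihomA B)"
  unfolding is_functor_def
proof (intro conjI ballI)
  fix X assume "X \<in> Ob (monoidal_B :: (('u, 'u) cobj, ('u, 'u) carrow) monoidal_cat)"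
  then show "ihomA B (Ident monoidal_B X) = Ident monoidal_B (ihom B X)"
    using assms by (intro ihom_arrs_eqI[of B X]) simp_all
next
  fix X Y Z f g
  assume "f \<in> Hom monoidal_B X Y" "g \<in> Hom monoidal_B Y (Z :: ('u, 'u) cobj)"
  then show "ihomA B (g \<cdot>\<^bsub>monoidal_B\<^esub> f) = ihomA B g \<cdot>\<^bsub>monoidal_B\<^esub> ihomA B f"
    using assms by (intro ihom_arrs_eqI[of B Z]) (auto simp: Hom_iff)
qed (use assms in \<open>auto simp: Hom_iff\<close>)

lemma monoidal_closed_monoidal_B:
  "monoidal_closed (monoidal_B :: (('u, 'u) cobj, ('u, 'u) carrow) monoidal_cat)"
  unfolding monoidal_closed_def has_right_adjoint_def
proof (intro ballI exI conjI)
  fix B assume "B \<in> Ob (monoidal_B :: (('u, 'u) cobj, ('u, 'u) carrow) monoidal_cat)"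
  then have B: "B \<in> obs" by simp
  show "is_functor monoidal_B monoidal_B (ihom B) (ihomA B)" by (rule is_functor_ihom[OF B])
  show "bij_betw (curry_arr B A X) (Hom monoidal_B (A \<odot>\<^bsub>monoidal_B\<^esub> B) X) (Hom monoidal_B A (ihom B X))"
    if "A \<in> Ob monoidal_B" "X \<in> Ob monoidal_B" for A X
    using bij_betw_curry_arr[OF B] that by simp
  fix A A' X X' h f k
  assume "A \<in> Ob monoidal_B" "A' \<in> Ob monoidal_B" "X \<in> Ob monoidal_B" "X' \<in> Ob monoidal_B"
    "h \<in> Hom monoidal_B A' A" "f \<in> Hom monoidal_B (A \<odot>\<^bsub>monoidal_B\<^esub> B) X" "k \<in> Hom monoidal_B X (X' :: ('u, 'u) cobj)"
  then show "curry_arr B A' X' (k \<cdot>\<^bsub>monoidal_B\<^esub> f \<cdot>\<^bsub>monoidal_B\<^esub> (h \<odot>\<^sub>a\<^bsub>monoidal_B\<^esub> Ident monoidal_B B)) =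
      ihomA B k \<cdot>\<^bsub>monoidal_B\<^esub> curry_arr B A X f \<cdot>\<^bsub>monoidal_B\<^esub> h"
    using B by (intro ihom_arrs_eqI[of B X']) (auto simp: Hom_iff)
qed

end

section \<open>Limits and colimits\<close>

lemma small_insert:
  assumes "inaccessible TYPE('u)" "small TYPE('u) S"
  shows "small TYPE('u) (insert x S)"
proof -
  have "small TYPE('u) (\<Union>b \<in> UNIV. if b then S else {x})"
    by (rule small_UN[OF assms(1)])
      (simp_all add: assms(2) small_countable[OF assms(1)] del: UN_simps)
  moreover have "(\<Union>b \<in> UNIV. if b then S else {x}) = insert x S"
    by (auto split: if_splits intro: exI[of _ True] exI[of _ False])
  ultimately show ?thesis by simp
qed

locale small_diagram = universe U for U :: "'u itself" +
  fixes J :: "('u, 'u) cat" and Fo :: "'u \<Rightarrow> ('u, 'u) cobj" and Fa :: "'u \<Rightarrow> ('u, 'u) carrow"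
  assumes small_category: "small_category TYPE('u) J"
    and is_functor: "is_functor J monoidal_B Fo Fa"
begin

interpretation J: category J
  using small_category by (simp add: small_category_def)

lemma Dom_Cod [simp]: "f \<in> Arr J \<Longrightarrow> Dom J f \<in> Ob J" "f \<in> Arr J \<Longrightarrow> Cod J f \<in> Ob J"
  using J.dom_cod by auto

lemma Fo_obs [simp]: "j \<in> Ob J \<Longrightarrow> Fo j \<in> obs"
  using is_functor by (simp add: is_functor_def)

lemma Fa_arrs [simp]:
  assumes "f \<in> Arr J"
  shows "Fa f \<in> arrs" "src (Fa f) = Fo (Dom J f)" "tgt (Fa f) = Fo (Cod J f)"
proof -
  have "Fa f \<in> Hom cat_B (Fo (Dom J f)) (Fo (Cod J f))"
    using is_functor assms Dom_Cod[OF assms] unfolding is_functor_def Hom_monoidal_B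
    by (simp add: Hom_def[of J])
  then show "Fa f \<in> arrs" "src (Fa f) = Fo (Dom J f)" "tgt (Fa f) = Fo (Cod J f)"
    by (simp_all add: Hom_iff)
qed

lemma small_Ob: "small TYPE('u) (Ob J)"
  using small_category by (simp add: small_category_def)

lemma small_Fo: "j \<in> Ob J \<Longrightarrow> small TYPE('u) (gens (Fo j))"
  using B_object.small_gens[OF B_objectI, of "Fo j"] by simp

section \<open>Limits\<close>

abbreviation lim_mon :: "('u \<Rightarrow> 'u) monoid" where
  "lim_mon \<equiv> product_group (Ob J) (\<lambda>j. mon_of (Fo j))"

definition lim_gens :: "('u \<Rightarrow> 'u) set" where
  "lim_gens = {s \<in> (\<Pi>\<^sub>E j \<in> Ob J. gens (Fo j)). \<forall>f \<in> Arr J. mmap (Fa f) (s (Dom J f)) = s (Cod J f)}"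

lemma lim_gensD:
  "s \<in> lim_gens \<Longrightarrow> j \<in> Ob J \<Longrightarrow> s j \<in> gens (Fo j)"
  "s \<in> lim_gens \<Longrightarrow> f \<in> Arr J \<Longrightarrow> mmap (Fa f) (s (Dom J f)) = s (Cod J f)"
  by (auto simp: lim_gens_def)

interpretation L: small_generators lim_mon lim_gens U
proof (intro small_generators.intro small_generators_axioms.intro comm_monoid_product_group
    comm_monoid_ob Fo_obs inaccessible)
  show "lim_gens \<subseteq> carrier lim_mon"
    by (auto simp: lim_gens_def PiE_iff extensional_def)
  show "\<one>\<^bsub>lim_mon\<^esub> \<in> lim_gens"
    by (auto simp: lim_gens_def)
  have "lim_gens \<subseteq> (\<Pi>\<^sub>E j \<in> Ob J. gens (Fo j))" by (auto simp: lim_gens_def)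
  then show "small TYPE('u) lim_gens"
    using small_PiE[OF inaccessible small_Ob small_Fo] by (rule small_subset[rotated])
qed

text \<open>The legs of a cone preserve generators and are compatible, so they send a generator of
  the vertex to an element of \<open>lim_gens\<close>. The map into the product therefore lands in
  the encoded submonoid.\<close>

lemma limit_exists: "\<exists>L \<pi>. is_limit J monoidal_B Fo Fa L \<pi>"
proof -
  have L: "L.T \<in> obs" by (rule L.obj_of_in_Ob)
  have lim: "s \<in> generated lim_mon lim_gens \<Longrightarrow> s \<in> (\<Pi>\<^sub>E j \<in> Ob J. carr (Fo j))" for s
    using L.generated_closed[OF L.S_closed, of s] by simp
  have "\<exists>p. p \<in> Hom cat_B L.T (Fo j) \<and> (\<forall>t \<in> carr L.T. mmap p t = L.d t j)" if j: "j \<in> Ob J" for j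
  proof -
    let ?g = "\<lambda>s \<in> generated lim_mon lim_gens. s j"
    have "?g \<in> mon_hom (lim_mon\<lparr>carrier := generated lim_mon lim_gens\<rparr>) (mon_of (Fo j))"
    proof (rule mon_homI)
      fix a b assume ab: "a \<in> carrier (lim_mon\<lparr>carrier := generated lim_mon lim_gens\<rparr>)"
        "b \<in> carrier (lim_mon\<lparr>carrier := generated lim_mon lim_gens\<rparr>)"
      then have "a \<otimes>\<^bsub>lim_mon\<^esub> b \<in> generated lim_mon lim_gens"
        using L.generated_mult[OF L.S_closed, of a b] by simp
      then show "?g (a \<otimes>\<^bsub>lim_mon\<lparr>carrier := generated lim_mon lim_gens\<rparr>\<^esub> b) = ?g a \<otimes>\<^bsub>mon_of (Fo j)\<^esub> ?g b"
        using ab j by simp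
      show "?g a \<in> carr (Fo j)" using ab(1) j lim[of a] by auto
    next
      show "?g \<one>\<^bsub>lim_mon\<lparr>carrier := generated lim_mon lim_gens\<rparr>\<^esub> = \<one>\<^bsub>mon_of (Fo j)\<^esub>"
        using generated.one[of lim_mon lim_gens] j by simp
    qed simp
    moreover have "?g s \<in> gens (Fo j)" if "s \<in> lim_gens" for s
      using that j L.S_generated by (simp add: lim_gensD)
    ultimately obtain p where p: "p \<in> Hom cat_B L.T (Fo j)" "\<And>t. t \<in> carr L.T \<Longrightarrow> mmap p t = ?g (L.d t)"
      using L.arrow_from_obj_of[OF Fo_obs[OF j]] by blast
    then show ?thesis using L.dec_closed by auto
  qed
  then obtain \<pi> where \<pi>: "\<And>j. j \<in> Ob J \<Longrightarrow> \<pi> j \<in> Hom cat_B L.T (Fo j)"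
    "\<And>j t. j \<in> Ob J \<Longrightarrow> t \<in> carr L.T \<Longrightarrow> mmap (\<pi> j) t = L.d t j"
    by metis
  have \<pi>_arrs: "\<pi> j \<in> arrs" "src (\<pi> j) = L.T" "tgt (\<pi> j) = Fo j" if "j \<in> Ob J" for j
    using \<pi>(1)[OF that] by (simp_all add: Hom_iff)
  \<comment> \<open>The projections are jointly injective, since an element is a family determined
    by its coordinates; this gives uniqueness below.\<close>
  have ext: "t = t'" if "t \<in> carr L.T" "t' \<in> carr L.T" "\<And>j. j \<in> Ob J \<Longrightarrow> L.d t j = L.d t' j" for t t'
  proof -
    have "L.d t = L.d t'"
      using that lim[OF L.dec_closed] by (intro PiE_ext[of _ "Ob J"]) auto
    then show ?thesis using that L.enc_dec by metis
  qed
  have "cone J monoidal_B Fo Fa L.T \<pi>"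
    unfolding cone_def
  proof (intro conjI ballI)
    fix f assume f: "f \<in> Arr J"
    show "Fa f \<cdot>\<^bsub>monoidal_B\<^esub> \<pi> (Dom J f) = \<pi> (Cod J f)"
    proof (simp, rule arrs_eqI)
      \<comment> \<open>Compatibility of the projections has to be checked on generators only, and
        there it is the condition in \<open>lim_gens\<close>.\<close>
      fix x assume "x \<in> gens (src (Fa f \<cdot>\<^bsub>cat_B\<^esub> \<pi> (Dom J f)))"
      then obtain s where "s \<in> lim_gens" "x = L.e s"
        using f by (auto simp: \<pi>_arrs L.gens_obj_of)
      then show "mmap (Fa f \<cdot>\<^bsub>cat_B\<^esub> \<pi> (Dom J f)) x = mmap (\<pi> (Cod J f)) x"
        using f by (simp add: \<pi>_arrs \<pi> L.enc_closed L.S_generated L.dec_enc lim_gensD)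
    qed (use f in \<open>simp_all add: \<pi>_arrs\<close>)
  qed (simp_all add: L \<pi>)
  moreover have "\<exists>!u. u \<in> Hom monoidal_B L' L.T \<and> (\<forall>j \<in> Ob J. \<pi> j \<cdot>\<^bsub>monoidal_B\<^esub> u = \<pi>' j)"
    if c: "cone J monoidal_B Fo Fa L' \<pi>'" for L' \<pi>'
  proof -
    have L': "L' \<in> obs" and \<pi>': "\<And>j. j \<in> Ob J \<Longrightarrow> \<pi>' j \<in> arrs \<and> src (\<pi>' j) = L' \<and> tgt (\<pi>' j) = Fo j"
      and comm: "\<And>f. f \<in> Arr J \<Longrightarrow> Fa f \<cdot>\<^bsub>cat_B\<^esub> \<pi>' (Dom J f) = \<pi>' (Cod J f)"
      using c by (simp_all add: cone_def Hom_iff)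
    let ?g = "\<lambda>a \<in> carr L'. \<lambda>j \<in> Ob J. mmap (\<pi>' j) a"
    have "?g \<in> mon_hom (mon_of L') lim_mon"
      by (rule mon_homI) (use L' \<pi>' in \<open>auto simp: mmap_mult[where X = L']\<close>)
    moreover have "?g x \<in> lim_gens" if x: "x \<in> gens L'" for x
    proof -
      have "mmap (Fa f) (mmap (\<pi>' (Dom J f)) x) = mmap (\<pi>' (Cod J f)) x" if f: "f \<in> Arr J" for f
        using f x L' \<pi>'[of "Dom J f"] unfolding comm[OF f, symmetric] by (subst mmap_Comp_eq) auto
      then show ?thesis using x L' \<pi>' by (auto simp: lim_gens_def)
    qed
    ultimately obtain u where u: "u \<in> Hom cat_B L' L.T" "\<And>a. a \<in> carr L' \<Longrightarrow> L.d (mmap u a) = ?g a"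
      using L.arrow_to_obj_of[OF L'] by blast
    have u': "u \<in> arrs" "src u = L'" "tgt u = L.T" using u(1) by (simp_all add: Hom_iff)
    show ?thesis
    proof (rule ex1I[of _ u], intro conjI ballI)
      fix j assume j: "j \<in> Ob J"
      show "\<pi> j \<cdot>\<^bsub>monoidal_B\<^esub> u = \<pi>' j"
        using j u' L' \<pi>'[OF j] by (simp, intro arrs_eqI) (simp_all add: \<pi>_arrs \<pi> u(2))
    next
      fix v assume v: "v \<in> Hom monoidal_B L' L.T \<and> (\<forall>j \<in> Ob J. \<pi> j \<cdot>\<^bsub>monoidal_B\<^esub> v = \<pi>' j)"
      then have v': "v \<in> arrs" "src v = L'" "tgt v = L.T" by (simp_all add: Hom_iff)
      show "v = u"
      proof (rule arrs_eqI)
        fix x assume "x \<in> gens (src v)"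
        then have x: "x \<in> carr L'" using v' L' by simp
        show "mmap v x = mmap u x"
        proof (rule ext)
          fix j assume j: "j \<in> Ob J"
          have "L.d (mmap v x) j = mmap (\<pi> j \<cdot>\<^bsub>cat_B\<^esub> v) x"
            using v' x j by (simp add: \<pi>)
          then show "L.d (mmap v x) j = L.d (mmap u x) j"
            using v x j by (simp add: u(2))
        qed (use u' v' x in simp_all)
      qed (use u' v' in simp_all)
    qed (use u in simp)
  qed
  ultimately show ?thesis unfolding is_limit_def by blast
qed

section \<open>Colimits\<close>

abbreviation colim_set :: "('u \<times> 'u) set" where
  "colim_set \<equiv> (SIGMA j:Ob J. carr (Fo j))"

text \<open>The homomorphism on formal sums of elements of all monoids of the diagram that is
  induced by the cocone.\<close>

definition cocone_val :: "('u, 'u) cobj \<Rightarrow> ('u \<Rightarrow> ('u, 'u) carrow) \<Rightarrow> ('u \<times> 'u) multiset \<Rightarrow> 'u" where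
  "cocone_val X \<iota> = mprod (mon_of X) (\<lambda>(j, a). mmap (\<iota> j) a)"

text \<open>Two formal sums are identified if every cocone identifies them, which makes the universal
  property immediate.\<close>

definition colim_rel :: "(('u \<times> 'u) multiset \<times> ('u \<times> 'u) multiset) set" where
  "colim_rel = {(s, t). set_mset s \<subseteq> colim_set \<and> set_mset t \<subseteq> colim_set \<and>
     (\<forall>X \<iota>. cocone J monoidal_B Fo Fa X \<iota> \<longrightarrow> cocone_val X \<iota> s = cocone_val X \<iota> t)}"

lemma coconeD:
  assumes "cocone J monoidal_B Fo Fa X \<iota>"
  shows "X \<in> obs" "j \<in> Ob J \<Longrightarrow> \<iota> j \<in> arrs" "j \<in> Ob J \<Longrightarrow> src (\<iota> j) = Fo j" "j \<in> Ob J \<Longrightarrow> tgt (\<iota> j) = X"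
    "f \<in> Arr J \<Longrightarrow> \<iota> (Cod J f) \<cdot>\<^bsub>cat_B\<^esub> Fa f = \<iota> (Dom J f)"
  using assms by (simp_all add: cocone_def Hom_iff)

lemma cocone_val_closed:
  assumes "cocone J monoidal_B Fo Fa X \<iota>"
  shows "(\<lambda>(j, a). mmap (\<iota> j) a) \<in> colim_set \<rightarrow> carr X"
  by (auto simp: coconeD[OF assms])

lemma cocone_val_union:
  assumes "cocone J monoidal_B Fo Fa X \<iota>" "set_mset s \<subseteq> colim_set" "set_mset t \<subseteq> colim_set"
  shows "cocone_val X \<iota> (s + t) = cocone_val X \<iota> s \<otimes>\<^bsub>mon_of X\<^esub> cocone_val X \<iota> t"
  unfolding cocone_val_def
  using cocone_val_closed[OF assms(1)] assms(2,3)
  by (intro comm_monoid.mprod_union comm_monoid_ob coconeD(1)[OF assms(1)]) blast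

lemma cocone_val_simps:
  assumes "cocone J monoidal_B Fo Fa X \<iota>"
  shows "cocone_val X \<iota> {#} = \<one>\<^bsub>mon_of X\<^esub>"
    "j \<in> Ob J \<Longrightarrow> a \<in> carr (Fo j) \<Longrightarrow> cocone_val X \<iota> {#(j, a)#} = mmap (\<iota> j) a"
    "j \<in> Ob J \<Longrightarrow> a \<in> carr (Fo j) \<Longrightarrow> b \<in> carr (Fo j) \<Longrightarrow>
      cocone_val X \<iota> {#(j, a), (j, b)#} = mmap (\<iota> j) a \<otimes>\<^bsub>mon_of X\<^esub> mmap (\<iota> j) b"
proof -
  interpret X: comm_monoid "mon_of X" by (rule comm_monoid_ob[OF coconeD(1)[OF assms]])
  show "cocone_val X \<iota> {#} = \<one>\<^bsub>mon_of X\<^esub>" by (simp add: cocone_val_def)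
  show 1: "cocone_val X \<iota> {#(j, a)#} = mmap (\<iota> j) a" if "j \<in> Ob J" "a \<in> carr (Fo j)" for j a
    using that by (simp add: cocone_val_def coconeD[OF assms])
  show "j \<in> Ob J \<Longrightarrow> a \<in> carr (Fo j) \<Longrightarrow> b \<in> carr (Fo j) \<Longrightarrow>
      cocone_val X \<iota> {#(j, a), (j, b)#} = mmap (\<iota> j) a \<otimes>\<^bsub>mon_of X\<^esub> mmap (\<iota> j) b"
    using cocone_val_union[OF assms, of "{#(j, b)#}" "{#(j, a)#}"]
    by (simp add: 1 X.m_comm coconeD[OF assms])
qed

interpretation R: mset_congruence colim_set colim_rel
proof
  show "equiv {s. set_mset s \<subseteq> colim_set} colim_rel"
    by (auto simp: equiv_def refl_on_def sym_def trans_def colim_rel_def)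
qed (auto simp: colim_rel_def cocone_val_union)

text \<open>The neutral element is inserted for the empty diagram. Otherwise it is already the class
  of a neutral generator, since every cocone sends that generator to the neutral element.\<close>

definition colim_gens :: "('u \<times> 'u) multiset set set" where
  "colim_gens = insert \<one>\<^bsub>R.Q\<^esub> ((\<lambda>z. R.cls {#z#}) ` (SIGMA j:Ob J. gens (Fo j)))"

interpretation C: small_generators R.Q colim_gens U
proof (intro small_generators.intro small_generators_axioms.intro R.comm_monoid_quot_mon inaccessible)
  show "colim_gens \<subseteq> carrier R.Q"
    by (auto simp: colim_gens_def R.one_quot_mon intro!: R.cls_closed)
  show "small TYPE('u) colim_gens"
    unfolding colim_gens_def
    by (intro small_insert small_image small_Sigma small_Ob small_Fo inaccessible)
qed (simp add: colim_gens_def)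

text \<open>The legs are additive and compatible in the quotient because they are so under every
  cocone. A given cocone factors through the quotient by evaluation with \<open>cocone_val\<close>,
  which \<open>colim_rel\<close> respects by its definition.\<close>

lemma colimit_exists: "\<exists>L \<iota>. is_colimit J monoidal_B Fo Fa L \<iota>"
proof -
  have C: "C.T \<in> obs" by (rule C.obj_of_in_Ob)
  have "\<exists>i. i \<in> Hom cat_B (Fo j) C.T \<and> (\<forall>a \<in> carr (Fo j). C.d (mmap i a) = R.cls {#(j, a)#})"
    if j: "j \<in> Ob J" for j
  proof -
    let ?g = "\<lambda>a \<in> carr (Fo j). R.cls {#(j, a)#}"
    have "?g \<in> mon_hom (mon_of (Fo j)) R.Q"
    proof (rule mon_homI)
      fix a b assume ab: "a \<in> carr (Fo j)" "b \<in> carr (Fo j)"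
      have "R.cls {#(j, a \<otimes>\<^bsub>mon_of (Fo j)\<^esub> b)#} = R.cls {#(j, a), (j, b)#}"
        using ab j
        by (subst R.cls_eq_iff) (auto simp: colim_rel_def cocone_val_simps coconeD mmap_mult)
      then show "?g (a \<otimes>\<^bsub>mon_of (Fo j)\<^esub> b) = ?g a \<otimes>\<^bsub>R.Q\<^esub> ?g b"
        using ab j by (simp add: R.mult_cls add_mset_commute)
      show "?g a \<in> carrier R.Q" using ab j by (auto intro!: R.cls_closed)
    next
      have "R.cls {#(j, \<one>\<^bsub>mon_of (Fo j)\<^esub>)#} = R.cls {#}"
        using j by (subst R.cls_eq_iff) (auto simp: colim_rel_def cocone_val_simps coconeD)
      then show "?g \<one>\<^bsub>mon_of (Fo j)\<^esub> = \<one>\<^bsub>R.Q\<^esub>" using j by (simp add: R.one_quot_mon)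
    qed simp
    moreover have "?g x \<in> colim_gens" if "x \<in> gens (Fo j)" for x
      using that j by (auto simp: colim_gens_def)
    ultimately obtain i where "i \<in> Hom cat_B (Fo j) C.T" "\<And>a. a \<in> carr (Fo j) \<Longrightarrow> C.d (mmap i a) = ?g a"
      using C.arrow_to_obj_of[OF Fo_obs[OF j]] by blast
    then show ?thesis by auto
  qed
  then obtain \<iota> where \<iota>: "\<And>j. j \<in> Ob J \<Longrightarrow> \<iota> j \<in> Hom cat_B (Fo j) C.T"
    "\<And>j a. j \<in> Ob J \<Longrightarrow> a \<in> carr (Fo j) \<Longrightarrow> C.d (mmap (\<iota> j) a) = R.cls {#(j, a)#}"
    by metis
  have \<iota>_arrs: "\<iota> j \<in> arrs" "src (\<iota> j) = Fo j" "tgt (\<iota> j) = C.T" if "j \<in> Ob J" for j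
    using \<iota>(1)[OF that] by (simp_all add: Hom_iff)
  have ext: "t = t'" if "t \<in> carr C.T" "t' \<in> carr C.T" "C.d t = C.d t'" for t t'
    using that C.enc_dec by metis
  have "cocone J monoidal_B Fo Fa C.T \<iota>"
    unfolding cocone_def
  proof (intro conjI ballI)
    fix f assume f: "f \<in> Arr J"
    show "\<iota> (Cod J f) \<cdot>\<^bsub>monoidal_B\<^esub> Fa f = \<iota> (Dom J f)"
    proof (simp, rule arrs_eqI)
      fix x assume "x \<in> gens (src (\<iota> (Cod J f) \<cdot>\<^bsub>cat_B\<^esub> Fa f))"
      then have x: "x \<in> carr (Fo (Dom J f))" using f by simp
      have "cocone_val X i {#(Cod J f, mmap (Fa f) x)#} = cocone_val X i {#(Dom J f, x)#}"
        if c: "cocone J monoidal_B Fo Fa X i" for X i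
        using f x coconeD(5)[OF c f, symmetric] by (simp add: cocone_val_simps[OF c])
      then have "R.cls {#(Cod J f, mmap (Fa f) x)#} = R.cls {#(Dom J f, x)#}"
        using f x by (subst R.cls_eq_iff) (auto simp: colim_rel_def)
      then show "mmap (\<iota> (Cod J f) \<cdot>\<^bsub>cat_B\<^esub> Fa f) x = mmap (\<iota> (Dom J f)) x"
        using f x by - (rule ext, simp_all add: \<iota> \<iota>_arrs)
    qed (use f in \<open>simp_all add: \<iota>_arrs\<close>)
  qed (simp_all add: C \<iota>)
  moreover have "\<exists>!u. u \<in> Hom monoidal_B C.T X \<and> (\<forall>j \<in> Ob J. u \<cdot>\<^bsub>monoidal_B\<^esub> \<iota> j = i j)"
    if c: "cocone J monoidal_B Fo Fa X i" for X i
  proof -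
    note i = coconeD[OF c]
    have "\<And>s t. (s, t) \<in> colim_rel \<Longrightarrow> cocone_val X i s = cocone_val X i t"
      using c by (auto simp: colim_rel_def)
    then obtain h where h: "h \<in> mon_hom R.Q (mon_of X)"
      "\<And>s. set_mset s \<subseteq> colim_set \<Longrightarrow> h (R.cls s) = cocone_val X i s"
      using R.quot_mon_lift[OF comm_monoid_ob[OF i(1)] cocone_val_closed[OF c]]
      unfolding cocone_val_def by blast
    let ?Q = "R.Q\<lparr>carrier := generated R.Q colim_gens\<rparr>"
    have gc: "a \<in> carrier R.Q" if "a \<in> generated R.Q colim_gens" for a
      using C.generated_closed[OF C.S_closed that] .
    have "restrict h (generated R.Q colim_gens) \<in> mon_hom ?Q (mon_of X)"
      by (rule mon_homI)
        (simp_all add: gc mon_homD[OF h(1)] C.generated_mult[OF C.S_closed] generated.one)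
    moreover have "restrict h (generated R.Q colim_gens) g \<in> gens X" if "g \<in> colim_gens" for g
      using that C.S_generated[OF that] i(1-4) mon_homD(4)[OF h(1)]
      by (auto simp: colim_gens_def h(2) cocone_val_simps[OF c])
    ultimately obtain u where u: "u \<in> Hom cat_B C.T X"
      "\<And>t. t \<in> carr C.T \<Longrightarrow> mmap u t = restrict h (generated R.Q colim_gens) (C.d t)"
      using C.arrow_from_obj_of[OF i(1)] by blast
    have u': "u \<in> arrs" "src u = C.T" "tgt u = X" using u(1) by (simp_all add: Hom_iff)
    show ?thesis
    proof (rule ex1I[of _ u], intro conjI ballI)
      fix j assume j: "j \<in> Ob J"
      have "mmap u (mmap (\<iota> j) a) = mmap (i j) a" if a: "a \<in> carr (Fo j)" for a
      proof -
        have "mmap (\<iota> j) a \<in> carr C.T" using a j by (simp add: \<iota>_arrs)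
        then have "mmap u (mmap (\<iota> j) a) = h (R.cls {#(j, a)#})"
          using C.dec_closed[of "mmap (\<iota> j) a"] a j by (simp add: u(2) \<iota>)
        then show ?thesis using a j by (simp add: h(2) cocone_val_simps[OF c])
      qed
      then show "u \<cdot>\<^bsub>monoidal_B\<^esub> \<iota> j = i j"
        using j u' i(2-4)[OF j] by (simp, intro arrs_eqI) (simp_all add: \<iota>_arrs)
    next
      fix v assume v: "v \<in> Hom monoidal_B C.T X \<and> (\<forall>j \<in> Ob J. v \<cdot>\<^bsub>monoidal_B\<^esub> \<iota> j = i j)"
      then have v': "v \<in> arrs" "src v = C.T" "tgt v = X" by (simp_all add: Hom_iff)
      show "v = u"
      proof (rule arrs_eqI)
        fix x assume "x \<in> gens (src v)"
        then obtain g where g: "g \<in> colim_gens" "x = C.e g"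
          by (auto simp: v' C.gens_obj_of)
        \<comment> \<open>A generator other than the inserted neutral element comes from a leg,
          where u and v agree because both factor the cocone. The neutral element is treated apart
          since an empty diagram has no legs.\<close>
        then have "g = \<one>\<^bsub>R.Q\<^esub> \<or> (\<exists>j \<in> Ob J. \<exists>y \<in> gens (Fo j). g = R.cls {#(j, y)#})"
          unfolding colim_gens_def by auto
        then consider "x = \<one>\<^bsub>mon_of C.T\<^esub>" | j y where "j \<in> Ob J" "y \<in> gens (Fo j)" "x = C.e (R.cls {#(j, y)#})"
          unfolding g(2) C.one_obj_of by blast
        then show "mmap v x = mmap u x"
        proof cases
          case 1
          then show ?thesis using u' v' by simp
        next
          case (2 j y)
          have y: "y \<in> carr (Fo j)" using 2 by simp
          have "R.cls {#(j, y)#} \<in> colim_gens" using 2 by (auto simp: colim_gens_def)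
          then have xc: "x \<in> carr C.T" "C.d x = R.cls {#(j, y)#}"
            using 2 C.enc_closed C.dec_enc C.S_generated by auto
          have "x = mmap (\<iota> j) y"
            using 2(1) y xc by - (rule ext, simp_all add: \<iota> \<iota>_arrs)
          moreover have "mmap v (mmap (\<iota> j) y) = mmap (v \<cdot>\<^bsub>cat_B\<^esub> \<iota> j) y"
            using 2 y by (simp add: \<iota>_arrs)
          moreover have "v \<cdot>\<^bsub>cat_B\<^esub> \<iota> j = i j" using 2 v by simp
          moreover have "mmap u (mmap (\<iota> j) y) = mmap (i j) y"
            using xc C.dec_closed[OF xc(1)] 2 y
            by (simp add: u(2) h(2) cocone_val_simps[OF c] flip: \<open>x = mmap (\<iota> j) y\<close>)
          ultimately show ?thesis by simp
        qed
      qed (use u' v' in simp_all)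
    qed (use u in simp)
  qed
  ultimately show ?thesis unfolding is_colimit_def by blast
qed

end

theorem theorem3p5:
  assumes "inaccessible TYPE('u)"
  shows "\<exists>C :: (('u, 'u) cobj, ('u, 'u) carrow) monoidal_cat.
           cat.truncate C = cat_B \<and> symmetric_monoidal_category C \<and> natural_structure C \<and>
           monoidal_closed C \<and> complete_category TYPE('u) C \<and> cocomplete_category TYPE('u) C"
proof -
  interpret universe "TYPE('u)" by unfold_locales (rule assms)
  have d: "small_diagram J Fo Fa"
    if "small_category TYPE('u) J \<and> is_functor J monoidal_B Fo Fa"
    for J :: "('u, 'u) cat" and Fo :: "'u \<Rightarrow> ('u, 'u) cobj" and Fa
    using that by unfold_locales auto
  have "complete_category TYPE('u) (monoidal_B :: (('u, 'u) cobj, ('u, 'u) carrow) monoidal_cat)"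
    unfolding complete_category_def using small_diagram.limit_exists[OF d] by blast
  moreover have "cocomplete_category TYPE('u) (monoidal_B :: (('u, 'u) cobj, ('u, 'u) carrow) monoidal_cat)"
    unfolding cocomplete_category_def using small_diagram.colimit_exists[OF d] by blast
  ultimately show ?thesis
    using truncate_monoidal_B symmetric_monoidal_category_monoidal_B natural_structure_monoidal_B
      monoidal_closed_monoidal_B by blast
qed

end
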